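(* The following holds for all sufficiently large $m \leq n^2/4$. Every $n$-vertex graph with $m$ edges which has the maximum number of proper 3-colorings among all $n$-vertex graphs with $m$ edges is either (i) a semi-complete subgraph of some $K_{a,b}$, plus isolated vertices if necessary, or (ii) a complete bipartite graph $K_{a,b}$ plus a pendant edge. Furthermore: - If $m \leq \kappa_3 n^2$, then $a = (1+o(1))\sqrt{m \cdot \frac{\log 3/2}{\log 3}}$ and $b = (1+o(1))\sqrt{m \cdot \frac{\log 3}{\log 3/2}}$, and the corresponding number of 3-colorings is $3^n e^{-(c+o(1))\sqrt{m}}$, where $c = 2\sqrt{ \log \frac{3}{2} \cdot \log 3 }$. - If $\kappa_3 n^2 \leq m \leq \frac{1}{4} n^2$, then $a = (1+o(1))\frac{n-\sqrt{n^2-4m}}{2}$ and $b = (1+o(1))\frac{n+\sqrt{n^2-4m}}{2}$, and the corresponding number of 3-colorings is $2^{b + o(n)}$.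
   Context: All logarithms are natural. $\kappa_3 = \left( \sqrt{\frac{\log (3/2)}{\log 3}} + \sqrt{\frac{\log 3}{\log (3/2)}} \right)^{-2}$. $o(1)$ denotes a quantity tending to $0$ as $m,n\to\infty$. Semi-complete subgraph: for positive integers $a \leq b$, a graph is a semi-complete subgraph of $K_{a,b}$ if it is obtained from $K_{a,b}$ by deleting fewer than $a$ edges which all share a common endpoint (the missing edges form a star). A pendant edge means a new vertex is added together with a single edge joining it to some vertex of the graph. *)

theory Defs
  imports Complex_Main "HOL-Library.FuncSet" "HOL-Library.Ramsey"
begin

text \<open>A finite simple graph is a vertex set together with a set of edges, each edge being a
  two-element set of vertices (\<^const>\<open>nsets\<close> \<open>V 2\<close>). Vertices not covered by an edge are isolated.\<close>

definition simple_graph :: "'a set \<Rightarrow> 'a set set \<Rightarrow> bool" where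
  "simple_graph V E \<longleftrightarrow> finite V \<and> E \<subseteq> nsets V 2"

definition proper_colorings :: "nat \<Rightarrow> 'a set \<Rightarrow> 'a set set \<Rightarrow> ('a \<Rightarrow> nat) set" where
  "proper_colorings q V E =
     {f \<in> V \<rightarrow>\<^sub>E {..<q}. \<forall>x y. {x, y} \<in> E \<longrightarrow> f x \<noteq> f y}"

definition num_colorings :: "nat \<Rightarrow> 'a set \<Rightarrow> 'a set set \<Rightarrow> nat" where
  "num_colorings q V E = card (proper_colorings q V E)"

definition graph_with :: "nat \<Rightarrow> nat \<Rightarrow> 'a set \<Rightarrow> 'a set set \<Rightarrow> bool" where
  "graph_with n m V E \<longleftrightarrow> simple_graph V E \<and> card V = n \<and> card E = m"

definition maximizes_colorings :: "nat \<Rightarrow> nat \<Rightarrow> nat \<Rightarrow> 'a set \<Rightarrow> 'a set set \<Rightarrow> bool" where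
  "maximizes_colorings q n m V E \<longleftrightarrow>
     graph_with n m V E \<and>
     (\<forall>(V' :: 'a set) E'. graph_with n m V' E' \<longrightarrow> num_colorings q V' E' \<le> num_colorings q V E)"

definition complete_bipartite :: "nat \<Rightarrow> nat \<Rightarrow> 'a set \<Rightarrow> 'a set set \<Rightarrow> bool" where
  "complete_bipartite a b V E \<longleftrightarrow>
     (\<exists>A B. finite A \<and> finite B \<and> A \<inter> B = {} \<and> V = A \<union> B \<and> card A = a \<and> card B = b \<and>
            E = {{x, y} | x y. x \<in> A \<and> y \<in> B})"

text \<open>The deleted star \<open>D\<close> may be empty, and its centre \<open>v\<close> may lie in either class.\<close>

definition semi_complete :: "nat \<Rightarrow> nat \<Rightarrow> 'a set \<Rightarrow> 'a set set \<Rightarrow> bool" where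
  "semi_complete a b V E \<longleftrightarrow>
     1 \<le> a \<and> a \<le> b \<and>
     (\<exists>E0 D. complete_bipartite a b V E0 \<and> D \<subseteq> E0 \<and> card D < a \<and>
             (\<exists>v. \<forall>e\<in>D. v \<in> e) \<and> E = E0 - D)"

definition semi_complete_plus_isolated :: "nat \<Rightarrow> nat \<Rightarrow> 'a set \<Rightarrow> 'a set set \<Rightarrow> bool" where
  "semi_complete_plus_isolated a b V E \<longleftrightarrow> (\<exists>W\<subseteq>V. semi_complete a b W E)"

text \<open>Here \<open>v\<close> is the new vertex, so \<open>V\<close> has exactly \<open>a + b + 1\<close> vertices; the vertex \<open>u\<close> to which
  it is joined may lie in either class.\<close>

definition complete_bipartite_plus_pendant ::
    "nat \<Rightarrow> nat \<Rightarrow> 'a set \<Rightarrow> 'a set set \<Rightarrow> bool" where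
  "complete_bipartite_plus_pendant a b V E \<longleftrightarrow>
     1 \<le> a \<and> a \<le> b \<and>
     (\<exists>W E0 u v. complete_bipartite a b W E0 \<and> u \<in> W \<and> v \<notin> W \<and>
                 V = insert v W \<and> E = insert {u, v} E0)"

definition kappa3 :: real where
  "kappa3 = 1 / (sqrt (ln (3/2) / ln 3) + sqrt (ln 3 / ln (3/2)))\<^sup>2"

end

theory Submission
  imports Defs
begin

text \<open>By a container argument, a single assignment of colour lists to the vertices accounts for all
  3-colourings of a maximiser up to a factor \<open>e^(\<epsilon> sqrt m)\<close>, with \<open>\<epsilon>\<close> a small constant, and
  is such that on all but \<open>O(sqrt m)\<close> edges the lists of the two ends are disjoint. Give a split into classes of sizes \<open>x\<close> and \<open>m / x\<close> the cost \<open>x ln 3 + (m / x) ln (3/2)\<close>, the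
  logarithm of the factor it loses against \<open>3^n\<close>. Complete bipartite competitors show that the cost of
  the list assignment is nearly minimal, and since the cost grows quadratically away from its
  minimiser, one class of size about \<open>\<alpha>\<close> carries single colours and one of size about \<open>m / \<alpha>\<close> the
  complementary pairs; so the graph is nearly complete bipartite. A vertex outside the two classes,
  or an edge inside one of them, costs a constant factor that rebalancing the class sizes recovers,
  except in the pendant configuration. Finally, among the ways of deleting \<open>d < a\<close> edges from \<open>K_{a,b}\<close>
  a star keeps the most colourings, since the colourings in which the two sides share a colour
  correspond to complete bipartite subgraphs of the deleted edges. The asymptotics follow from the quadratic
  growth of the cost.\<close>

section \<open>List colourings\<close>

text \<open>The scale is L = sqrt m. A maximiser loses only a factor e^(O(L)) against 3^n, while
  half of the non-isolated vertices can be made to cost a factor 2/3 each; so there are O(L) of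
  them. This is why containers work with a constant degree threshold D: on O(L) vertices they forget
  only O(D L) edges, negligible against m = L^2, and lose only e^(O(\<eta> L)) colourings. The
  obstacle is that an error e^(\<epsilon> L) says nothing about single edges or vertices, where only
  bounded factors are at stake. The bridge is a statement about colourings instead of graphs: all
  but 3/1000 of them are constant on one of the two classes, since every other pattern is
  exponentially rare. From then on each defect has a price such as 2/3 or 1/2, to be compared with a
  complete bipartite competitor. Delicate is the situation in which no vertex is left over to
  enlarge a class; in its tightest instance even the factor 1000/997 is too coarse and colourings
  are counted exactly.\<close>

definition list_colorings :: "'a set \<Rightarrow> 'a set set \<Rightarrow> ('a \<Rightarrow> nat set) \<Rightarrow> ('a \<Rightarrow> nat) set" where
  "list_colorings V E A = {f \<in> PiE V A. \<forall>x\<in>V. \<forall>y\<in>V. {x, y} \<in> E \<longrightarrow> f x \<noteq> f y}"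

abbreviation cols3 :: "'a set \<Rightarrow> 'a set set \<Rightarrow> ('a \<Rightarrow> nat) set" where
  "cols3 V E \<equiv> list_colorings V E (\<lambda>_. {..<3})"

lemma simple_graph_edge:
  assumes "simple_graph V E" "{x, y} \<in> E" shows "x \<in> V" "y \<in> V" "x \<noteq> y"
proof -
  have "{x, y} \<in> nsets V 2" using assms unfolding simple_graph_def by blast
  then have "{x, y} \<subseteq> V" "card {x, y} = 2" by (simp_all add: nsets_def)
  then show "x \<in> V" "y \<in> V" "x \<noteq> y" by auto
qed

lemma num_colorings_cols3:
  assumes "simple_graph V E" shows "num_colorings 3 V E = card (cols3 V E)"
proof -
  have "proper_colorings 3 V E = cols3 V E"
    unfolding proper_colorings_def list_colorings_def using simple_graph_edge[OF assms] by blast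
  then show ?thesis by (simp add: num_colorings_def)
qed

lemma finite_list_colorings [simp]:
  assumes "finite V" "\<And>v. v \<in> V \<Longrightarrow> finite (A v)" shows "finite (list_colorings V E A)"
  using assms by (auto simp: list_colorings_def intro!: finite_subset[OF _ finite_PiE[of V A]])

text \<open>\<open>list_colorings\<close> tests only edges with both ends in the given vertex set,
  so the same \<open>E\<close> serves for every subset of the vertices.\<close>

lemma restrict_list_colorings:
  assumes "f \<in> list_colorings V E A" "W \<subseteq> V" shows "restrict f W \<in> list_colorings W E A"
  using assms by (auto simp: list_colorings_def PiE_def Pi_def)

section \<open>Counting colourings by forgetting vertices\<close>

lemma card_le_mult_card_image:
  assumes "finite S" "\<And>t. t \<in> h ` S \<Longrightarrow> card {s \<in> S. h s = t} \<le> k"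
  shows "card S \<le> k * card (h ` S)"
proof -
  have "card S = (\<Sum>t\<in>h ` S. card {s \<in> S. h s = t})"
    using assms(1) sum.image_gen[of S "\<lambda>_. 1::nat" h] by simp
  also have "\<dots> \<le> (\<Sum>t\<in>h ` S. k)" by (rule sum_mono) (use assms(2) in auto)
  finally show ?thesis by (simp add: mult.commute)
qed

text \<open>The candidates at a forgotten vertex depend on the remembered colouring but not on other
  forgotten values; hence each fibre of the restriction map embeds into a product.\<close>

lemma card_extensions_le:
  fixes B :: "('a \<Rightarrow> 'b) \<Rightarrow> 'a \<Rightarrow> 'b set"
  assumes "finite F" "finite V" "S \<subseteq> V" "\<And>f. f \<in> F \<Longrightarrow> f \<in> extensional V"
    and B: "\<And>f w. f \<in> F \<Longrightarrow> w \<in> S \<Longrightarrow> f w \<in> B (restrict f (V - S)) w"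
    and k: "\<And>f w. f \<in> F \<Longrightarrow> w \<in> S \<Longrightarrow>
      finite (B (restrict f (V - S)) w) \<and> card (B (restrict f (V - S)) w) \<le> k w"
  shows "card F \<le> (\<Prod>w\<in>S. k w) * card ((\<lambda>f. restrict f (V - S)) ` F)"
proof (rule card_le_mult_card_image[OF assms(1)])
  fix g assume g: "g \<in> (\<lambda>f. restrict f (V - S)) ` F"
  let ?T = "{f \<in> F. restrict f (V - S) = g}"
  have finS: "finite S" using assms(2,3) finite_subset by blast
  have inj: "inj_on (\<lambda>f. restrict f S) ?T"
  proof (rule inj_onI)
    fix f f' assume a: "f \<in> ?T" "f' \<in> ?T" "restrict f S = restrict f' S"
    show "f = f'"
    proof (rule extensionalityI[of _ V])
      show "f \<in> extensional V" "f' \<in> extensional V" using a assms(4) by auto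
      fix v assume v: "v \<in> V"
      show "f v = f' v"
      proof (cases "v \<in> S")
        case True then show ?thesis using a(3) by (metis restrict_apply')
      next
        case False
        have "restrict f (V - S) v = restrict f' (V - S) v" using a by simp
        then show ?thesis using False v by simp
      qed
    qed
  qed
  have sub: "(\<lambda>f. restrict f S) ` ?T \<subseteq> PiE S (B g)" using B by auto
  have fin: "\<And>w. w \<in> S \<Longrightarrow> finite (B g w) \<and> card (B g w) \<le> k w" using g k by auto
  have "card ?T = card ((\<lambda>f. restrict f S) ` ?T)" using inj by (simp add: card_image)
  also have "\<dots> \<le> card (PiE S (B g))"
    by (rule card_mono) (use sub fin finS in \<open>auto intro: finite_PiE\<close>)
  also have "\<dots> = (\<Prod>w\<in>S. card (B g w))" using finS by (simp add: card_PiE)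
  also have "\<dots> \<le> (\<Prod>w\<in>S. k w)" by (rule prod_mono) (use fin in auto)
  finally show "card ?T \<le> (\<Prod>w\<in>S. k w)" .
qed

text \<open>Every \<open>w\<close> in \<open>S\<close> has a neighbour whose colour survives the
  restriction and excludes one of the three values. \<open>F\<close> is an arbitrary family because
  the bound is later applied to the colourings that are constant on a given class.\<close>

lemma card_dominated_le:
  assumes "finite V" "S \<subseteq> V" "\<And>w. w \<in> S \<Longrightarrow> \<exists>u\<in>V - S. {w, u} \<in> E"
    and F: "F \<subseteq> cols3 V E"
  shows "card F \<le> 2 ^ card S * card ((\<lambda>f. restrict f (V - S)) ` F)"
proof -
  obtain u where u: "\<And>w. w \<in> S \<Longrightarrow> u w \<in> V - S \<and> {w, u w} \<in> E" using assms(3) by metis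
  have fin: "finite F" by (rule finite_subset[OF F]) (use assms(1) in simp)
  have "card F \<le> (\<Prod>w\<in>S. 2) * card ((\<lambda>f. restrict f (V - S)) ` F)"
  proof (rule card_extensions_le[where B="\<lambda>g w. {..<3} - {g (u w)}", OF fin assms(1,2)])
    show "f \<in> extensional V" if "f \<in> F" for f using that F by (auto simp: list_colorings_def PiE_def)
    show "f w \<in> {..<3} - {restrict f (V - S) (u w)}" if "f \<in> F" "w \<in> S" for f w
    proof -
      have "f \<in> cols3 V E" "w \<in> V" "u w \<in> V" "u w \<notin> S" "{w, u w} \<in> E" using that F u[OF that(2)] assms(2) by auto
      then show ?thesis by (auto simp: list_colorings_def)
    qed
    show "finite ({..<3} - {restrict f (V - S) (u w)}) \<and> card ({..<3} - {restrict f (V - S) (u w)}) \<le> 2"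
      if "f \<in> F" "w \<in> S" for f w
    proof -
      have "f \<in> cols3 V E" "u w \<in> V" using that F u[OF that(2)] by auto
      then have "f (u w) \<in> {..<3}" by (auto simp: list_colorings_def)
      then show ?thesis using u[OF that(2)] by simp
    qed
  qed
  then show ?thesis by simp
qed

lemma card_free_le:
  assumes "finite V" "S \<subseteq> V" and F: "F \<subseteq> cols3 V E"
  shows "card F \<le> 3 ^ card S * card ((\<lambda>f. restrict f (V - S)) ` F)"
proof -
  have fin: "finite F" by (rule finite_subset[OF F]) (use assms(1) in simp)
  have "card F \<le> (\<Prod>w\<in>S. 3) * card ((\<lambda>f. restrict f (V - S)) ` F)"
    by (rule card_extensions_le[where B="\<lambda>g w. {..<3}", OF fin assms(1,2)])
       (use F assms(2) in \<open>auto simp: list_colorings_def PiE_def Pi_def dest!: subsetD\<close>)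
  then show ?thesis by simp
qed

text \<open>A maximal set all of whose members have a neighbour outside the set has a complement
  in \<open>W\<close> with the same property, so one of the two contains half of \<open>W\<close>.\<close>

lemma half_dominated:
  assumes fin: "finite W" "W \<subseteq> V" and irr: "\<And>w. {w, w} \<notin> E"
    and iso: "\<And>w. w \<in> W \<Longrightarrow> \<exists>u\<in>V. {w, u} \<in> E"
  obtains S where "S \<subseteq> W" "card W \<le> 2 * card S" "\<And>w. w \<in> S \<Longrightarrow> \<exists>u\<in>V - S. {w, u} \<in> E"
proof -
  define P where "P S \<longleftrightarrow> S \<subseteq> W \<and> (\<forall>w\<in>S. \<exists>u\<in>V - S. {w, u} \<in> E)" for S
  have "P {}" by (simp add: P_def)
  moreover have "\<forall>S. P S \<longrightarrow> card S < Suc (card W)"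
    using fin by (auto simp: P_def card_mono less_Suc_eq_le)
  ultimately obtain S where S: "P S" and mx: "\<And>T. P T \<Longrightarrow> card T \<le> card S"
    using ex_has_greatest_nat[of P "{}" card "Suc (card W)"] by auto
  have "P (W - S)"
    unfolding P_def
  proof (intro conjI ballI)
    fix w assume w: "w \<in> W - S"
    show "\<exists>u\<in>V - (W - S). {w, u} \<in> E"
    proof (rule ccontr)
      assume neg: "\<not> ?thesis"
      obtain u where u: "u \<in> V" "{w, u} \<in> E" using iso w by blast
      \<comment> \<open>By \<open>neg\<close> all neighbours of \<open>w\<close> lie in
        \<open>W - S\<close>. So \<open>w\<close> has a witness outside \<open>insert w S\<close>,
        and \<open>w\<close> was no witness for a member of \<open>S\<close>; this contradicts
        maximality.\<close>
      have "P (insert w S)"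
        unfolding P_def
      proof (intro conjI ballI)
        fix z assume z: "z \<in> insert w S"
        show "\<exists>u\<in>V - insert w S. {z, u} \<in> E"
        proof (cases "z = w")
          case True
          have "u \<noteq> w" using u irr by metis
          moreover have "u \<notin> S" using neg u S by (auto simp: P_def)
          ultimately show ?thesis using True u by blast
        next
          case False
          then obtain v where v: "v \<in> V - S" "{z, v} \<in> E" using S z by (auto simp: P_def)
          have "v \<noteq> w"
          proof
            assume "v = w"
            then have "{w, z} \<in> E" using v by (simp add: insert_commute)
            moreover have "z \<in> S" "z \<in> V" using z False S fin by (auto simp: P_def)
            ultimately show False using neg by blast
          qed
          then show ?thesis using v by blast
        qed
      qed (use S w in \<open>auto simp: P_def\<close>)
      then have "card (insert w S) \<le> card S" by (rule mx)
      moreover have "finite S" using S fin finite_subset[of S W] by (auto simp: P_def)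
      ultimately show False using w by simp
    qed
  qed simp
  have "S \<subseteq> W" using S by (simp add: P_def)
  then have "card (W - S) = card W - card S" "card S \<le> card W"
    using fin by (simp_all add: card_Diff_subset finite_subset card_mono)
  then consider "card W \<le> 2 * card S" | "card W \<le> 2 * card (W - S)" by linarith
  then show thesis
  proof cases
    case 1
    show thesis by (rule that[of S]) (use 1 S in \<open>auto simp: P_def\<close>)
  next
    case 2
    show thesis by (rule that[of "W - S"]) (use 2 \<open>P (W - S)\<close> in \<open>auto simp: P_def\<close>)
  qed
qed

section \<open>Complete bipartite edge sets and their 3-colourings\<close>

definition bip :: "'a set \<Rightarrow> 'a set \<Rightarrow> 'a set set" where
  "bip A B = {{x, y} | x y. x \<in> A \<and> y \<in> B}"

lemma bip_iff:
  assumes "A \<inter> B = {}"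
  shows "{x, y} \<in> bip A B \<longleftrightarrow> x \<in> A \<and> y \<in> B \<or> x \<in> B \<and> y \<in> A"
  unfolding bip_def using assms by (auto simp: doubleton_eq_iff)

lemma bip_commute: "bip A B = bip B A"
  unfolding bip_def by (auto simp: insert_commute)

lemma inj_on_doubleton: "A \<inter> B = {} \<Longrightarrow> inj_on (\<lambda>(x, y). {x, y}) (A \<times> B)"
  by (auto simp: inj_on_def doubleton_eq_iff)

lemma bip_image: "bip A B = (\<lambda>(x, y). {x, y}) ` (A \<times> B)"
  unfolding bip_def by auto

lemma finite_bip [simp]: "finite A \<Longrightarrow> finite B \<Longrightarrow> finite (bip A B)"
  by (simp add: bip_image)

lemma card_bip: "A \<inter> B = {} \<Longrightarrow> card (bip A B) = card A * card B"
  unfolding bip_image by (subst card_image) (auto simp: inj_on_doubleton card_cartesian_product)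

lemma bip_nsets:
  assumes "A \<inter> B = {}" "A \<subseteq> V" "B \<subseteq> V" shows "bip A B \<subseteq> nsets V 2"
proof
  fix e assume "e \<in> bip A B"
  then obtain x y where "e = {x, y}" "x \<in> A" "y \<in> B" by (auto simp: bip_def)
  moreover from this have "x \<noteq> y" using assms(1) by blast
  ultimately show "e \<in> nsets V 2" using assms by (auto simp: nsets_def)
qed

lemma prod_classes:
  fixes g :: "'a \<Rightarrow> 'b :: comm_monoid_mult"
  assumes fin: "finite V" and sub: "A \<subseteq> V" "B \<subseteq> V" "A \<inter> B = {}"
    and g: "\<And>v. v \<in> A \<Longrightarrow> g v = p" "\<And>v. v \<in> B \<Longrightarrow> g v = q" "\<And>v. v \<in> V - A - B \<Longrightarrow> g v = r"
  shows "prod g V = p ^ card A * q ^ card B * r ^ (card V - card A - card B)"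
proof -
  have f: "finite A" "finite B" using fin sub(1,2) by (blast intro: finite_subset)+
  have V: "V = A \<union> (B \<union> (V - A - B))" using sub by auto
  have "prod g V = prod g (A \<union> (B \<union> (V - A - B)))" by (rule arg_cong[OF V])
  also have "\<dots> = prod g A * prod g (B \<union> (V - A - B))"
    by (rule prod.union_disjoint) (use f fin sub in auto)
  also have "prod g (B \<union> (V - A - B)) = prod g B * prod g (V - A - B)"
    by (rule prod.union_disjoint) (use f fin sub in auto)
  also have "prod g A = p ^ card A" using g(1) by simp
  also have "prod g B = q ^ card B" using g(2) by simp
  also have "prod g (V - A - B) = r ^ card (V - A - B)" using g(3) by simp
  also have "card (V - A - B) = card V - card A - card B"
    using f sub by (subst card_Diff_subset, simp, blast, subst card_Diff_subset) auto
  finally show ?thesis by (simp add: mult.assoc)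
qed

lemma card_PiE_classes:
  assumes fin: "finite V" and sub: "A \<subseteq> V" "B \<subseteq> V" "A \<inter> B = {}"
    and T: "\<And>v. v \<in> A \<Longrightarrow> card (T v) = p" "\<And>v. v \<in> B \<Longrightarrow> card (T v) = q"
      "\<And>v. v \<in> V - A - B \<Longrightarrow> card (T v) = r"
  shows "card (PiE V T) = p ^ card A * q ^ card B * r ^ (card V - card A - card B)"
  unfolding card_PiE[OF fin] by (rule prod_classes[OF fin sub T])

definition split_colorings :: "'a set \<Rightarrow> 'a set \<Rightarrow> 'a set \<Rightarrow> ('a \<Rightarrow> nat) set" where
  "split_colorings V A B = {f \<in> PiE V (\<lambda>_. {..<3}). \<forall>x\<in>A. \<forall>y\<in>B. f x \<noteq> f y}"

lemma card_lessThan_3_Diff: "c < 3 \<Longrightarrow> card ({..<3::nat} - {c}) = 2" by simp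

text \<open>Two colours on each of two sides without a common colour would take four
  colours.\<close>

lemma split_colorings_mono_cases:
  fixes f :: "'a \<Rightarrow> nat"
  assumes "f \<in> V \<rightarrow> {..<3}" "A \<subseteq> V" "B \<subseteq> V" "\<And>x y. x \<in> A \<Longrightarrow> y \<in> B \<Longrightarrow> f x \<noteq> f y" "A \<noteq> {}" "B \<noteq> {}"
  shows "(\<exists>c<3. \<forall>x\<in>A. f x = c) \<or> (\<exists>c<3. \<forall>x\<in>B. f x = c)"
proof (rule ccontr)
  assume neg: "\<not> ?thesis"
  obtain x where x: "x \<in> A" using assms by blast
  then have "f x < 3" using assms(1,2) by auto
  then obtain x' where x': "x' \<in> A" "f x' \<noteq> f x" using neg x by blast
  obtain y where y: "y \<in> B" using assms by blast
  then have "f y < 3" using assms(1,3) by auto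
  then obtain y' where y': "y' \<in> B" "f y' \<noteq> f y" using neg y by blast
  have "f x' < 3" "f y' < 3" using x' y' assms(1-3) by auto
  moreover have "f x \<noteq> f y" "f x \<noteq> f y'" "f x' \<noteq> f y" "f x' \<noteq> f y'" using x y x' y' assms(4) by auto
  ultimately show False using x' y' \<open>f x < 3\<close> \<open>f y < 3\<close> by linarith
qed

text \<open>Inclusion-exclusion over the side that is constant: \<open>F c\<close> and
  \<open>G c\<close> fix the colour of \<open>A\<close> or of \<open>B\<close>, and \<open>H\<close>
  counts the overlap, one ordered pair of distinct colours at a time. The subtracted term stands on
  the left to keep the identity in the naturals.\<close>

lemma card_split_colorings:
  assumes fin: "finite V" and sub: "A \<subseteq> V" "B \<subseteq> V" "A \<inter> B = {}" "A \<noteq> {}" "B \<noteq> {}"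
  shows "card (split_colorings V A B) + 6 * 3 ^ (card V - card A - card B) =
    (3 * 2 ^ card B + 3 * 2 ^ card A) * 3 ^ (card V - card A - card B)"
proof -
  let ?r = "card V - card A - card B"
  define F where "F c = PiE V (\<lambda>v. if v \<in> A then {c} else if v \<in> B then {..<3} - {c} else {..<3})" for c :: nat
  define G where "G c = PiE V (\<lambda>v. if v \<in> A then {..<3} - {c} else if v \<in> B then {c} else {..<3})" for c :: nat
  define H where "H = (\<lambda>(c, d). PiE V (\<lambda>v. if v \<in> A then {c} else if v \<in> B then {d} else {..<3::nat}))"
  define I where "I = Sigma {..<3::nat} (\<lambda>c. {..<3} - {c})"
  have cF: "card (F c) = 2 ^ card B * 3 ^ ?r" if "c < 3" for c
    unfolding F_def using that sub by (subst card_PiE_classes[OF fin sub(1-3), of _ 1 2 3]) auto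
  have cG: "card (G c) = 2 ^ card A * 3 ^ ?r" if "c < 3" for c
    unfolding G_def using that sub by (subst card_PiE_classes[OF fin sub(1-3), of _ 2 1 3]) auto
  have cH: "card (H cd) = 3 ^ ?r" for cd
  proof -
    have "H cd = PiE V (\<lambda>v. if v \<in> A then {fst cd} else if v \<in> B then {snd cd} else {..<3})"
      by (simp only: H_def case_prod_beta)
    also have "card \<dots> = 1 ^ card A * 1 ^ card B * 3 ^ ?r"
      using sub by (intro card_PiE_classes[OF fin sub(1-3)]) auto
    finally show ?thesis by simp
  qed
  have fin': "finite (F c)" "finite (G c)" "finite (H cd)" for c cd
    unfolding F_def G_def H_def using fin by (auto intro!: finite_PiE split: prod.splits)
  obtain a b where ab: "a \<in> A" "b \<in> B" using sub by auto
  have ab': "a \<in> V" "b \<in> V" "b \<notin> A" using ab sub by auto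
  have eF: "f a = c" if "f \<in> F c" for f c
    using PiE_mem[OF that[unfolded F_def] ab'(1)] ab by simp
  have eG: "f b = c" if "f \<in> G c" for f c
    using PiE_mem[OF that[unfolded G_def] ab'(2)] ab ab' by simp
  have eH: "(f a, f b) = cd" if "f \<in> H cd" for f cd
  proof (cases cd)
    case (Pair c d)
    have "f \<in> PiE V (\<lambda>v. if v \<in> A then {c} else if v \<in> B then {d} else {..<3})"
      using that by (simp add: H_def Pair)
    from PiE_mem[OF this ab'(1)] PiE_mem[OF this ab'(2)] show ?thesis using ab ab' Pair by simp
  qed
  have dF: "F c \<inter> F d = {}" "G c \<inter> G d = {}" if "c \<noteq> d" for c d
  proof -
    have "c = d" if "f \<in> F c" "f \<in> F d" for f using eF[OF that(1)] eF[OF that(2)] by simp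
    then show "F c \<inter> F d = {}" using \<open>c \<noteq> d\<close> by blast
    have "c = d" if "f \<in> G c" "f \<in> G d" for f using eG[OF that(1)] eG[OF that(2)] by simp
    then show "G c \<inter> G d = {}" using \<open>c \<noteq> d\<close> by blast
  qed
  have dH: "H c \<inter> H d = {}" if "c \<noteq> d" for c d
  proof -
    have "c = d" if "f \<in> H c" "f \<in> H d" for f using eH[OF that(1)] eH[OF that(2)] by simp
    then show ?thesis using that by blast
  qed
  have "card (\<Union>c<3. F c) = (\<Sum>c<3. card (F c))"
    by (rule card_UN_disjoint) (simp_all add: fin' dF)
  also have "\<dots> = 3 * (2 ^ card B * 3 ^ ?r)" using cF by simp
  finally have uF: "card (\<Union>c<3. F c) = 3 * (2 ^ card B * 3 ^ ?r)" .
  have "card (\<Union>c<3. G c) = (\<Sum>c<3. card (G c))"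
    by (rule card_UN_disjoint) (simp_all add: fin' dF)
  also have "\<dots> = 3 * (2 ^ card A * 3 ^ ?r)" using cG by simp
  finally have uG: "card (\<Union>c<3. G c) = 3 * (2 ^ card A * 3 ^ ?r)" .
  have cI: "card I = 6" unfolding I_def by (subst card_SigmaI) (auto simp: card_lessThan_3_Diff)
  have "card (\<Union>cd\<in>I. H cd) = (\<Sum>cd\<in>I. card (H cd))"
    by (rule card_UN_disjoint) (simp_all add: fin' dH, simp add: I_def)
  also have "\<dots> = 6 * 3 ^ ?r" using cH cI by simp
  finally have uH: "card (\<Union>cd\<in>I. H cd) = 6 * 3 ^ ?r" .
  have un: "split_colorings V A B = (\<Union>c<3. F c) \<union> (\<Union>c<3. G c)"
  proof
    show "split_colorings V A B \<subseteq> (\<Union>c<3. F c) \<union> (\<Union>c<3. G c)"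
    proof
      fix f assume f: "f \<in> split_colorings V A B"
      then have ff: "f \<in> PiE V (\<lambda>_. {..<3})" and d: "\<And>x y. x \<in> A \<Longrightarrow> y \<in> B \<Longrightarrow> f x \<noteq> f y"
        by (auto simp: split_colorings_def)
      then have "(\<exists>c<3. \<forall>x\<in>A. f x = c) \<or> (\<exists>c<3. \<forall>x\<in>B. f x = c)"
        by (intro split_colorings_mono_cases[OF _ sub(1,2) d sub(4,5)]) auto
      then show "f \<in> (\<Union>c<3. F c) \<union> (\<Union>c<3. G c)"
      proof
        assume "\<exists>c<3. \<forall>x\<in>A. f x = c"
        then obtain c where c: "c < 3" "\<forall>x\<in>A. f x = c" by blast
        have "f \<in> F c" unfolding F_def using ff c d ab
          by (intro PiE_I) (auto simp: PiE_def Pi_def extensional_def)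
        then show ?thesis using c by auto
      next
        assume "\<exists>c<3. \<forall>x\<in>B. f x = c"
        then obtain c where c: "c < 3" "\<forall>x\<in>B. f x = c" by blast
        have "f \<in> G c" unfolding G_def using ff c d ab
          by (intro PiE_I) (auto simp: PiE_def Pi_def extensional_def)
        then show ?thesis using c by auto
      qed
    qed
    have 1: "f \<in> split_colorings V A B" if f: "f \<in> F c" and c: "c < 3" for f c
    proof -
      have *: "f v \<in> (if v \<in> A then {c} else if v \<in> B then {..<3} - {c} else {..<3})" if "v \<in> V" for v
        using PiE_mem[OF f[unfolded F_def] that] .
      have "f \<in> PiE V (\<lambda>_. {..<3})"
      proof (rule PiE_I)
        show "f v \<in> {..<3}" if "v \<in> V" for v using *[OF that] c by (auto split: if_splits)
        show "f v = undefined" if "v \<notin> V" for v using f that by (auto simp: F_def)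
      qed
      moreover have "f x \<noteq> f y" if "x \<in> A" "y \<in> B" for x y
      proof -
        have "x \<in> V" "y \<in> V" "y \<notin> A" using that sub by auto
        then show ?thesis using *[of x] *[of y] that by simp
      qed
      ultimately show ?thesis by (simp add: split_colorings_def)
    qed
    have 2: "f \<in> split_colorings V A B" if f: "f \<in> G c" and c: "c < 3" for f c
    proof -
      have *: "f v \<in> (if v \<in> A then {..<3} - {c} else if v \<in> B then {c} else {..<3})" if "v \<in> V" for v
        using PiE_mem[OF f[unfolded G_def] that] .
      have "f \<in> PiE V (\<lambda>_. {..<3})"
      proof (rule PiE_I)
        show "f v \<in> {..<3}" if "v \<in> V" for v using *[OF that] c by (auto split: if_splits)
        show "f v = undefined" if "v \<notin> V" for v using f that by (auto simp: G_def)
      qed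
      moreover have "f x \<noteq> f y" if "x \<in> A" "y \<in> B" for x y
      proof -
        have "x \<in> V" "y \<in> V" "y \<notin> A" using that sub by auto
        then show ?thesis using *[of x] *[of y] that by auto
      qed
      ultimately show ?thesis by (simp add: split_colorings_def)
    qed
    show "(\<Union>c<3. F c) \<union> (\<Union>c<3. G c) \<subseteq> split_colorings V A B" using 1 2 by blast
  qed
  have int: "(\<Union>c<3. F c) \<inter> (\<Union>c<3. G c) = (\<Union>cd\<in>I. H cd)"
  proof -
    have "F c \<inter> G d = (if c = d then {} else H (c, d))" if "c < 3" "d < 3" for c d
    proof -
      have "F c \<inter> G d = PiE V (\<lambda>v. (if v \<in> A then {c} else if v \<in> B then {..<3} - {c} else {..<3}) \<inter>
         (if v \<in> A then {..<3} - {d} else if v \<in> B then {d} else {..<3}))"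
        unfolding F_def G_def by (rule PiE_Int)
      also have "\<dots> = (if c = d then {} else H (c, d))"
      proof (cases "c = d")
        case True then show ?thesis using ab ab' by (auto simp: PiE_eq_empty_iff)
      next
        case False
        then show ?thesis unfolding H_def using that by (auto intro!: PiE_cong)
      qed
      finally show ?thesis .
    qed
    then have *: "F c \<inter> G d = (if c = d then {} else H (c, d))" if "c \<in> {..<3}" "d \<in> {..<3}" for c d
      using that by simp
    have "(\<Union>c<3. F c) \<inter> (\<Union>c<3. G c) = (\<Union>c<3. \<Union>d<3. F c \<inter> G d)" by blast
    also have "\<dots> = (\<Union>c<3. \<Union>d<3. if c = d then {} else H (c, d))"
      by (intro SUP_cong refl *)
    also have "\<dots> = (\<Union>cd\<in>I. H cd)" unfolding I_def by (auto split: if_splits)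
    finally show ?thesis .
  qed
  have fU: "finite (\<Union>c<3. F c)" "finite (\<Union>c<3. G c)" using fin' by blast+
  show ?thesis using card_Un_Int[OF fU] uF uG uH unfolding int un[symmetric] by (simp add: algebra_simps)
qed

text \<open>Any \<open>m\<close> edges of the complete bipartite graph form a competitor on which
  all its colourings stay proper. So a pair of sizes only has to fit into \<open>n\<close> vertices
  and to offer enough edges.\<close>

lemma maximizer_ge_bipartite:
  fixes V :: "'a set"
  assumes mx: "maximizes_colorings 3 n m V E" and ab: "1 \<le> a" "1 \<le> b" "a + b \<le> n" "m \<le> a * b"
  shows "(3 * 2 ^ b + 3 * 2 ^ a - 6) * 3 ^ (n - a - b) \<le> (real (num_colorings 3 V E))"
proof -
  have V: "finite V" "card V = n"
    using mx by (auto simp: maximizes_colorings_def graph_with_def simple_graph_def)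
  obtain A where A: "A \<subseteq> V" "card A = a"
    using obtain_subset_with_card_n[of a V] ab V by auto
  have "b \<le> card (V - A)" using A V ab by (simp add: card_Diff_subset finite_subset)
  then obtain B where B: "B \<subseteq> V - A" "card B = b" by (rule obtain_subset_with_card_n)
  have dis: "A \<inter> B = {}" "B \<subseteq> V" using B by auto
  have "m \<le> card (bip A B)" using ab A B dis by (simp add: card_bip)
  then obtain E' where E': "E' \<subseteq> bip A B" "card E' = m" by (rule obtain_subset_with_card_n)
  have sg: "simple_graph V E'" using E' bip_nsets[OF dis(1) A(1) dis(2)] V by (auto simp: simple_graph_def)
  then have "graph_with n m V E'" using E' V by (simp add: graph_with_def)
  then have le: "num_colorings 3 V E' \<le> num_colorings 3 V E" using mx by (simp add: maximizes_colorings_def)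
  have "split_colorings V A B \<subseteq> cols3 V E'"
  proof
    fix f assume f: "f \<in> split_colorings V A B"
    have "f x \<noteq> f y" if "{x, y} \<in> E'" for x y
      using that E' bip_iff[OF dis(1)] f by (fastforce simp: split_colorings_def)
    then show "f \<in> cols3 V E'" using f by (auto simp: split_colorings_def list_colorings_def)
  qed
  then have "card (split_colorings V A B) \<le> num_colorings 3 V E"
    using le num_colorings_cols3[OF sg] card_mono[of "cols3 V E'" "split_colorings V A B"] V by simp
  then have "real (card (split_colorings V A B)) \<le> real (num_colorings 3 V E)" by (rule of_nat_mono)
  moreover have "card (split_colorings V A B) + 6 * 3 ^ (n - a - b) = (3 * 2 ^ b + 3 * 2 ^ a) * 3 ^ (n - a - b)"
    using card_split_colorings[OF V(1) A(1) dis(2,1)] A B ab V by force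
  then have "real (card (split_colorings V A B) + 6 * 3 ^ (n - a - b)) =
      real ((3 * 2 ^ b + 3 * 2 ^ a) * 3 ^ (n - a - b))" by presburger
  then have "real (card (split_colorings V A B)) = (3 * 2 ^ b + 3 * 2 ^ a) * 3 ^ (n - a - b) - 6 * 3 ^ (n - a - b)"
    unfolding of_nat_add of_nat_mult of_nat_power of_nat_numeral by linarith
  ultimately show ?thesis by (simp only: left_diff_distrib)
qed

section \<open>Containers\<close>

text \<open>A colour allowed at both ends of an edge is a conflict. Conflicts are bounded per vertex
  and colour, and \<open>card_conflict_le\<close> adds them up.\<close>

definition sparse_lists :: "'a set \<Rightarrow> 'a set set \<Rightarrow> nat \<Rightarrow> ('a \<Rightarrow> nat set) \<Rightarrow> bool" where
  "sparse_lists V E d A \<longleftrightarrow> (\<forall>v\<in>V. \<forall>c\<in>A v. card {w \<in> V. {v, w} \<in> E \<and> c \<in> A w} < d)"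

text \<open>Branch on whether a vertex \<open>v\<close> with many neighbours allowing the colour \<open>c\<close> receives
  \<open>c\<close>: either \<open>d\<close> lists lose \<open>c\<close>, or the list of \<open>v\<close> does.\<close>

lemma container:
  fixes l :: real
  assumes fin: "finite V" and l: "l > 0" "1 / l + (1 / l) ^ d \<le> 1"
  shows "(\<And>v. v \<in> V \<Longrightarrow> finite (A v)) \<Longrightarrow> \<exists>A'. (\<forall>v\<in>V. A' v \<subseteq> A v) \<and> sparse_lists V E d A' \<and>
    real (card (list_colorings V E A)) \<le> l ^ (\<Sum>v\<in>V. card (A v)) * card (list_colorings V E A')"
proof (induction "\<Sum>v\<in>V. card (A v)" arbitrary: A rule: less_induct)
  case less
  let ?s = "\<lambda>A. \<Sum>v\<in>V. card (A v :: nat set)"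
  have "(1 / l) ^ d \<ge> 0" using l by simp
  then have "1 / l \<le> 1" using l by linarith
  then have l1: "l \<ge> 1" using l by (simp add: divide_simps)
  show ?case
  proof (cases "sparse_lists V E d A")
    case True
    have "1 \<le> l ^ ?s A" using l1 by simp
    then have "real (card (list_colorings V E A)) \<le> l ^ ?s A * card (list_colorings V E A)"
      by (simp add: mult_le_cancel_right1)
    then show ?thesis using True by blast
  next
    case False
    then obtain v c where v: "v \<in> V" "c \<in> A v" and d: "d \<le> card {w \<in> V. {v, w} \<in> E \<and> c \<in> A w}"
      by (auto simp: sparse_lists_def not_less)
    define N where "N = {w \<in> V. {v, w} \<in> E \<and> c \<in> A w}"
    define A1 where "A1 w = (if w \<in> N then A w - {c} else A w)" for w
    define A2 where "A2 w = (if w = v then A w - {c} else A w)" for w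
    have finA: "\<And>w. w \<in> V \<Longrightarrow> finite (A w)" by fact
    have s1: "?s A1 + card N \<le> ?s A"
    proof -
      have "?s A1 + card N = (\<Sum>w\<in>V. card (A1 w) + (if w \<in> N then 1 else 0))"
      proof -
        have "(\<Sum>w\<in>V. if w \<in> N then 1 else 0) = card (V \<inter> N)" using fin by (simp add: sum.If_cases)
        also have "V \<inter> N = N" by (auto simp: N_def)
        finally show ?thesis by (simp add: sum.distrib)
      qed
      also have "\<dots> = ?s A"
      proof (rule sum.cong[OF refl])
        fix w assume "w \<in> V"
        then show "card (A1 w) + (if w \<in> N then 1 else 0) = card (A w)"
          using finA[of w] card_Suc_Diff1[of "A w" c] by (auto simp: A1_def N_def)
      qed
      finally show ?thesis by simp
    qed
    have s2: "?s A2 + 1 = ?s A"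
    proof -
      have "?s A2 + 1 = (\<Sum>w\<in>V. card (A2 w) + (if w = v then 1 else 0))"
        unfolding sum.distrib using fin v by simp
      also have "\<dots> = ?s A"
        by (rule sum.cong) (use finA v card_Suc_Diff1[of "A v" c] in \<open>auto simp: A2_def\<close>)
      finally show ?thesis .
    qed
    have dN: "d \<le> card N" using d by (simp add: N_def)
    have d1: "d \<ge> 1" using l by (cases d) (auto simp: divide_simps split: if_splits)
    have fA: "\<And>w. w \<in> V \<Longrightarrow> finite (A1 w)" "\<And>w. w \<in> V \<Longrightarrow> finite (A2 w)"
      using finA by (auto simp: A1_def A2_def)
    obtain B1 where B1: "\<forall>v\<in>V. B1 v \<subseteq> A1 v" "sparse_lists V E d B1"
      "real (card (list_colorings V E A1)) \<le> l ^ ?s A1 * card (list_colorings V E B1)"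
      using less.hyps[of A1] fA s1 dN d1 by fastforce
    obtain B2 where B2: "\<forall>v\<in>V. B2 v \<subseteq> A2 v" "sparse_lists V E d B2"
      "real (card (list_colorings V E A2)) \<le> l ^ ?s A2 * card (list_colorings V E B2)"
      using less.hyps[of A2] fA s2 by fastforce
    \<comment> \<open>Keeping only the branch with more leaf colourings is what yields a single
      assignment; the loss is absorbed by the power of \<open>l\<close>.\<close>
    define B where "B = (if card (list_colorings V E B1) \<le> card (list_colorings V E B2) then B2 else B1)"
    let ?K = "real (card (list_colorings V E B))"
    have B: "\<forall>v\<in>V. B v \<subseteq> A v" "sparse_lists V E d B"
      using B1 B2 unfolding B_def A1_def A2_def by (fastforce split: if_splits)+
    have K: "real (card (list_colorings V E B1)) \<le> ?K" "real (card (list_colorings V E B2)) \<le> ?K"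
      unfolding B_def by auto
    have "list_colorings V E A \<subseteq> list_colorings V E A1 \<union> list_colorings V E A2"
    proof
      fix f assume f: "f \<in> list_colorings V E A"
      then have m: "\<And>w. w \<in> V \<Longrightarrow> f w \<in> A w" by (auto simp: list_colorings_def)
      have e: "\<And>w. w \<notin> V \<Longrightarrow> f w = undefined" using f by (auto simp: list_colorings_def)
      show "f \<in> list_colorings V E A1 \<union> list_colorings V E A2"
      proof (cases "f v = c")
        case True
        have "f w \<noteq> c" if "w \<in> N" for w
        proof -
          have "w \<in> V" "{v, w} \<in> E" using that by (auto simp: N_def)
          then have "f v \<noteq> f w" using f v unfolding list_colorings_def by blast
          then show ?thesis using True by simp
        qed
        then have "f \<in> PiE V A1" using m e by (intro PiE_I) (auto simp: A1_def)
        then show ?thesis using f by (simp add: list_colorings_def)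
      next
        case False
        then have "f \<in> PiE V A2" using m e by (intro PiE_I) (auto simp: A2_def)
        then show ?thesis using f by (simp add: list_colorings_def)
      qed
    qed
    then have "card (list_colorings V E A) \<le> card (list_colorings V E A1 \<union> list_colorings V E A2)"
      by (intro card_mono finite_UnI finite_list_colorings fin fA)
    also have "\<dots> \<le> card (list_colorings V E A1) + card (list_colorings V E A2)" by (rule card_Un_le)
    finally have "real (card (list_colorings V E A)) \<le>
        real (card (list_colorings V E A1)) + real (card (list_colorings V E A2))"
      unfolding of_nat_add[symmetric] by (rule of_nat_mono)
    also have "\<dots> \<le> l ^ ?s A1 * ?K + l ^ ?s A2 * ?K"
      by (intro add_mono order.trans[OF B1(3)] order.trans[OF B2(3)] mult_left_mono K) (use l in auto)
    also have "\<dots> \<le> l ^ (?s A - d) * ?K + l ^ (?s A - 1) * ?K"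
      by (intro add_mono mult_right_mono power_increasing l1) (use s1 s2 dN in auto)
    \<comment> \<open>One branch shortens the total list length by at least \<open>d\<close>, the
      other by 1, so the recursion closes exactly under
      \<open>1 / l + (1 / l) ^ d \<le> 1\<close>.\<close>
    also have "\<dots> = l ^ ?s A * ?K * (1 / l + (1 / l) ^ d)"
    proof -
      have "l ^ (?s A - d) = l ^ ?s A * (1 / l) ^ d"
        using l s1 dN by (simp add: power_diff power_divide)
      moreover have "l ^ (?s A - 1) = l ^ ?s A * (1 / l)"
        using l s2 power_diff[of l 1 "?s A"] by simp
      ultimately show ?thesis by (simp add: algebra_simps)
    qed
    also have "\<dots> \<le> l ^ ?s A * ?K * 1" by (intro mult_left_mono) (use l in auto)
    finally show ?thesis using B by auto
  qed
qed

text \<open>Two proper 2-colourings agree on a set closed under adjacency, so a minimal nonempty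
  closed set has at most two of them.\<close>

definition two_colorings :: "'a set \<Rightarrow> 'a set set \<Rightarrow> ('a \<Rightarrow> bool) set" where
  "two_colorings X E = {f \<in> PiE X (\<lambda>_. UNIV). \<forall>x\<in>X. \<forall>y\<in>X. {x, y} \<in> E \<longrightarrow> f x \<noteq> f y}"

definition edges_in :: "'a set \<Rightarrow> 'a set set \<Rightarrow> 'a set set" where
  "edges_in X E = {e \<in> E. e \<subseteq> X}"

lemma finite_two_colorings: "finite X \<Longrightarrow> finite (two_colorings X E)"
  by (auto simp: two_colorings_def intro!: finite_subset[OF _ finite_PiE[of X "\<lambda>_. UNIV"]])

lemma edges_in_two_colorable_le:
  assumes fin: "finite X" and f: "f \<in> two_colorings X E" and E: "E \<subseteq> nsets V 2"
  shows "4 * card (edges_in X E) \<le> card X ^ 2"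
proof -
  let ?P = "{x \<in> X. f x}" and ?Q = "{x \<in> X. \<not> f x}"
  have "edges_in X E \<subseteq> bip ?P ?Q"
  proof
    fix e assume e: "e \<in> edges_in X E"
    then have "e \<in> nsets V 2" using E by (auto simp: edges_in_def)
    then obtain x y where xy: "e = {x, y}" by (auto simp: nsets_def card_2_iff)
    then have xX: "x \<in> X" "y \<in> X" "{x, y} \<in> E" using e by (auto simp: edges_in_def)
    then have "f x \<noteq> f y" using f by (auto simp: two_colorings_def)
    then show "e \<in> bip ?P ?Q" using xX xy by (cases "f x") (auto simp: bip_def doubleton_eq_iff)
  qed
  then have "card (edges_in X E) \<le> card (bip ?P ?Q)" by (rule card_mono[rotated]) (use fin in simp)
  also have "\<dots> = card ?P * card ?Q" by (rule card_bip) auto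
  finally have *: "card (edges_in X E) \<le> card ?P * card ?Q" .
  have "card X = card (?P \<union> ?Q)" by (rule arg_cong[where f=card]) auto
  also have "\<dots> = card ?P + card ?Q" by (rule card_Un_disjoint) (use fin in auto)
  finally have X: "card X = card ?P + card ?Q" .
  have "4 * (int (card ?P) * int (card ?Q)) \<le> (int (card ?P) + int (card ?Q))\<^sup>2"
    using zero_le_power2[of "int (card ?P) - int (card ?Q)"]
    by (simp only: power2_eq_square) (simp add: algebra_simps)
  then have "4 * (card ?P * card ?Q) \<le> (card ?P + card ?Q)\<^sup>2"
    by (metis (mono_tags, lifting) of_nat_add of_nat_le_iff of_nat_mult of_nat_numeral of_nat_power)
  then show ?thesis using * X by (metis le_trans mult_le_mono2)
qed

text \<open>The exponent \<open>j\<close> measures how far the number of 2-colourings falls below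
  its maximum. A component with \<open>i + 1\<close> vertices has deficit \<open>i\<close> and at
  most (i + 1)^2 / 4 edges, and for a given total deficit a single component holds the most edges.
  So edges inside a class must be paid for in colourings.\<close>

lemma card_two_colorings_le:
  assumes E: "E \<subseteq> nsets V 2"
  shows "finite X \<Longrightarrow> two_colorings X E \<noteq> {} \<Longrightarrow>
    \<exists>j. card (two_colorings X E) * 2 ^ j \<le> 2 ^ card X \<and> 4 * card (edges_in X E) \<le> (j + 1) ^ 2"
proof (induction "card X" arbitrary: X rule: less_induct)
  case less
  show ?case
  proof (cases "X = {}")
    case True
    have "edges_in {} E = {}" using E by (auto simp: edges_in_def nsets_def)
    moreover have "card (two_colorings {} E) \<le> 1" by (auto simp: two_colorings_def)
    ultimately show ?thesis using True by (intro exI[of _ 0]) auto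
  next
    case False
    \<comment> \<open>Sets closed under adjacency in \<open>X\<close> are unions of components, so
      the smallest one is a component.\<close>
    define cl where "cl S \<longleftrightarrow> S \<noteq> {} \<and> S \<subseteq> X \<and> (\<forall>x\<in>S. \<forall>y\<in>X. {x, y} \<in> E \<longrightarrow> y \<in> S)" for S
    have "cl X" using False by (simp add: cl_def)
    then obtain S where S: "cl S" and mn: "\<And>T. cl T \<Longrightarrow> card S \<le> card T"
      by (metis ex_has_least_nat)
    have SX: "S \<subseteq> X" "S \<noteq> {}" and clS: "\<And>x y. x \<in> S \<Longrightarrow> y \<in> X \<Longrightarrow> {x, y} \<in> E \<Longrightarrow> y \<in> S"
      using S by (auto simp: cl_def)
    have finS: "finite S" using SX less.prems finite_subset by blast
    obtain f0 where f0: "f0 \<in> two_colorings X E" using less.prems by blast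
    have res: "restrict f W \<in> two_colorings W E" if "f \<in> two_colorings X E" "W \<subseteq> X" for f W
      using that by (auto simp: two_colorings_def PiE_def)
    have two: "f = g \<or> (\<forall>x\<in>S. f x = (\<not> g x))"
      if "f \<in> two_colorings S E" "g \<in> two_colorings S E" for f g
    proof (cases "\<exists>x\<in>S. f x = g x")
      case True
      let ?T = "{x \<in> S. f x = g x}"
      have "cl ?T" unfolding cl_def
      proof (intro conjI ballI impI)
        fix x y assume xy: "x \<in> ?T" "y \<in> X" "{x, y} \<in> E"
        then have yS: "x \<in> S" "y \<in> S" using clS by auto
        then have "f x \<noteq> f y" "g x \<noteq> g y" using that xy(3) unfolding two_colorings_def by blast+
        then show "y \<in> ?T" using xy yS by auto
      qed (use True SX in auto)
      then have "card S \<le> card ?T" by (rule mn)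
      then have "?T = S" using finS by (intro card_seteq) auto
      then have "\<And>x. x \<in> S \<Longrightarrow> f x = g x" by blast
      then have "f = g" using that by (intro extensionalityI[of f S g]) (auto simp: two_colorings_def PiE_def)
      then show ?thesis by simp
    qed auto
    let ?g = "restrict f0 S"
    have "two_colorings S E \<subseteq> {?g, restrict (\<lambda>x. \<not> ?g x) S}"
    proof
      fix f assume f: "f \<in> two_colorings S E"
      have ext: "f \<in> extensional S" using f by (auto simp: two_colorings_def PiE_def)
      from two[OF f res[OF f0 SX(1)]] show "f \<in> {?g, restrict (\<lambda>x. \<not> ?g x) S}"
      proof
        assume "\<forall>x\<in>S. f x = (\<not> ?g x)"
        then have "f = restrict (\<lambda>x. \<not> ?g x) S" by (intro extensionalityI[OF ext]) simp_all
        then show ?thesis by blast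
      qed blast
    qed
    then have "card (two_colorings S E) \<le> card {?g, restrict (\<lambda>x. \<not> ?g x) S}"
      by (rule card_mono[rotated]) simp
    also have "\<dots> \<le> 2" by (simp add: card_insert_if)
    finally have c2: "card (two_colorings S E) \<le> 2" .
    let ?h = "\<lambda>f. (restrict f S, restrict f (X - S))"
    have "inj_on ?h (two_colorings X E)"
    proof (rule inj_onI)
      fix f g assume a: "f \<in> two_colorings X E" "g \<in> two_colorings X E" "?h f = ?h g"
      show "f = g"
      proof (rule extensionalityI[of _ X])
        fix x assume "x \<in> X"
        then show "f x = g x" using a(3) by (cases "x \<in> S") (auto dest: fun_cong[of _ _ x])
      qed (use a in \<open>auto simp: two_colorings_def PiE_def\<close>)
    qed
    then have "card (two_colorings X E) = card (?h ` two_colorings X E)" by (simp add: card_image)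
    also have "\<dots> \<le> card (two_colorings S E \<times> two_colorings (X - S) E)"
      by (rule card_mono) (use res SX finS less.prems in \<open>auto simp: finite_two_colorings\<close>)
    finally have prod: "card (two_colorings X E) \<le> card (two_colorings S E) * card (two_colorings (X - S) E)"
      by (simp add: card_cartesian_product)
    have cX: "card X = card S + card (X - S)"
      using SX finS less.prems by (simp add: card_Diff_subset card_mono)
    have "two_colorings (X - S) E \<noteq> {}" using res[OF f0, of "X - S"] by auto
    then obtain j where j: "card (two_colorings (X - S) E) * 2 ^ j \<le> 2 ^ card (X - S)"
        "4 * card (edges_in (X - S) E) \<le> (j + 1) ^ 2"
      using less.hyps[of "X - S"] SX finS less.prems cX by (metis card_gt_0_iff finite_Diff less_add_same_cancel2)
    have "edges_in X E \<subseteq> edges_in S E \<union> edges_in (X - S) E"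
    proof
      fix e assume e: "e \<in> edges_in X E"
      then have "e \<in> nsets V 2" using E by (auto simp: edges_in_def)
      then obtain x y where xy: "e = {x, y}" by (auto simp: nsets_def card_2_iff)
      then have xX: "x \<in> X" "y \<in> X" "{x, y} \<in> E" "{y, x} \<in> E" using e by (auto simp: edges_in_def insert_commute)
      then have "x \<in> S \<longleftrightarrow> y \<in> S" using clS by blast
      then show "e \<in> edges_in S E \<union> edges_in (X - S) E" using xX xy by (auto simp: edges_in_def)
    qed
    moreover have finE: "finite (edges_in W E)" if "W \<subseteq> X" for W
      using that less.prems by (auto simp: edges_in_def intro!: finite_subset[of _ "Pow X"])
    ultimately have "card (edges_in X E) \<le> card (edges_in S E \<union> edges_in (X - S) E)"
      by (intro card_mono) (use SX in auto)
    also have "\<dots> \<le> card (edges_in S E) + card (edges_in (X - S) E)" by (rule card_Un_le)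
    finally have eX: "card (edges_in X E) \<le> card (edges_in S E) + card (edges_in (X - S) E)" .
    have eS: "4 * card (edges_in S E) \<le> card S ^ 2"
      by (rule edges_in_two_colorable_le[OF finS res[OF f0 SX(1)] E])
    have S1: "1 \<le> card S" using SX finS by (simp add: Suc_le_eq card_gt_0_iff)
    define i where "i = card S - 1"
    have i: "card S = i + 1" using S1 by (simp add: i_def)
    have "card (two_colorings X E) * 2 ^ (i + j) \<le> 2 * card (two_colorings (X - S) E) * 2 ^ (i + j)"
      using prod c2 by (meson le_trans mult_le_mono1)
    also have "\<dots> = 2 ^ card S * (card (two_colorings (X - S) E) * 2 ^ j)" using i by (simp add: power_add)
    also have "\<dots> \<le> 2 ^ card S * 2 ^ card (X - S)" by (rule mult_le_mono2[OF j(1)])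
    also have "\<dots> = 2 ^ card X" by (simp add: cX power_add)
    finally have c: "card (two_colorings X E) * 2 ^ (i + j) \<le> 2 ^ card X" .
    have "4 * card (edges_in X E) \<le> (i + j + 1) ^ 2"
    \<comment> \<open>Superadditivity of the squares fails when a deficit is 0, but then that part
      has no edges at all.\<close>
    proof (cases "i = 0 \<or> j = 0")
      case True
      then show ?thesis
      proof
        assume "i = 0"
        then have "card (edges_in S E) = 0" using eS i by simp
        then show ?thesis using eX j(2) \<open>i = 0\<close> by simp
      next
        assume "j = 0"
        then have "card (edges_in (X - S) E) = 0" using j(2) by simp
        then show ?thesis using eX eS i \<open>j = 0\<close> by simp
      qed
    next
      case False
      then have "1 \<le> i * j" by (simp add: Suc_le_eq)
      moreover have "(i + 1)\<^sup>2 + (j + 1)\<^sup>2 + 2 * (i * j) = (i + j + 1)\<^sup>2 + 1"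
        by (simp add: power2_eq_square algebra_simps)
      ultimately have "(i + 1)\<^sup>2 + (j + 1)\<^sup>2 \<le> (i + j + 1)\<^sup>2" by linarith
      then show ?thesis using eX eS i j(2) by simp
    qed
    then show ?thesis using c by blast
  qed
qed

section \<open>Bipartite graphs with few missing edges\<close>

text \<open>\<open>p\<close> and \<open>q\<close> are the colour class sizes on the two sides, and
  the sum of products counts the monochromatic pairs across. If all \<open>p i\<close> were
  positive, then \<open>q i \<le> p i * q i\<close> would contradict the second hypothesis; likewise
  for \<open>q\<close>. If the same colour is absent from both sides, applying this to the other two
  colours shows another one absent from a side. So one side uses \<open>c\<close>, \<open>d\<close>
  and the other \<open>c\<close>, \<open>e\<close>.\<close>

lemma one_shared_class:
  fixes p q :: "nat \<Rightarrow> nat"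
  assumes "p 0 * q 0 + p 1 * q 1 + p 2 * q 2 < p 0 + p 1 + p 2"
    and "p 0 * q 0 + p 1 * q 1 + p 2 * q 2 < q 0 + q 1 + q 2"
  shows "\<exists>c<3. \<exists>d<3. \<exists>e<3. c \<noteq> d \<and> c \<noteq> e \<and> d \<noteq> e \<and> p e = 0 \<and> q d = 0"
proof -
  let ?s = "\<lambda>f. f 0 + f 1 + f (2::nat) :: nat"
  let ?t = "\<lambda>i. p i * q i"
  have lt: "?s ?t < ?s p" "?s ?t < ?s q" using assms by simp_all
  have third: "\<exists>c<3. \<exists>d<3. \<exists>e<3. c \<noteq> d \<and> c \<noteq> e \<and> d \<noteq> e \<and> p e = 0 \<and> q d = 0"
    if "i < 3" "j < 3" "i \<noteq> j" "p i = 0" "q j = 0" for i j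
    by (rule exI[of _ "3 - i - j"], intro conjI, use that in linarith, rule exI[of _ j], intro conjI,
        use that in linarith, rule exI[of _ i]) (use that in presburger)
  have "\<not> (0 < p 0 \<and> 0 < p 1 \<and> 0 < p 2)"
  proof
    assume "0 < p 0 \<and> 0 < p 1 \<and> 0 < p 2"
    then have "q 0 \<le> ?t 0" "q 1 \<le> ?t 1" "q 2 \<le> ?t 2" by simp_all
    then show False using lt(2) by linarith
  qed
  then obtain i where i: "i = 0 \<or> i = 1 \<or> i = 2" "p i = 0" by auto
  have "\<not> (0 < q 0 \<and> 0 < q 1 \<and> 0 < q 2)"
  proof
    assume "0 < q 0 \<and> 0 < q 1 \<and> 0 < q 2"
    then have "p 0 \<le> ?t 0" "p 1 \<le> ?t 1" "p 2 \<le> ?t 2" by simp_all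
    then show False using lt(1) by linarith
  qed
  then obtain j where j: "j = 0 \<or> j = 1 \<or> j = 2" "q j = 0" by auto
  have ij: "i < 3" "j < 3" using i j by auto
  show ?thesis
  proof (cases "i = j")
    case False
    then show ?thesis using third[OF ij] i j by blast
  next
    case True
    obtain k l where kl: "k < 3" "l < 3" "k \<noteq> i" "l \<noteq> i" "\<And>f. ?s f = f i + f k + f l"
    proof -
      from i(1) consider "i = 0" | "i = 1" | "i = 2" by blast
      then show thesis
      proof cases
        case 1 show thesis by (rule that[of 1 2]) (use 1 in simp_all)
      next
        case 2 show thesis by (rule that[of 0 2]) (use 2 in simp_all)
      next
        case 3 show thesis by (rule that[of 0 1]) (use 3 in simp_all)
      qed
    qed
    have "q k = 0 \<or> q l = 0"
    proof (rule ccontr)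
      assume "\<not> ?thesis"
      then have "p k \<le> ?t k" "p l \<le> ?t l" by simp_all
      then show False using lt(1) kl(5)[of p] kl(5)[of ?t] i by linarith
    qed
    then show ?thesis using third[of i k] third[of i l] ij kl i by blast
  qed
qed

lemma card_color_classes:
  assumes "finite A" "\<And>v. v \<in> A \<Longrightarrow> f v < (3::nat)"
  shows "card A = card {v \<in> A. f v = 0} + card {v \<in> A. f v = 1} + card {v \<in> A. f v = 2}"
proof -
  have "A = {v \<in> A. f v = 0} \<union> {v \<in> A. f v = 1} \<union> {v \<in> A. f v = 2}"
  proof -
    have "f v = 0 \<or> f v = 1 \<or> f v = 2" if "v \<in> A" for v using assms(2)[OF that] by linarith
    then show ?thesis by auto
  qed
  then have "card A = card ({v \<in> A. f v = 0} \<union> {v \<in> A. f v = 1} \<union> {v \<in> A. f v = 2})" by simp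
  also have "\<dots> = card {v \<in> A. f v = 0} + card {v \<in> A. f v = 1} + card {v \<in> A. f v = 2}"
    using assms(1) by (subst card_Un_disjoint, auto)+
  finally show ?thesis .
qed

text \<open>\<open>S\<close> carries the colour \<open>c\<close> shared by both sides, the rest of
  \<open>A\<close> has \<open>d\<close>, and the rest of \<open>X\<close> has the third colour,
  which is \<open>3 - c - d\<close> since 0 + 1 + 2 = 3.\<close>

definition swap_coloring :: "'a set \<Rightarrow> 'a set \<Rightarrow> 'a set \<Rightarrow> 'a set \<Rightarrow> nat \<Rightarrow> nat \<Rightarrow> ('a \<Rightarrow> nat) \<Rightarrow> 'a \<Rightarrow> nat" where
  "swap_coloring V A X S c d g = (\<lambda>v\<in>V. if v \<in> S then c else if v \<in> A then d else if v \<in> X then 3 - c - d else g v)"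

definition color_pairs :: "(nat \<times> nat) set" where
  "color_pairs = Sigma {..<3} (\<lambda>c. {..<3} - {c})"

lemma card_color_pairs: "card color_pairs = 6"
  unfolding color_pairs_def by (subst card_SigmaI) (auto simp: card_lessThan_3_Diff)

text \<open>A colouring in which the two sides share a colour \<open>c\<close> has exactly one shared colour, because
  there are few missing edges; the rectangle of pairs coloured \<open>c\<close>, the colour \<open>c\<close> and the other
  colour on \<open>A\<close> determine it on \<open>A \<union> X\<close>.\<close>

lemma shared_coloring:
  assumes fin: "finite V" and sub: "A \<subseteq> V" "X \<subseteq> V" "A \<inter> X = {}"
    and D: "D \<subseteq> bip A X" "card D < card A" "card D < card X"
    and f: "f \<in> cols3 V (bip A X - D)" "f \<notin> split_colorings V A X"
  obtains \<beta> c d where "\<beta> \<subseteq> D" "\<beta> \<noteq> {}" "(c, d) \<in> color_pairs"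
    "f = swap_coloring V A X (\<Union>\<beta>) c d (restrict f (V - A - X))"
    "\<And>a x a' x'. {a, x} \<in> \<beta> \<Longrightarrow> {a', x'} \<in> \<beta> \<Longrightarrow> a \<in> A \<Longrightarrow> x' \<in> X \<Longrightarrow> {a, x'} \<in> \<beta>"
proof -
  define \<beta> where "\<beta> = {{a, x} | a x. a \<in> A \<and> x \<in> X \<and> f a = f x}"
  have \<beta>I: "{a, x} \<in> \<beta>" if "a \<in> A" "x \<in> X" "f a = f x" for a x
    unfolding \<beta>_def using that by blast
  define P where "P c = {v \<in> A. f v = c}" for c
  define Q where "Q c = {v \<in> X. f v = c}" for c
  have finAX: "finite A" "finite X" using fin sub(1,2) by (blast intro: finite_subset)+
  have f3: "f v < 3" if "v \<in> V" for v using f(1) that by (auto simp: list_colorings_def)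
  have pr: "f a \<noteq> f x" if "a \<in> A" "x \<in> X" "{a, x} \<notin> D" for a x
  proof -
    have "{a, x} \<in> bip A X - D" using that by (auto simp: bip_def)
    then show ?thesis using f(1) that sub unfolding list_colorings_def by blast
  qed
  have \<beta>D: "\<beta> \<subseteq> D" using pr by (auto simp: \<beta>_def)
  have finD: "finite D" using D(1) finAX finite_bip finite_subset by blast
  have \<beta>ne: "\<beta> \<noteq> {}"
  proof
    assume "\<beta> = {}"
    then have "\<And>a x. a \<in> A \<Longrightarrow> x \<in> X \<Longrightarrow> f a \<noteq> f x" by (auto simp: \<beta>_def)
    moreover have "f \<in> PiE V (\<lambda>_. {..<3})" using f(1) by (simp add: list_colorings_def)
    ultimately show False using f(2) by (simp add: split_colorings_def)
  qed
  \<comment> \<open>The monochromatic pairs split by colour into complete bipartite pieces. Their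
    number is therefore a sum of products of class sizes, and as all of them are deleted edges it
    stays below both side sizes, as \<open>one_shared_class\<close> requires.\<close>
  have "\<beta> = bip (P 0) (Q 0) \<union> bip (P 1) (Q 1) \<union> bip (P 2) (Q 2)" (is "_ = ?U")
  proof
    show "\<beta> \<subseteq> ?U"
    proof
      fix e assume "e \<in> \<beta>"
      then obtain a x where e: "e = {a, x}" "a \<in> A" "x \<in> X" "f a = f x" by (auto simp: \<beta>_def)
      then have "e \<in> bip (P (f a)) (Q (f a))" by (auto simp: bip_def P_def Q_def)
      moreover have "f a < 3" using f3[of a] e sub(1) by blast
      then have "f a = 0 \<or> f a = 1 \<or> f a = 2" by linarith
      ultimately show "e \<in> ?U" by auto
    qed
    have "bip (P i) (Q i) \<subseteq> \<beta>" for i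
    proof
      fix e assume "e \<in> bip (P i) (Q i)"
      then obtain a x where "e = {a, x}" "a \<in> P i" "x \<in> Q i" by (auto simp: bip_def)
      then show "e \<in> \<beta>" unfolding \<beta>_def P_def Q_def by force
    qed
    then show "?U \<subseteq> \<beta>" by blast
  qed
  moreover have dPQ: "P i \<inter> Q j = {}" for i j using sub by (auto simp: P_def Q_def)
  have dj: "bip (P i) (Q i) \<inter> bip (P j) (Q j) = {}" if "i \<noteq> j" for i j
    using that sub by (auto simp: bip_def P_def Q_def doubleton_eq_iff)
  have fPQ: "finite (P i)" "finite (Q i)" for i using finAX by (auto simp: P_def Q_def)
  ultimately have "card \<beta> = card (P 0) * card (Q 0) + card (P 1) * card (Q 1) + card (P 2) * card (Q 2)"
    using dj by (simp add: card_Un_disjoint fPQ Int_Un_distrib2 card_bip[OF dPQ])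
  moreover have "card \<beta> \<le> card D" using \<beta>D finD by (rule card_mono[rotated])
  moreover have "card A = card (P 0) + card (P 1) + card (P 2)"
    unfolding P_def by (rule card_color_classes) (use finAX f3 sub in auto)
  moreover have "card X = card (Q 0) + card (Q 1) + card (Q 2)"
    unfolding Q_def by (rule card_color_classes) (use finAX f3 sub in auto)
  ultimately have "\<exists>c<3. \<exists>d<3. \<exists>e<3. c \<noteq> d \<and> c \<noteq> e \<and> d \<noteq> e \<and> card (P e) = 0 \<and> card (Q d) = 0"
    using D(2,3) by (intro one_shared_class) auto
  then obtain c d e where cde: "c < 3" "d < 3" "e < 3" "c \<noteq> d" "c \<noteq> e" "d \<noteq> e"
    and PQ: "P e = {}" "Q d = {}" using fPQ by auto
  have e: "e = 3 - c - d" using cde by linarith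
  have Ac: "f a = c \<or> f a = d" if "a \<in> A" for a
  proof -
    have "f a \<noteq> e" using PQ that by (auto simp: P_def)
    then show ?thesis using f3[of a] cde that sub by fastforce
  qed
  have Xc: "f x = c \<or> f x = e" if "x \<in> X" for x
  proof -
    have "f x \<noteq> d" using PQ that by (auto simp: Q_def)
    then show ?thesis using f3[of x] cde that sub by fastforce
  qed
  obtain a0 x0 where ax: "a0 \<in> A" "x0 \<in> X" "f a0 = f x0" using \<beta>ne by (auto simp: \<beta>_def)
  then have c0: "f a0 = c" "f x0 = c" using Ac[of a0] Xc[of x0] cde by auto
  have UA: "v \<in> \<Union>\<beta> \<longleftrightarrow> f v = c" if "v \<in> A" for v
  proof
    assume "f v = c"
    then have "{v, x0} \<in> \<beta>" using that ax c0 by (intro \<beta>I) auto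
    then show "v \<in> \<Union>\<beta>" by blast
  next
    assume "v \<in> \<Union>\<beta>"
    then obtain a x where "a \<in> A" "x \<in> X" "f a = f x" "v = a \<or> v = x" by (auto simp: \<beta>_def)
    then show "f v = c" using that sub Ac[of a] Xc[of x] cde by auto
  qed
  have UX: "v \<in> \<Union>\<beta> \<longleftrightarrow> f v = c" if "v \<in> X" for v
  proof
    assume "f v = c"
    then have "{a0, v} \<in> \<beta>" using that ax c0 by (intro \<beta>I) auto
    then show "v \<in> \<Union>\<beta>" by blast
  next
    assume "v \<in> \<Union>\<beta>"
    then obtain a x where "a \<in> A" "x \<in> X" "f a = f x" "v = a \<or> v = x" by (auto simp: \<beta>_def)
    then show "f v = c" using that sub Ac[of a] Xc[of x] cde by auto
  qed
  have UR: "v \<notin> \<Union>\<beta>" if "v \<notin> A" "v \<notin> X" for v using that by (auto simp: \<beta>_def)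
  have "f = swap_coloring V A X (\<Union>\<beta>) c d (restrict f (V - A - X))"
  proof (rule extensionalityI[of _ V])
    show "f \<in> extensional V" using f(1) by (auto simp: list_colorings_def PiE_def)
    show "swap_coloring V A X (\<Union>\<beta>) c d (restrict f (V - A - X)) \<in> extensional V"
      by (simp add: swap_coloring_def)
    fix v assume v: "v \<in> V"
    consider "v \<in> A" | "v \<in> X" | "v \<notin> A" "v \<notin> X" by blast
    then show "f v = swap_coloring V A X (\<Union>\<beta>) c d (restrict f (V - A - X)) v"
    proof cases
      case 1
      then show ?thesis using v UA[OF 1] Ac[OF 1] by (auto simp: swap_coloring_def simp del: Union_iff)
    next
      case 2
      then have "v \<notin> A" using sub by blast
      then show ?thesis using v 2 UX[OF 2] Xc[OF 2] e by (auto simp: swap_coloring_def simp del: Union_iff)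
    next
      case 3
      then show ?thesis using v UR[OF 3] by (simp add: swap_coloring_def del: Union_iff)
    qed
  qed
  then have sw: "f = swap_coloring V A X (\<Union>\<beta>) c d (restrict f (V - A - X))" .
  have rect: "{a, x'} \<in> \<beta>" if "{a, x} \<in> \<beta>" "{a', x'} \<in> \<beta>" "a \<in> A" "x' \<in> X" for a x a' x'
  proof -
    have "a \<in> \<Union>\<beta>" "x' \<in> \<Union>\<beta>" using that(1,2) by blast+
    then have "f a = c" "f x' = c" using UA UX that by blast+
    then show ?thesis using that by (intro \<beta>I) auto
  qed
  have "(c, d) \<in> color_pairs" using cde by (auto simp: color_pairs_def)
  from \<beta>D \<beta>ne this sw show thesis by (rule that) (use rect in blast)
qed

text \<open>Bipartite graphs have no triangles. An edge avoiding \<open>a\<close> must meet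
  \<open>{a, x}\<close> in \<open>x\<close>, an edge avoiding \<open>x\<close> must meet it in
  \<open>a\<close>, and these two would be disjoint.\<close>

lemma pairwise_intersecting_star:
  assumes D: "D \<subseteq> bip A X" "A \<inter> X = {}" and int: "\<And>e e'. e \<in> D \<Longrightarrow> e' \<in> D \<Longrightarrow> e \<inter> e' \<noteq> {}"
  shows "\<exists>v. \<forall>e\<in>D. v \<in> e"
proof (rule ccontr)
  assume neg: "\<not> ?thesis"
  then obtain e where "e \<in> D" by blast
  then obtain a x where e: "{a, x} \<in> D" "a \<in> A" "x \<in> X" using D by (auto simp: bip_def)
  obtain e1 where e1: "e1 \<in> D" "a \<notin> e1" using neg by blast
  then have "e1 \<in> bip A X" using D by blast
  then obtain a1 x1 where 1: "e1 = {a1, x1}" "a1 \<in> A" "x1 \<in> X" by (auto simp: bip_def)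
  obtain e2 where e2: "e2 \<in> D" "x \<notin> e2" using neg by blast
  then have "e2 \<in> bip A X" using D by blast
  then obtain a2 x2 where 2: "e2 = {a2, x2}" "a2 \<in> A" "x2 \<in> X" by (auto simp: bip_def)
  have "x1 = x" using int[OF e(1) e1(1)] e1(2) e 1 D(2) by auto
  moreover have "a2 = a" using int[OF e(1) e2(1)] e2(2) e 2 D(2) by auto
  ultimately show False using int[OF e1(1) e2(1)] e1(2) e2(2) 1 2 D(2) e by auto
qed

text \<open>Beyond the split colourings, each colouring is given by a nonempty rectangle of deleted
  edges, an ordered pair of colours and the colours of the remaining vertices. There are at most
  \<open>2 ^ card D - 1\<close> rectangles, and fewer unless \<open>D\<close> is a star: two
  disjoint deleted edges alone do not form a rectangle.\<close>

lemma card_bip_minus_le: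
  assumes fin: "finite V" and sub: "A \<subseteq> V" "X \<subseteq> V" "A \<inter> X = {}"
    and D: "D \<subseteq> bip A X" "card D < card A" "card D < card X"
    and r: "r = card V - card A - card X"
  shows "card (cols3 V (bip A X - D)) + 6 * 3 ^ r \<le>
      (3 * 2 ^ card X + 3 * 2 ^ card A) * 3 ^ r + 6 * (2 ^ card D - 1) * 3 ^ r"
    and "\<not> (\<exists>v. \<forall>e\<in>D. v \<in> e) \<Longrightarrow> card (cols3 V (bip A X - D)) + 6 * 3 ^ r <
      (3 * 2 ^ card X + 3 * 2 ^ card A) * 3 ^ r + 6 * (2 ^ card D - 1) * 3 ^ r"
proof -
  have finAX: "finite A" "finite X" using fin sub(1,2) by (blast intro: finite_subset)+
  have finD: "finite D" using D(1) finAX finite_bip finite_subset by blast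
  have ne: "A \<noteq> {}" "X \<noteq> {}" using D by auto
  let ?R = "PiE (V - A - X) (\<lambda>_. {..<3::nat})"
  let ?F = "\<lambda>(\<beta>, (c, d), g). swap_coloring V A X (\<Union>\<beta>) c d g"
  have cR: "card ?R = 3 ^ r"
  proof -
    have "card (V - A - X) = r"
      unfolding r using finAX fin sub by (subst card_Diff_subset, simp, blast, subst card_Diff_subset) auto
    then show ?thesis using fin by (simp add: card_PiE)
  qed
  \<comment> \<open>\<open>B\<close> is any family containing all rectangles inside
    \<open>D\<close>; it is taken as all nonempty subsets, and then with one non-rectangle
    removed.\<close>
  have main: "card (cols3 V (bip A X - D)) + 6 * 3 ^ r \<le>
      (3 * 2 ^ card X + 3 * 2 ^ card A) * 3 ^ r + 6 * card B * 3 ^ r"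
    if "finite B" and B: "\<And>\<beta>. \<beta> \<subseteq> D \<Longrightarrow> \<beta> \<noteq> {} \<Longrightarrow>
      (\<And>a x a' x'. {a, x} \<in> \<beta> \<Longrightarrow> {a', x'} \<in> \<beta> \<Longrightarrow> a \<in> A \<Longrightarrow> x' \<in> X \<Longrightarrow> {a, x'} \<in> \<beta>) \<Longrightarrow> \<beta> \<in> B" for B
  proof -
    have finT: "finite (B \<times> color_pairs \<times> ?R)" using that(1) fin by (auto simp: color_pairs_def intro!: finite_PiE)
    have "cols3 V (bip A X - D) \<subseteq> split_colorings V A X \<union> ?F ` (B \<times> color_pairs \<times> ?R)"
    proof
      fix f assume f: "f \<in> cols3 V (bip A X - D)"
      show "f \<in> split_colorings V A X \<union> ?F ` (B \<times> color_pairs \<times> ?R)"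
      proof (cases "f \<in> split_colorings V A X")
        case False
        show ?thesis
        proof (rule shared_coloring[OF fin sub D f False])
          fix \<beta> c d
          assume b: "\<beta> \<subseteq> D" "\<beta> \<noteq> {}" "(c, d) \<in> color_pairs"
            "f = swap_coloring V A X (\<Union>\<beta>) c d (restrict f (V - A - X))"
            "\<And>a x a' x'. {a, x} \<in> \<beta> \<Longrightarrow> {a', x'} \<in> \<beta> \<Longrightarrow> a \<in> A \<Longrightarrow> x' \<in> X \<Longrightarrow> {a, x'} \<in> \<beta>"
          have "restrict f (V - A - X) \<in> ?R" using f by (auto simp: list_colorings_def)
          moreover have "\<beta> \<in> B" using b(1,2) by (rule B) (rule b(5))
          ultimately have "(\<beta>, (c, d), restrict f (V - A - X)) \<in> B \<times> color_pairs \<times> ?R"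
            using b(3) by simp
          moreover have "f = ?F (\<beta>, (c, d), restrict f (V - A - X))"
            unfolding prod.case by (rule b(4))
          ultimately have "f \<in> ?F ` (B \<times> color_pairs \<times> ?R)" by (rule image_eqI[rotated])
          then show "f \<in> split_colorings V A X \<union> ?F ` (B \<times> color_pairs \<times> ?R)" by (rule UnI2)
        qed
      qed simp
    qed
    moreover have "finite (split_colorings V A X)"
      using fin by (auto simp: split_colorings_def intro!: finite_subset[OF _ finite_PiE[of V "\<lambda>_. {..<3}"]])
    ultimately have "card (cols3 V (bip A X - D)) \<le> card (split_colorings V A X \<union> ?F ` (B \<times> color_pairs \<times> ?R))"
      using finT by (intro card_mono) auto
    moreover have "\<dots> \<le> card (split_colorings V A X) + card (?F ` (B \<times> color_pairs \<times> ?R))"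
      by (rule card_Un_le)
    moreover have "card (?F ` (B \<times> color_pairs \<times> ?R)) \<le> card (B \<times> color_pairs \<times> ?R)"
      using finT by (rule card_image_le)
    moreover have "card (B \<times> color_pairs \<times> ?R) = 6 * card B * 3 ^ r" by (simp add: card_cartesian_product card_color_pairs cR)
    moreover have "card (split_colorings V A X) + 6 * 3 ^ r = (3 * 2 ^ card X + 3 * 2 ^ card A) * 3 ^ r"
      using card_split_colorings[OF fin sub ne] r by simp
    ultimately show ?thesis by linarith
  qed
  have "card (Pow D - {{}}) = 2 ^ card D - 1" using finD by (simp add: card_Pow)
  moreover have "card (cols3 V (bip A X - D)) + 6 * 3 ^ r \<le>
      (3 * 2 ^ card X + 3 * 2 ^ card A) * 3 ^ r + 6 * card (Pow D - {{}}) * 3 ^ r"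
    by (rule main) (use finD in auto)
  ultimately show "card (cols3 V (bip A X - D)) + 6 * 3 ^ r \<le>
      (3 * 2 ^ card X + 3 * 2 ^ card A) * 3 ^ r + 6 * (2 ^ card D - 1) * 3 ^ r" by simp
  assume "\<not> (\<exists>v. \<forall>e\<in>D. v \<in> e)"
  then obtain e e' where ee: "e \<in> D" "e' \<in> D" "e \<inter> e' = {}"
    using pairwise_intersecting_star[OF D(1) sub(3)] by blast
  let ?B = "Pow D - {{}} - {{e, e'}}"
  have "card ?B < card (Pow D - {{}})" by (rule psubset_card_mono) (use finD ee in auto)
  then have "card ?B < 2 ^ card D - 1" using finD by (simp add: card_Pow)
  then have "6 * card ?B * 3 ^ r < 6 * (2 ^ card D - 1) * (3::nat) ^ r" by simp
  moreover have "card (cols3 V (bip A X - D)) + 6 * 3 ^ r \<le>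
      (3 * 2 ^ card X + 3 * 2 ^ card A) * 3 ^ r + 6 * card ?B * 3 ^ r"
  proof (rule main)
    fix \<beta> assume b: "\<beta> \<subseteq> D" "\<beta> \<noteq> {}"
      "\<And>a x a' x'. {a, x} \<in> \<beta> \<Longrightarrow> {a', x'} \<in> \<beta> \<Longrightarrow> a \<in> A \<Longrightarrow> x' \<in> X \<Longrightarrow> {a, x'} \<in> \<beta>"
    have "\<beta> \<noteq> {e, e'}"
    proof
      assume eq: "\<beta> = {e, e'}"
      obtain a x where e: "e = {a, x}" "a \<in> A" "x \<in> X" using ee D by (auto simp: bip_def)
      obtain a' x' where e': "e' = {a', x'}" "a' \<in> A" "x' \<in> X" using ee D by (auto simp: bip_def)
      have "{a, x'} \<in> \<beta>" using b(3)[of a x a' x'] eq e e' by blast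
      then show False using eq e e' ee(3) sub(3) by (auto simp: doubleton_eq_iff)
    qed
    then show "\<beta> \<in> ?B" using b by blast
  qed (use finD in auto)
  ultimately show "card (cols3 V (bip A X - D)) + 6 * 3 ^ r <
      (3 * 2 ^ card X + 3 * 2 ^ card A) * 3 ^ r + 6 * (2 ^ card D - 1) * 3 ^ r" by linarith
qed

text \<open>In a star every nonempty set of deleted edges is a rectangle, so the upper bound of
  \<open>card_bip_minus_le\<close> is attained.\<close>

lemma card_bip_minus_star_ge:
  assumes fin: "finite V" and sub: "A \<subseteq> V" "X \<subseteq> V" "A \<inter> X = {}"
    and T: "T \<subseteq> A" "card T < card A" and y: "y \<in> X"
    and r: "r = card V - card A - card X"
  shows "card (cols3 V (bip A X - bip T {y})) + 6 * 3 ^ r \<ge>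
      (3 * 2 ^ card X + 3 * 2 ^ card A) * 3 ^ r + 6 * (2 ^ card T - 1) * 3 ^ r"
proof -
  have finAX: "finite A" "finite X" using fin sub(1,2) by (blast intro: finite_subset)+
  have finT: "finite T" using T finAX finite_subset by blast
  have ne: "A \<noteq> {}" "X \<noteq> {}" using T y by auto
  let ?R = "PiE (V - A - X) (\<lambda>_. {..<3::nat})"
  let ?F = "\<lambda>(P, (c, d), g). swap_coloring V A X (insert y P) c d g"
  let ?B = "Pow T - {{}}"
  let ?S = "?B \<times> color_pairs \<times> ?R"
  have cR: "card ?R = 3 ^ r"
  proof -
    have "card (V - A - X) = r"
      unfolding r using finAX fin sub by (subst card_Diff_subset, simp, blast, subst card_Diff_subset) auto
    then show ?thesis using fin by (simp add: card_PiE)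
  qed
  have yV: "y \<in> V" "y \<notin> A" using y sub by auto
  have fA: "swap_coloring V A X (insert y P) c d g v = (if v \<in> P then c else d)" if "v \<in> A" "P \<subseteq> T" for v P c d g
    using that sub(1) yV by (auto simp: swap_coloring_def)
  have fy: "swap_coloring V A X (insert y P) c d g y = c" for P c d g
    using yV by (auto simp: swap_coloring_def)
  have fX: "swap_coloring V A X (insert y P) c d g v = 3 - c - d" if "v \<in> X" "v \<noteq> y" "P \<subseteq> T" for v P c d g
  proof -
    have "v \<in> V" "v \<notin> A" "v \<notin> P" using that sub T by auto
    then show ?thesis using that by (simp add: swap_coloring_def)
  qed
  have fR: "swap_coloring V A X (insert y P) c d g v = g v" if "v \<in> V - A - X" "P \<subseteq> T" for v P c d g
    using that T y by (auto simp: swap_coloring_def)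
  have cp: "c < 3" "d < 3" "c \<noteq> d" "3 - c - d < 3" "3 - c - d \<noteq> c" "3 - c - d \<noteq> d"
    if "(c, d) \<in> color_pairs" for c d
  proof -
    show "c < 3" "d < 3" "c \<noteq> d" using that by (auto simp: color_pairs_def)
    then show "3 - c - d < 3" "3 - c - d \<noteq> c" "3 - c - d \<noteq> d" by presburger+
  qed
  have inj: "inj_on ?F ?S"
  proof (rule inj_onI)
    fix s s' assume ss: "s \<in> ?S" "s' \<in> ?S" "?F s = ?F s'"
    obtain P c d g where s: "s = (P, (c, d), g)" by (metis prod.exhaust)
    obtain P' c' d' g' where s': "s' = (P', (c', d'), g')" by (metis prod.exhaust)
    have a: "P \<subseteq> T" "(c, d) \<in> color_pairs" "g \<in> ?R" "P' \<subseteq> T" "(c', d') \<in> color_pairs" "g' \<in> ?R"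
      and eq: "swap_coloring V A X (insert y P) c d g = swap_coloring V A X (insert y P') c' d' g'"
      using ss s s' by auto
    have c: "c = c'" using fun_cong[OF eq, of y] fy by simp
    have "P = {v \<in> A. swap_coloring V A X (insert y P) c d g v = c}"
      using a(1) T(1) cp(3)[OF a(2)] by (auto simp: fA[OF _ a(1)] split: if_splits)
    also have "\<dots> = {v \<in> A. swap_coloring V A X (insert y P') c' d' g' v = c'}" using eq c by simp
    also have "\<dots> = P'" using a(4) T(1) cp(3)[OF a(5)] by (auto simp: fA[OF _ a(4)] split: if_splits)
    finally have P: "P = P'" .
    have "card P < card A" using card_mono[OF finT a(1)] T by simp
    \<comment> \<open>As the star misses some vertex of \<open>A\<close>, the colour
      \<open>d\<close> is visible there and can be recovered from the colouring.\<close>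
    then obtain v where v: "v \<in> A" "v \<notin> P" using a(1) T(1) by (metis finAX(1) psubsetI subset_iff order.irrefl order.trans set_eq_subset)
    have d: "d = d'" using fun_cong[OF eq, of v] fA[OF v(1) a(1)] fA[OF v(1) a(4)] v P by simp
    have "g = g'"
    proof (rule extensionalityI[of _ "V - A - X"])
      fix u assume "u \<in> V - A - X"
      then show "g u = g' u" using fun_cong[OF eq, of u] fR a(1,4) by simp
    qed (use a in \<open>auto simp: PiE_def\<close>)
    then show "s = s'" using P c d s s' by simp
  qed
  have im: "?F ` ?S \<subseteq> cols3 V (bip A X - bip T {y}) - split_colorings V A X"
  proof (rule image_subsetI)
    fix s assume sS: "s \<in> ?S"
    obtain P c d g where s: "s = (P, (c, d), g)" by (metis prod.exhaust)
    have a: "P \<subseteq> T" "P \<noteq> {}" "(c, d) \<in> color_pairs" "g \<in> ?R" using sS unfolding s by simp_all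
    let ?f = "swap_coloring V A X (insert y P) c d g"
    have g: "g u < 3" if "u \<in> V - A - X" for u using a(4) that by auto
    have "?f u < 3" if "u \<in> V" for u
    proof -
      have "u \<in> A \<or> u = y \<or> u \<in> X \<and> u \<noteq> y \<or> u \<in> V - A - X" using that by blast
      then consider "u \<in> A" | "u = y" | "u \<in> X" "u \<noteq> y" | "u \<in> V - A - X" by metis
      then show ?thesis
      proof cases
        case 1 then show ?thesis using fA[OF 1 a(1), of c d g] cp[OF a(3)] by simp
      next
        case 2 then show ?thesis using fy[of P c d g] cp[OF a(3)] by simp
      next
        case 3 then show ?thesis using fX[OF 3 a(1), of c d g] cp[OF a(3)] by simp
      next
        case 4 then show ?thesis using fR[OF 4 a(1), of c d g] g[OF 4] by simp
      qed
    qed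
    then have PiE: "?f \<in> PiE V (\<lambda>_. {..<3})" by (auto simp: swap_coloring_def)
    have ax: "?f u \<noteq> ?f v" if "u \<in> A" "v \<in> X" "{u, v} \<notin> bip T {y}" for u v
    proof (cases "v = y")
      case True
      then have "u \<notin> T" using that by (auto simp: bip_def)
      then have "u \<notin> P" using a by blast
      then show ?thesis using True fA[OF that(1) a(1)] fy cp[OF a(3)] by simp
    next
      case False
      then show ?thesis using fA[OF that(1) a(1)] fX[OF that(2) False a(1)] cp[OF a(3)] by simp
    qed
    have "?f u \<noteq> ?f v" if "{u, v} \<in> bip A X - bip T {y}" for u v
      using that ax[of u v] ax[of v u] bip_iff[OF sub(3)] by (metis Diff_iff insert_commute)
    then have "?f \<in> cols3 V (bip A X - bip T {y})" using PiE by (simp add: list_colorings_def)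
    moreover obtain u where u: "u \<in> P" using a by blast
    then have "u \<in> A" using a T by blast
    then have "?f u = ?f y" using fA[OF _ a(1)] fy u by simp
    then have "?f \<notin> split_colorings V A X" using \<open>u \<in> A\<close> y by (auto simp: split_colorings_def)
    ultimately have "?f \<in> cols3 V (bip A X - bip T {y}) - split_colorings V A X" by blast
    then show "?F s \<in> cols3 V (bip A X - bip T {y}) - split_colorings V A X" by (simp add: s)
  qed
  have spl: "split_colorings V A X \<subseteq> cols3 V (bip A X - bip T {y})"
  proof
    fix f assume f: "f \<in> split_colorings V A X"
    have "f u \<noteq> f v" if "{u, v} \<in> bip A X" for u v
      using that bip_iff[OF sub(3)] f by (metis (mono_tags, lifting) mem_Collect_eq split_colorings_def)
    then show "f \<in> cols3 V (bip A X - bip T {y})" using f by (auto simp: split_colorings_def list_colorings_def)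
  qed
  have finc: "finite (cols3 V (bip A X - bip T {y}))" using fin by simp
  have "card ?S = card (?F ` ?S)" using inj by (simp add: card_image)
  also have "\<dots> \<le> card (cols3 V (bip A X - bip T {y}) - split_colorings V A X)"
    by (rule card_mono[OF _ im]) (use finc in simp)
  also have "\<dots> = card (cols3 V (bip A X - bip T {y})) - card (split_colorings V A X)"
    by (rule card_Diff_subset[OF finite_subset[OF spl finc] spl])
  finally have "card ?S + card (split_colorings V A X) \<le> card (cols3 V (bip A X - bip T {y}))"
    using card_mono[OF finc spl] by linarith
  moreover have "card ?S = 6 * (2 ^ card T - 1) * 3 ^ r"
    using finT by (simp add: card_cartesian_product card_color_pairs cR card_Pow)
  moreover have "card (split_colorings V A X) + 6 * 3 ^ r = (3 * 2 ^ card X + 3 * 2 ^ card A) * 3 ^ r"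
    using card_split_colorings[OF fin sub ne] r by simp
  ultimately show ?thesis by linarith
qed

section \<open>The cost of a bipartite split\<close>

abbreviation lp :: real where "lp \<equiv> ln 3"
abbreviation lr :: real where "lr \<equiv> ln (3 / 2)"

text \<open>The comparisons of \<open>lp\<close> with multiples of \<open>lr\<close> come from 9/4 <
  3 < 27/8.\<close>

lemma log_bounds:
  shows "1 / 3 \<le> lr" "lr \<le> 1 / 2" "2 * lr < lp" "lp < 3 * lr" "lp \<le> 3 / 2" "1 \<le> lp" "lp = lr + ln 2" "1 / 2 \<le> ln (2::real)"
proof -
  have "2 * lr = ln ((3/2) ^ 2)" by (subst ln_realpow) simp_all
  also have "\<dots> < lp" by (subst ln_less_cancel_iff) (simp_all add: power2_eq_square)
  finally show 1: "2 * lr < lp" .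
  have "3 * lr = ln ((3/2) ^ 3)" by (subst ln_realpow) simp_all
  moreover have "lp < ln ((3/2) ^ 3)" by (subst ln_less_cancel_iff) (simp_all add: power3_eq_cube)
  ultimately show "lp < 3 * lr" by simp
  show 2: "lr \<le> 1 / 2" using ln_le_minus_one[of "3/2"] by simp
  have "ln (2/3) \<le> (2/3 :: real) - 1" by (rule ln_le_minus_one) simp
  moreover have "ln (2/3) = - lr" by (simp add: ln_div)
  ultimately show "1 / 3 \<le> lr" by simp
  show 3: "lp = lr + ln 2" by (simp add: ln_div)
  have "ln (2::real) \<le> 2 - 1" by (rule ln_le_minus_one) simp
  then show "lp \<le> 3 / 2" using 2 3 by simp
  have "ln (1/2) \<le> (1/2 :: real) - 1" by (rule ln_le_minus_one) simp
  then show "1 / 2 \<le> ln (2::real)" by (simp add: ln_div)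
  show "1 \<le> lp" using exp_le by (subst ln_ge_iff) auto
qed

definition cost :: "real \<Rightarrow> real \<Rightarrow> real" where
  "cost m X = X * lp + lr * m / X"

text \<open>The zero of the derivative of \<open>cost m\<close>, where \<open>X * lp\<close> and
  \<open>lr * m / X\<close> are equal.\<close>

definition sparse_opt :: "real \<Rightarrow> real" where
  "sparse_opt m = sqrt (m * (lr / lp))"

text \<open>The minimiser of \<open>cost m\<close> among splits that fit, X + m / X \<le> n. As long
  as \<open>sparse_opt m\<close> fits it is the minimiser; afterwards it is the smaller root of X (n
  - X) = m, and \<open>kappa3\<close> marks the change. At the threshold both descriptions hold, so
  this is a relation and not a function by cases.\<close>

definition center :: "real \<Rightarrow> real \<Rightarrow> real \<Rightarrow> bool" where
  "center m n \<alpha> \<longleftrightarrow> (m \<le> kappa3 * n\<^sup>2 \<and> \<alpha> = sparse_opt m) \<or>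
     (kappa3 * n\<^sup>2 \<le> m \<and> \<alpha> = (n - sqrt (n\<^sup>2 - 4 * m)) / 2)"

lemma kappa3_eq: "kappa3 = lp * lr / (lp + lr)\<^sup>2"
proof -
  have p: "lp > 0" "lr > 0" using log_bounds by linarith+
  have "(sqrt (lr / lp) + sqrt (lp / lr))\<^sup>2 = lr / lp + lp / lr + 2 * (sqrt (lr / lp) * sqrt (lp / lr))"
    using p by (simp add: power2_sum)
  also have "sqrt (lr / lp) * sqrt (lp / lr) = 1" using p by (simp add: real_sqrt_mult[symmetric])
  also have "lr / lp + lp / lr + 2 * 1 = (lp + lr)\<^sup>2 / (lp * lr)"
    using p by (simp add: field_simps power2_eq_square)
  finally show ?thesis unfolding kappa3_def by simp
qed

lemma sparse_opt_bounds:
  assumes "m > 0"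
  shows "sparse_opt m > 0" "(sparse_opt m)\<^sup>2 * lp = m * lr" "sqrt m / 2 \<le> sparse_opt m" "sparse_opt m < sqrt m"
proof -
  have p: "lp > 0" "lr > 0" using log_bounds by linarith+
  show "sparse_opt m > 0" using assms p by (simp add: sparse_opt_def)
  show "(sparse_opt m)\<^sup>2 * lp = m * lr" using assms p by (simp add: sparse_opt_def)
  have "sqrt m / 2 = sqrt (m * (1 / 4))" by (simp add: real_sqrt_mult real_sqrt_divide)
  also have "\<dots> \<le> sparse_opt m" unfolding sparse_opt_def
    using assms p log_bounds by (intro real_sqrt_le_mono mult_left_mono) (auto simp: field_simps)
  finally show "sqrt m / 2 \<le> sparse_opt m" .
  have "lr / lp < 1" using p log_bounds by (simp add: field_simps)
  then have "m * (lr / lp) < m * 1" using assms by (intro mult_strict_left_mono) auto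
  then show "sparse_opt m < sqrt m" unfolding sparse_opt_def by (intro real_sqrt_less_mono) simp
qed

text \<open>Lets later arguments treat both regimes at once: either the unconstrained minimum is
  reached or the constraint is tight.\<close>

lemma center_props:
  assumes c: "center m n \<alpha>" and m: "m > 0" "4 * m \<le> n\<^sup>2" and n: "n > 0"
  shows "sparse_opt m \<le> \<alpha>" "\<alpha> \<le> sqrt m" "2 * \<alpha> \<le> n" "m \<le> \<alpha> * (n - \<alpha>)"
    and "\<alpha> = sparse_opt m \<or> \<alpha> * (n - \<alpha>) = m"
proof -
  let ?u = "sparse_opt m"
  have p: "lp > 0" "lr > 0" using log_bounds by linarith+
  note u = sparse_opt_bounds[OF m(1)]
  have sn: "2 * sqrt m \<le> n"
  proof -
    have "sqrt (4 * m) \<le> sqrt (n\<^sup>2)" using m by (intro real_sqrt_le_mono)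
    then show ?thesis using n by (simp add: real_sqrt_mult)
  qed
  \<comment> \<open>Both \<open>kappa3 * n\<^sup>2\<close> and \<open>m\<close> are written as a
    square times the same positive factor. Comparing them is comparing \<open>lr * n\<close> with
    \<open>?u * (lp + lr)\<close>, that is, n with u + m / u.\<close>
  have k: "kappa3 * n\<^sup>2 = (lr * n)\<^sup>2 * (lp / (lr * (lp + lr)\<^sup>2))"
  proof -
    have "lp * lr / Q * n\<^sup>2 = (lr * n)\<^sup>2 * (lp / (lr * Q))" for Q
      using p by (simp add: power_mult_distrib power2_eq_square)
    then show ?thesis by (simp add: kappa3_eq)
  qed
  have mu: "m = (?u * (lp + lr))\<^sup>2 * (lp / (lr * (lp + lr)\<^sup>2))"
  proof -
    have "m = ?u\<^sup>2 * lp / lr" using u(2) p by (simp add: field_simps)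
    moreover have "?u\<^sup>2 * lp / lr = ?u\<^sup>2 * Q * (lp / (lr * Q))" if "Q > 0" for Q using p that by simp
    moreover have "(lp + lr)\<^sup>2 > 0" using add_pos_pos[OF p] by (simp only: zero_less_power)
    ultimately have "m = ?u\<^sup>2 * (lp + lr)\<^sup>2 * (lp / (lr * (lp + lr)\<^sup>2))" by metis
    then show ?thesis by (simp only: power_mult_distrib)
  qed
  have pos: "lp / (lr * (lp + lr)\<^sup>2) > 0" using p by (intro divide_pos_pos mult_pos_pos zero_less_power add_pos_pos)
  have nn: "?u * (lp + lr) \<ge> 0" "lr * n \<ge> 0" using u(1) p n by auto
  have "sparse_opt m \<le> \<alpha> \<and> \<alpha> \<le> sqrt m \<and> 2 * \<alpha> \<le> n \<and> m \<le> \<alpha> * (n - \<alpha>) \<and> (\<alpha> = sparse_opt m \<or> \<alpha> * (n - \<alpha>) = m)"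
    using c unfolding center_def
  proof (elim disjE conjE)
    assume sp: "m \<le> kappa3 * n\<^sup>2" and \<alpha>: "\<alpha> = ?u"
    then have "(?u * (lp + lr))\<^sup>2 * (lp / (lr * (lp + lr)\<^sup>2)) \<le> (lr * n)\<^sup>2 * (lp / (lr * (lp + lr)\<^sup>2))"
      using k mu by simp
    then have "(?u * (lp + lr))\<^sup>2 \<le> (lr * n)\<^sup>2" using pos by (simp only: mult_le_cancel_right_pos)
    then have le: "?u * (lp + lr) \<le> lr * n" by (rule power2_le_imp_le[OF _ nn(2)])
    have "lr * m = ?u * (?u * lp)" using u(2) by (simp add: power2_eq_square algebra_simps)
    also have "\<dots> \<le> ?u * (lr * (n - ?u))" using le u(1) by (intro mult_left_mono) (auto simp: algebra_simps)
    finally have "lr * m \<le> lr * (?u * (n - ?u))" by (simp add: algebra_simps)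
    then have "m \<le> ?u * (n - ?u)" using p by simp
    then show ?thesis using \<alpha> u sn by auto
  next
    assume de: "kappa3 * n\<^sup>2 \<le> m" and \<alpha>: "\<alpha> = (n - sqrt (n\<^sup>2 - 4 * m)) / 2"
    have sq: "(sqrt (n\<^sup>2 - 4 * m))\<^sup>2 = n\<^sup>2 - 4 * m" using m by simp
    have prod: "\<alpha> * (n - \<alpha>) = m" unfolding \<alpha> using sq by (simp add: power2_eq_square field_simps)
    have s0: "sqrt (n\<^sup>2 - 4 * m) \<ge> 0" using m by simp
    have "sqrt (n\<^sup>2 - 4 * m) \<le> sqrt (n\<^sup>2)" using m by (intro real_sqrt_le_mono) simp
    then have "sqrt (n\<^sup>2 - 4 * m) \<le> n" using n by simp
    moreover have "2 * \<alpha> = n - sqrt (n\<^sup>2 - 4 * m)" using \<alpha> by simp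
    ultimately have a0: "\<alpha> \<ge> 0" "2 * \<alpha> \<le> n" using s0 by linarith+
    have "\<alpha>\<^sup>2 \<le> \<alpha> * (n - \<alpha>)" unfolding power2_eq_square using a0 by (intro mult_left_mono) auto
    then have aL: "\<alpha> \<le> sqrt m" using prod by (intro real_le_rsqrt) simp
    have "(lr * n)\<^sup>2 * (lp / (lr * (lp + lr)\<^sup>2)) \<le> (?u * (lp + lr))\<^sup>2 * (lp / (lr * (lp + lr)\<^sup>2))"
      using k mu de by simp
    then have "(lr * n)\<^sup>2 \<le> (?u * (lp + lr))\<^sup>2" using pos by (simp only: mult_le_cancel_right_pos)
    then have le: "lr * n \<le> ?u * (lp + lr)" by (rule power2_le_imp_le[OF _ nn(1)])
    \<comment> \<open>Otherwise \<open>?u\<close> would lie strictly between the two roots \<alpha>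
      and n - \<alpha>, where X (n - X) exceeds \<open>m\<close>.\<close>
    have "?u \<le> \<alpha>"
    proof (rule ccontr)
      assume "\<not> ?thesis"
      then have gt: "\<alpha> < ?u" by simp
      have "lr * (?u * (n - ?u)) = ?u * (lr * (n - ?u))" by simp
      also have "\<dots> \<le> ?u * (?u * lp)" using le u(1) by (intro mult_left_mono) (auto simp: algebra_simps)
      also have "\<dots> = lr * m" using u(2) by (simp add: power2_eq_square algebra_simps)
      finally have "?u * (n - ?u) \<le> m" using p by simp
      then have "(?u - \<alpha>) * (n - \<alpha> - ?u) \<le> 0" using prod by (simp add: algebra_simps)
      moreover have "n - \<alpha> - ?u > 0" using u(4) sn a0 by linarith
      ultimately show False using gt by (simp add: mult_le_0_iff)
    qed
    then show ?thesis using a0 aL prod by auto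
  qed
  then show "sparse_opt m \<le> \<alpha>" "\<alpha> \<le> sqrt m" "2 * \<alpha> \<le> n" "m \<le> \<alpha> * (n - \<alpha>)"
    "\<alpha> = sparse_opt m \<or> \<alpha> * (n - \<alpha>) = m" by auto
qed

lemma cost_diff:
  assumes "m > 0" "X > 0" "Y > 0"
  shows "cost m X - cost m Y = lp * (X - Y) * (1 - (sparse_opt m)\<^sup>2 / (X * Y))"
proof -
  have "lp > 0" using log_bounds by linarith
  have "lr * m = lp * (sparse_opt m)\<^sup>2" using sparse_opt_bounds(2)[OF assms(1)] by (simp add: algebra_simps)
  then show ?thesis using assms unfolding cost_def by (simp add: field_simps)
qed

text \<open>Near its constrained minimiser \<open>\<alpha>\<close> the cost grows quadratically; \<open>d\<close> measures by how much
  the constraint may be violated.\<close>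

lemma cost_stability:
  assumes c: "center m n \<alpha>" and m: "m > 0" "4 * m \<le> n\<^sup>2" and n: "n > 0"
    and X: "X > 0" and d: "d \<ge> 0" "m - d \<le> X * (n - X) \<or> m - d \<le> X\<^sup>2"
  shows "cost m \<alpha> - lp * sqrt d \<le> cost m X"
    and "(X - \<alpha>)\<^sup>2 \<le> d \<or> lp * (X - \<alpha>)\<^sup>2 \<le> X * (cost m X - cost m \<alpha>)"
proof -
  let ?u = "sparse_opt m"
  have p: "lp > 0" using log_bounds by linarith
  note u = sparse_opt_bounds[OF m(1)]
  note cp = center_props[OF c m n]
  have \<alpha>: "\<alpha> > 0" using cp u by linarith
  note df = cost_diff[OF m(1) X \<alpha>]
  have "cost m \<alpha> - lp * sqrt d \<le> cost m X \<and>
     ((X - \<alpha>)\<^sup>2 \<le> d \<or> lp * (X - \<alpha>)\<^sup>2 \<le> X * (cost m X - cost m \<alpha>))"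
  proof (cases "\<alpha> = ?u \<or> \<alpha> \<le> X")
    case True
    have "lp * (X - \<alpha>)\<^sup>2 \<le> X * (cost m X - cost m \<alpha>)"
    proof -
      have "X * (cost m X - cost m \<alpha>) = lp * (X - \<alpha>) * (X - ?u\<^sup>2 / \<alpha>)"
        unfolding df using X \<alpha> by (simp add: field_simps)
      moreover have "lp * (X - \<alpha>) * (X - \<alpha>) \<le> lp * (X - \<alpha>) * (X - ?u\<^sup>2 / \<alpha>)"
        using True
      proof
        assume "\<alpha> = ?u"
        then have "?u\<^sup>2 / \<alpha> = \<alpha>" using \<alpha> by (simp add: power2_eq_square)
        then show ?thesis by simp
      next
        assume "\<alpha> \<le> X"
        have "?u\<^sup>2 \<le> \<alpha> * \<alpha>" unfolding power2_eq_square using cp(1) less_imp_le[OF u(1)] \<alpha> by (intro mult_mono) auto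
        then have "?u\<^sup>2 / \<alpha> \<le> \<alpha>" using \<alpha> by (simp add: field_simps)
        then show ?thesis using \<open>\<alpha> \<le> X\<close> p by (intro mult_left_mono) auto
      qed
      ultimately show ?thesis by (simp add: power2_eq_square)
    qed
    moreover from this have "0 \<le> X * (cost m X - cost m \<alpha>)"
      by (rule order.trans[rotated]) (use p in simp)
    then have "cost m \<alpha> \<le> cost m X" using X by (simp add: zero_le_mult_iff)
    moreover have "lp * sqrt d \<ge> 0" using p d by simp
    ultimately show ?thesis by linarith
  next
    case False
    \<comment> \<open>The only place where the cost can fall below that of \<alpha>: the constraint
      is tight at \<alpha> and \<open>X\<close> lies on its wrong side. A violation by
      \<open>d\<close> moves \<open>X\<close> by at most \<open>sqrt d\<close>, and the slope is at
      most \<open>lp\<close>.\<close>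
    then have lt: "X < \<alpha>" "\<alpha> * (n - \<alpha>) = m" using cp(5) by auto
    have sq: "(\<alpha> - X)\<^sup>2 \<le> d"
      using d(2)
    proof
      assume "m - d \<le> X * (n - X)"
      then have "(\<alpha> - X) * (n - \<alpha> - X) \<le> d" using lt(2) by (simp add: algebra_simps)
      moreover have "(\<alpha> - X) * (\<alpha> - X) \<le> (\<alpha> - X) * (n - \<alpha> - X)"
        using lt(1) cp(3) by (intro mult_left_mono) auto
      ultimately show ?thesis by (simp add: power2_eq_square)
    next
      assume a: "m - d \<le> X\<^sup>2"
      have "(\<alpha> - X) * (\<alpha> - X) \<le> (\<alpha> - X) * (\<alpha> + X)" using lt(1) X by (intro mult_left_mono) auto
      moreover have "\<alpha> * \<alpha> \<le> sqrt m * sqrt m" using cp \<alpha> m by (intro mult_mono) auto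
      then have "\<alpha> * \<alpha> \<le> m" using m by simp
      ultimately show ?thesis using a by (simp add: power2_eq_square algebra_simps)
    qed
    then have "\<alpha> - X \<le> sqrt d" by (rule real_le_rsqrt)
    then have "lp * (\<alpha> - X) \<le> lp * sqrt d" using p by (intro mult_left_mono) simp_all
    moreover have "cost m \<alpha> - cost m X \<le> lp * (\<alpha> - X)"
    proof -
      have "cost m \<alpha> - cost m X = lp * (\<alpha> - X) * (1 - ?u\<^sup>2 / (X * \<alpha>))" using df by (simp add: algebra_simps)
      also have "\<dots> \<le> lp * (\<alpha> - X) * 1" using lt(1) p X \<alpha> by (intro mult_left_mono) auto
      finally show ?thesis by simp
    qed
    ultimately have "cost m \<alpha> - lp * sqrt d \<le> cost m X" by linarith
    then show ?thesis using sq by (simp add: power2_commute)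
  qed
  then show "cost m \<alpha> - lp * sqrt d \<le> cost m X"
    "(X - \<alpha>)\<^sup>2 \<le> d \<or> lp * (X - \<alpha>)\<^sup>2 \<le> X * (cost m X - cost m \<alpha>)" by auto
qed

text \<open>Rounding \<alpha> up keeps m \<le> a (n - a), because the product grows up to n / 2; if
  rounding passes n / 2, then \<open>n div 2\<close> serves by integrality. With \<open>b\<close>
  the rounded-up quotient, all roundings together cost at most the constant 4.\<close>

lemma integer_near_center:
  fixes m n :: nat
  assumes c: "center m n \<alpha>" and m: "m \<ge> 16" "4 * m \<le> n\<^sup>2"
  obtains a b :: nat where "1 \<le> a" "1 \<le> b" "a + b \<le> n" "m \<le> a * b" "a * lp + b * lr \<le> cost m \<alpha> + 4"
proof -
  have m': "real m > 0" "4 * real m \<le> (real n)\<^sup>2" "real n > 0"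
  proof -
    show "real m > 0" using m by simp
    show *: "4 * real m \<le> (real n)\<^sup>2" using m(2) by (metis of_nat_le_iff of_nat_mult of_nat_numeral of_nat_power)
    show "real n > 0" using * \<open>real m > 0\<close> by (cases n) auto
  qed
  note cp = center_props[OF c m']
  have "sqrt 16 \<le> sqrt m" using m by (intro real_sqrt_le_mono) simp
  moreover have "sqrt 16 = (4::real)" by (rule real_sqrt_unique) auto
  ultimately have \<alpha>2: "\<alpha> \<ge> 2" "sqrt m / 2 \<le> \<alpha>" using sparse_opt_bounds(3)[OF m'(1)] cp(1) by linarith+
  define c where "c = nat \<lceil>\<alpha>\<rceil>"
  have cr: "real c \<ge> \<alpha>" "real c < \<alpha> + 1" using \<alpha>2 unfolding c_def by linarith+
  define a where "a = (if 2 * c \<le> n then c else n div 2)"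
  have a: "real a < \<alpha> + 1 \<and> \<alpha> - 1/2 \<le> real a \<and> m \<le> a * (n - a) \<and> 2 * a \<le> n"
  proof (cases "2 * c \<le> n")
    case True
    have "0 \<le> (real c - \<alpha>) * (real n - real c - \<alpha>)" using cr True cp(3) by (intro mult_nonneg_nonneg) auto
    then have "real m \<le> real c * (real n - real c)" using cp(4) by (simp add: algebra_simps)
    also have "\<dots> = real (c * (n - c))" using True by (simp add: of_nat_diff)
    finally have "m \<le> c * (n - c)" by (simp only: of_nat_le_iff)
    then show ?thesis using True cr by (simp add: a_def)
  next
    case False
    let ?h = "n div 2"
    have h: "real ?h \<ge> real n / 2 - 1/2" by linarith
    have hn: "2 * ?h \<le> n" by simp
    have "real c > real n / 2" using False by linarith
    then have "real ?h \<le> real c" by linarith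
    moreover have "m \<le> ?h * (n - ?h)"
    proof (cases "even n")
      case True
      then obtain h where n: "n = 2 * h" by (rule evenE)
      then have "4 * m \<le> 4 * (h * h)" using m(2) by (simp add: power2_eq_square)
      then have "m \<le> h * h" by linarith
      then show ?thesis using n by simp
    next
      case odd: False
      then obtain h where n: "n = 2 * h + 1" by (rule oddE)
      then have "4 * m \<le> 4 * (h * (h + 1)) + 1" using m(2) by (simp add: power2_eq_square algebra_simps)
      then have "m \<le> h * (h + 1)" by linarith
      then show ?thesis using n by simp
    qed
    ultimately show ?thesis using False cr h cp(3) hn by (auto simp: a_def)
  qed
  then have a1: "1 \<le> a" and ar: "real a \<ge> \<alpha> / 2" "real a > 0" using \<alpha>2 by linarith+
  define b where "b = nat \<lceil>real m / real a\<rceil>"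
  have qpos: "real m / real a > 0" using m'(1) ar by simp
  have b: "real b \<ge> real m / real a" "real b < real m / real a + 1" using qpos unfolding b_def by linarith+
  have b1: "1 \<le> b" using b(1) qpos by linarith
  have "real m \<le> real a * real b" using b(1) ar by (simp add: field_simps)
  then have mab: "m \<le> a * b" by (metis of_nat_le_iff of_nat_mult)
  have "real m \<le> real (a * (n - a))" using a by (intro of_nat_mono) simp
  then have "real m / real a \<le> real (n - a)" using ar by (simp add: field_simps)
  then have "real b < real (n - a) + 1" using b by linarith
  then have "b \<le> n - a" by linarith
  then have abn: "a + b \<le> n" using a by linarith
  have "real m / real a \<le> real m / \<alpha> + 4"
  proof -
    have "real m / real a - real m / \<alpha> = real m * (\<alpha> - real a) / (real a * \<alpha>)"
      using ar \<alpha>2 by (simp add: field_simps)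
    also have "\<dots> \<le> real m * (1 / 2) / (\<alpha> / 2 * \<alpha>)"
    proof (rule frac_le)
      show "real m * (\<alpha> - real a) \<le> real m * (1 / 2)" using a m' by (intro mult_left_mono) auto
      show "\<alpha> / 2 * \<alpha> \<le> real a * \<alpha>" using ar \<alpha>2 by (intro mult_right_mono) auto
    qed (use \<alpha>2 m' in auto)
    also have "\<dots> = real m / \<alpha>\<^sup>2" using \<alpha>2 by (simp add: field_simps power2_eq_square)
    also have "\<dots> \<le> 4"
    proof -
      have "(sqrt m / 2)\<^sup>2 \<le> \<alpha>\<^sup>2" using \<alpha>2 by (intro power_mono) auto
      then show ?thesis using \<alpha>2 by (simp add: power_divide field_simps)
    qed
    finally show ?thesis by simp
  qed
  then have "real b \<le> real m / \<alpha> + 5" using b by linarith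
  then have "real b * lr \<le> (real m / \<alpha> + 5) * lr" using log_bounds by (intro mult_right_mono) auto
  moreover have "real a * lp \<le> (\<alpha> + 1) * lp" using a log_bounds by (intro mult_right_mono) auto
  ultimately have "a * lp + b * lr \<le> cost m \<alpha> + lp + 5 * lr" by (simp add: cost_def algebra_simps)
  also have "\<dots> \<le> cost m \<alpha> + 4" using log_bounds by linarith
  finally show thesis by (rule that[OF a1 b1 abn mab])
qed

section \<open>From an approximate to an exact decomposition\<close>

definition monochrom :: "('a \<Rightarrow> nat) \<Rightarrow> 'a set \<Rightarrow> bool" where
  "monochrom f S \<longleftrightarrow> (\<exists>c. \<forall>v\<in>S. f v = c)"

text \<open>The left side is the total weight of the three colours at one vertex in
  \<open>card_few_unpopular\<close>. The 1/32 is chosen so that at most 6 L vertices contribute at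
  most 3 L / 16, below the L / 4 available in \<open>not_monochrom_few\<close>.\<close>

lemma exp_6_bound: "1 + 2 * exp (- 6 :: real) \<le> exp (1 / 32)"
proof -
  have "(2::real) ^ 6 \<le> (exp 1) ^ 6" using exp_ge_add_one_self[of 1] by (intro power_mono) simp_all
  also have "\<dots> = exp 6" by (simp add: exp_of_nat_mult[symmetric])
  finally have "exp (- 6 :: real) \<le> 1 / 64" by (simp add: exp_minus field_simps)
  moreover have "1 + 1 / 32 \<le> exp (1 / 32 :: real)" by (rule exp_ge_add_one_self)
  ultimately show ?thesis by simp
qed

text \<open>Exponential weights: a colouring gets the factor \<open>e\<^sup>-\<^sup>6\<close> for every deviation from the
  popular colours \<open>c\<close> on \<open>A\<close> and \<open>d\<close> on \<open>B\<close>.\<close>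

lemma card_few_unpopular:
  fixes K :: real
  assumes fin: "finite V" and sub: "A \<subseteq> V" "B \<subseteq> V" "A \<inter> B = {}" and cd: "c < 3" "d < 3"
  shows "real (card {f \<in> PiE V (\<lambda>_. {..<3::nat}). real (card {v \<in> A. f v \<noteq> c} + card {v \<in> B. f v \<noteq> d}) \<le> K})
    \<le> exp (6 * K) * exp (real (card A + card B) / 32) * 3 ^ (card V - card A - card B)"
    (is "real (card ?F) \<le> _")
proof -
  let ?x = "exp (- 6 :: real)"
  define w where "w v k = (if v \<in> A then (if k = c then 1 else ?x) else if v \<in> B then (if k = d then 1 else ?x) else 1)"
    for v k
  have fAB: "finite A" "finite B" using fin sub(1,2) by (blast intro: finite_subset)+
  have finP: "finite (PiE V (\<lambda>_. {..<3::nat}))" using fin by (intro finite_PiE) auto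
  have sumw: "(\<Sum>k<3. if k = e then 1 else ?x) = 1 + 2 * ?x" if "e < 3" for e :: nat
  proof -
    have "{..<3} \<inter> {k. k = e} = {e}" "card ({..<3::nat} \<inter> - {k. k = e}) = 2"
      using that card_lessThan_3_Diff[of e] by (auto simp: Diff_eq Compl_eq)
    then show ?thesis by (simp add: sum.If_cases)
  qed
  have "exp (- (6 * K)) * real (card ?F) = (\<Sum>f\<in>?F. exp (- (6 * K)))" by simp
  also have "\<dots> \<le> (\<Sum>f\<in>?F. \<Prod>v\<in>V. w v (f v))"
  proof (rule sum_mono)
    fix f assume f: "f \<in> ?F"
    let ?S = "{v \<in> A. f v \<noteq> c} \<union> {v \<in> B. f v \<noteq> d}"
    have "card ?S = card {v \<in> A. f v \<noteq> c} + card {v \<in> B. f v \<noteq> d}"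
      by (rule card_Un_disjoint) (use fAB sub in auto)
    then have cS: "real (card ?S) \<le> K" using f by simp
    have "(\<Prod>v\<in>V. w v (f v)) = (\<Prod>v\<in>V. if v \<in> ?S then ?x else 1)"
      by (rule prod.cong) (use sub in \<open>auto simp: w_def\<close>)
    also have "(\<Prod>v\<in>V. if v \<in> S then ?x else 1) = ?x ^ card (V \<inter> S)" for S
      using fin by (simp add: prod.If_cases)
    also have "V \<inter> ?S = ?S" using sub by auto
    also have "?x ^ card ?S = exp (- (6 * real (card ?S)))"
      by (simp add: exp_of_nat_mult[symmetric] mult.commute)
    finally show "exp (- (6 * K)) \<le> (\<Prod>v\<in>V. w v (f v))" using cS by simp
  qed
  also have "\<dots> \<le> (\<Sum>f\<in>PiE V (\<lambda>_. {..<3}). \<Prod>v\<in>V. w v (f v))"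
    by (rule sum_mono2) (use finP in \<open>auto intro!: prod_nonneg simp: w_def\<close>)
  also have "\<dots> = (\<Prod>v\<in>V. \<Sum>k<3. w v k)" using fin by (subst prod_sum_PiE) auto
  also have "\<dots> = (1 + 2 * ?x) ^ card A * (1 + 2 * ?x) ^ card B * 3 ^ (card V - card A - card B)"
  proof (rule prod_classes[OF fin sub])
    show "(\<Sum>k<3. w v k) = 1 + 2 * ?x" if "v \<in> A" for v using that sumw[OF cd(1)] by (simp add: w_def)
    show "(\<Sum>k<3. w v k) = 1 + 2 * ?x" if "v \<in> B" for v
    proof -
      have "v \<notin> A" using that sub by blast
      then show ?thesis using that sumw[OF cd(2)] by (simp add: w_def)
    qed
  qed (simp add: w_def)
  also have "\<dots> \<le> exp (real (card A + card B) / 32) * 3 ^ (card V - card A - card B)"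
  proof -
    have "(1 + 2 * ?x) ^ card A * (1 + 2 * ?x) ^ card B = (1 + 2 * ?x) ^ (card A + card B)"
      by (simp add: power_add)
    also have "\<dots> \<le> exp (1 / 32) ^ (card A + card B)" by (intro power_mono exp_6_bound) (simp add: add_nonneg_nonneg)
    also have "\<dots> = exp (real (card A + card B) / 32)" by (simp add: exp_of_nat_mult[symmetric])
    finally show ?thesis by (intro mult_right_mono) auto
  qed
  finally show ?thesis by (simp add: exp_minus field_simps)
qed

lemma exp_half_le_power2: "exp (real k / 2) \<le> 2 ^ k"
proof -
  have "exp (1 / 2 :: real) \<le> exp (ln 2)" using log_bounds(8) by (subst exp_le_cancel_iff)
  then have "exp (1 / 2 :: real) ^ k \<le> 2 ^ k" by (intro power_mono) simp_all
  then show ?thesis by (simp add: exp_of_nat_mult[symmetric])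
qed

text \<open>The approximate structure, with \<open>L\<close> standing for sqrt m. All assumptions
  are symmetric in \<open>A\<close> and \<open>B\<close>, including the two bounds
  \<open>lowB\<close> and \<open>lowA\<close>, so each statement about one class transfers to the
  other by \<open>core_sym\<close>.\<close>

locale core_graph =
  fixes V :: "'a set" and E :: "'a set set" and A B :: "'a set" and L :: real
  assumes sg: "simple_graph V E"
    and sub: "A \<subseteq> V" "B \<subseteq> V" "A \<inter> B = {}"
    and sizeA: "L / 2 \<le> card A" "card A \<le> 3 * L"
    and sizeB: "L / 2 \<le> card B" "card B \<le> 3 * L"
    and missA: "v \<in> A \<Longrightarrow> card {w \<in> B. {v, w} \<notin> E} \<le> L / 2000"
    and missB: "v \<in> B \<Longrightarrow> card {w \<in> A. {v, w} \<notin> E} \<le> L / 2000"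
    and rest: "card {v \<in> V - A - B. \<exists>w\<in>V. {v, w} \<in> E} \<le> L / 2000"
    and lowB: "2 ^ card B * 3 ^ (card V - card A - card B) \<le> card (cols3 V E) * exp (L / 2000)"
    and lowA: "2 ^ card A * 3 ^ (card V - card A - card B) \<le> card (cols3 V E) * exp (L / 2000)"
    and L: "10 ^ 8 \<le> L"
begin

lemma finV: "finite V" using sg by (simp add: simple_graph_def)
lemma L0: "0 < L" "100000000 \<le> L" using L by simp_all
lemma finAB: "finite A" "finite B" using finV sub(1,2) by (blast intro: finite_subset)+

lemma core_sym: "core_graph V E B A L"
proof -
  have e: "card V - card B - card A = card V - card A - card B" "V - B - A = V - A - B" by auto
  show ?thesis
    by (unfold_locales, unfold e) (use sg sub sizeA sizeB missA missB rest lowA lowB L in auto)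
qed

abbreviation "f \<equiv> real (card (cols3 V E))"
abbreviation "rst \<equiv> card V - card A - card B"

lemma colsD: "g \<in> cols3 V E \<Longrightarrow> v \<in> V \<Longrightarrow> g v < 3"
  "g \<in> cols3 V E \<Longrightarrow> v \<in> V \<Longrightarrow> w \<in> V \<Longrightarrow> {v, w} \<in> E \<Longrightarrow> g v \<noteq> g w"
  by (auto simp: list_colorings_def)

text \<open>A vertex of \<open>B\<close> has too few non-neighbours in \<open>A\<close> to avoid all
  vertices of a colour used more than \<open>L / 2000\<close> times there.\<close>

lemma popular_absent:
  assumes g: "g \<in> cols3 V E" and pop: "card {v \<in> A. g v = c} > L / 2000" and v: "v \<in> B"
  shows "g v \<noteq> c"
proof
  assume gv: "g v = c"
  have "{w \<in> A. g w = c} \<subseteq> {w \<in> A. {v, w} \<notin> E}"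
  proof (rule subsetI, clarify)
    fix w assume w: "w \<in> A" "c = g w" "{v, w} \<in> E"
    have "v \<in> V" "w \<in> V" using v w sub by auto
    then show False using colsD(2)[OF g _ _ w(3)] w gv by auto
  qed
  then have "card {w \<in> A. g w = c} \<le> card {w \<in> A. {v, w} \<notin> E}" by (rule card_mono[rotated]) (use finAB in simp)
  then show False using missB[OF v] pop by linarith
qed

text \<open>Some colour is popular on \<open>A\<close> because \<open>A\<close> has at least
  \<open>L / 2\<close> vertices. Two popular colours would leave a single colour for all of
  \<open>B\<close>; so the other two colours occur at most \<open>L / 2000\<close> times
  each.\<close>

lemma one_popular:
  assumes g: "g \<in> cols3 V E" and nm: "\<not> monochrom g B"
  shows "\<exists>c<3. card {v \<in> A. g v \<noteq> c} \<le> L / 1000"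
proof -
  let ?n = "\<lambda>c. card {v \<in> A. g v = c}"
  have tot: "card A = ?n 0 + ?n 1 + ?n 2"
    by (rule card_color_classes) (use finAB colsD[OF g] sub in auto)
  have two: "False" if h: "?n c > L / 2000" "?n d > L / 2000" "c \<noteq> d" "c < 3" "d < 3" for c d
  proof -
    have "g v = 3 - c - d" if v: "v \<in> B" for v
    proof -
      have "g v \<noteq> c" "g v \<noteq> d" using popular_absent[OF g h(1) v] popular_absent[OF g h(2) v] by auto
      moreover have "g v < 3" using colsD(1)[OF g] v sub by auto
      ultimately show ?thesis using h(3-5) by linarith
    qed
    then show False using nm by (auto simp: monochrom_def)
  qed
  have "\<exists>c<3. ?n c > L / 2000"
  proof (rule ccontr)
    assume "\<not> ?thesis"
    then have *: "?n c \<le> L / 2000" if "c < 3" for c using that by (meson not_less)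
    have "?n 0 \<le> L / 2000" "?n 1 \<le> L / 2000" "?n 2 \<le> L / 2000" by (intro *; simp)+
    then show False using tot sizeA L0 by linarith
  qed
  then obtain c where c: "c < 3" "?n c > L / 2000" by blast
  define d e where "d = (if c = 0 then 1 else 0 :: nat)" and "e = 3 - c - d"
  have de: "d < 3" "e < 3" "d \<noteq> c" "e \<noteq> c" "d \<noteq> e" and all: "\<And>k. k < 3 \<Longrightarrow> k = c \<or> k = d \<or> k = e"
    using c(1) unfolding d_def e_def by (cases "c = 0"; presburger)+
  have "?n d \<le> L / 2000" "?n e \<le> L / 2000" using two c de by (meson not_less)+
  moreover have "{v \<in> A. g v \<noteq> c} \<subseteq> {v \<in> A. g v = d} \<union> {v \<in> A. g v = e}"
    using all colsD(1)[OF g] sub(1) by blast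
  then have "card {v \<in> A. g v \<noteq> c} \<le> card ({v \<in> A. g v = d} \<union> {v \<in> A. g v = e})"
    by (rule card_mono[rotated]) (use finAB in simp)
  then have "card {v \<in> A. g v \<noteq> c} \<le> ?n d + ?n e" using card_Un_le le_trans by blast
  ultimately show ?thesis using c(1) by (intro exI[of _ c]) linarith
qed

text \<open>Such a colouring deviates from one of 9 pairs of popular colours at no more than L / 500
  vertices. By \<open>card_few_unpopular\<close> there are at most e^(L/5) 3^rst per pair, whereas
  \<open>lowB\<close> and |B| \<ge> L / 2 give about e^(L/4) 3^rst colourings in total.\<close>

lemma not_monochrom_few:
  "real (card {g \<in> cols3 V E. \<not> monochrom g A \<and> \<not> monochrom g B}) \<le> f / 1000"
proof -
  interpret sym: core_graph V E B A L by (rule core_sym)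
  let ?K = "L / 500"
  let ?F = "\<lambda>c d. {g \<in> PiE V (\<lambda>_. {..<3::nat}). real (card {v \<in> A. g v \<noteq> c} + card {v \<in> B. g v \<noteq> d}) \<le> ?K}"
  let ?b = "exp (6 * ?K) * exp (real (card A + card B) / 32) * 3 ^ rst"
  have fin: "finite (?F c d)" for c d
    by (rule finite_subset[of _ "PiE V (\<lambda>_. {..<3::nat})"]) (use finV in \<open>auto intro!: finite_PiE\<close>)
  have "{g \<in> cols3 V E. \<not> monochrom g A \<and> \<not> monochrom g B} \<subseteq> (\<Union>c<3. \<Union>d<3. ?F c d)"
  proof clarify
    fix g assume g: "g \<in> cols3 V E" and nm: "\<not> monochrom g A" "\<not> monochrom g B"
    obtain c where c: "c < 3" "card {v \<in> A. g v \<noteq> c} \<le> L / 1000" using one_popular[OF g nm(2)] by blast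
    obtain d where d: "d < 3" "card {v \<in> B. g v \<noteq> d} \<le> L / 1000" using sym.one_popular[OF g nm(1)] by blast
    have "g \<in> ?F c d" using c d g by (simp add: list_colorings_def)
    then show "g \<in> (\<Union>c<3. \<Union>d<3. ?F c d)" using c d by blast
  qed
  then have "card {g \<in> cols3 V E. \<not> monochrom g A \<and> \<not> monochrom g B} \<le> card (\<Union>c<3. \<Union>d<3. ?F c d)"
    by (rule card_mono[rotated]) (use fin in blast)
  also have "\<dots> \<le> (\<Sum>c<3. card (\<Union>d<3. ?F c d))" by (rule card_UN_le) simp
  also have "\<dots> \<le> (\<Sum>c<3. \<Sum>d<3. card (?F c d))" by (intro sum_mono card_UN_le) simp
  finally have "real (card {g \<in> cols3 V E. \<not> monochrom g A \<and> \<not> monochrom g B}) \<le> (\<Sum>c<3. \<Sum>d<3. real (card (?F c d)))"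
    unfolding of_nat_sum[symmetric] by (rule of_nat_mono)
  also have "\<dots> \<le> (\<Sum>c<3::nat. \<Sum>d<3::nat. ?b)"
    by (intro sum_mono card_few_unpopular finV sub) auto
  also have "\<dots> = 9 * ?b" by simp
  also have "\<dots> \<le> f / 1000"
  proof -
    have "3 ^ rst * exp (L / 4) \<le> 3 ^ rst * exp (real (card B) / 2)"
      using sizeB by (intro mult_left_mono) auto
    also have "\<dots> \<le> 3 ^ rst * 2 ^ card B" by (intro mult_left_mono exp_half_le_power2) auto
    also have "\<dots> \<le> f * exp (L / 2000)" using lowB by (simp add: mult.commute)
    finally have low: "3 ^ rst * exp (L / 4) \<le> f * exp (L / 2000)" .
    have "9 * ?b = 9 * exp (6 * ?K + real (card A + card B) / 32) * 3 ^ rst" by (simp add: exp_add)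
    also have "\<dots> \<le> 9 * exp (L / 5) * 3 ^ rst"
    proof -
      have "real (card A + card B) \<le> 6 * L" using sizeA sizeB by simp
      then have "real (card A + card B) / 32 \<le> 3 * L / 16" by simp
      then have "6 * ?K + real (card A + card B) / 32 \<le> 3 * L / 250 + 3 * L / 16" by simp
      also have "\<dots> \<le> L / 5" using L0 by simp
      finally have "6 * ?K + real (card A + card B) / 32 \<le> L / 5" .
      then show ?thesis by (intro mult_right_mono mult_left_mono) auto
    qed
    also have "\<dots> = 9 * exp (L / 5 - L / 4) * (3 ^ rst * exp (L / 4))"
    proof -
      have "exp (L / 5) = exp (L / 5 - L / 4) * exp (L / 4)" by (subst exp_add[symmetric]) simp
      then show ?thesis by simp
    qed
    also have "\<dots> \<le> 9 * exp (L / 5 - L / 4) * (f * exp (L / 2000))" using low by (intro mult_left_mono) auto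
    also have "\<dots> = 9 * exp (- (99 * L / 2000)) * f"
    proof -
      have "exp (L / 5 - L / 4) * exp (L / 2000) = exp (- (99 * L / 2000))" by (subst exp_add[symmetric]) simp
      then show ?thesis by (simp add: mult.assoc mult.left_commute)
    qed
    also have "\<dots> \<le> (1 / 1000) * f"
    proof (intro mult_right_mono)
      have "9000 \<le> 1 + 99 * L / 2000" using L by simp
      also have "\<dots> \<le> exp (99 * L / 2000)" by (rule exp_ge_add_one_self)
      finally show "9 * exp (- (99 * L / 2000)) \<le> 1 / 1000" by (simp add: exp_minus field_simps)
    qed simp
    finally show ?thesis by simp
  qed
  finally show ?thesis .
qed

abbreviation "U0 \<equiv> {v \<in> V - A - B. \<exists>w\<in>V. {v, w} \<in> E}"

text \<open>When \<open>A\<close> has the single colour \<open>c\<close>, all of \<open>B\<close>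
  avoids \<open>c\<close>. If a vertex with at least L / 400 neighbours in \<open>B\<close> has
  another colour, each of these neighbours is forced, which costs 2^(L/400) against fewer than L
  choices of vertex and colours. So almost always such a vertex behaves like a member of
  \<open>A\<close>.\<close>

lemma exceptional_few:
  "real (card {g \<in> cols3 V E. monochrom g A \<and>
      \<not> monochrom g (A \<union> {v \<in> U0. L / 400 \<le> card {w \<in> B. {v, w} \<in> E}})}) \<le> f / 1000"
  (is "real (card ?X) \<le> _")
proof -
  let ?W = "{v \<in> U0. L / 400 \<le> card {w \<in> B. {v, w} \<in> E}}"
  let ?N = "\<lambda>v. {w \<in> B. {v, w} \<in> E}"
  let ?T = "\<lambda>v c e u. if u \<in> A then {c} else if u \<in> ?N v then {..<3} - {c, e} else if u \<in> B then {..<3} - {c} else {..<3::nat}"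
  have finU: "finite U0" using finV by simp
  have Ane: "A \<noteq> {}" using sizeA L by auto
  have "?X \<subseteq> (\<Union>(v, c, e)\<in>?W \<times> color_pairs. PiE V (?T v c e))"
  proof (rule subsetI)
    fix g assume "g \<in> ?X"
    then have g: "g \<in> cols3 V E" "monochrom g A" "\<not> monochrom g (A \<union> ?W)" by simp_all
    obtain c where c: "\<forall>v\<in>A. g v = c" using g(2) by (auto simp: monochrom_def)
    obtain a0 where a0: "a0 \<in> A" using Ane by blast
    have "a0 \<in> V" using a0 sub(1) by (rule rev_subsetD)
    then have c3: "c < 3" using colsD(1)[OF g(1)] c a0 by metis
    obtain v where v: "v \<in> A \<union> ?W" "g v \<noteq> c" using g(3) unfolding monochrom_def by blast
    then have vW: "v \<in> ?W" using c by blast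
    then have vV: "v \<in> V" by blast
    have ce: "(c, g v) \<in> color_pairs" using c3 v colsD(1)[OF g(1) vV] by (auto simp: color_pairs_def)
    have "g \<in> PiE V (?T v c (g v))"
    proof (rule PiE_I)
      fix u assume u: "u \<in> V"
      have g3: "g u < 3" using colsD(1)[OF g(1) u] .
      have "g u \<noteq> c" if "u \<in> B"
      proof -
        have "{w \<in> A. g w = c} = A" using c by auto
        then show ?thesis using popular_absent[OF g(1) _ that, of c] sizeA L by simp
      qed
      moreover have "g u \<noteq> g v" if "u \<in> ?N v" using colsD(2)[OF g(1) vV u] that by auto
      ultimately show "g u \<in> ?T v c (g v) u" using c g3 by auto
    qed (use g in \<open>auto simp: list_colorings_def\<close>)
    then show "g \<in> (\<Union>(v, c, e)\<in>?W \<times> color_pairs. PiE V (?T v c e))" using vW ce by blast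
  qed
  moreover have fT: "finite (PiE V (?T v c e))" for v c e using finV by (intro finite_PiE) auto
  moreover have finW: "finite (?W \<times> color_pairs)" 
  proof (rule finite_cartesian_product)
    show "finite ?W" by (rule finite_subset[OF _ finU]) blast
    show "finite color_pairs" by (simp add: color_pairs_def)
  qed
  ultimately have "card ?X \<le> card (\<Union>(v, c, e)\<in>?W \<times> color_pairs. PiE V (?T v c e))"
    by (intro card_mono finite_UN_I) auto
  also have "\<dots> \<le> (\<Sum>(v, c, e)\<in>?W \<times> color_pairs. card (PiE V (?T v c e)))"
    using card_UN_le[OF finW, of "\<lambda>(v, c, e). PiE V (?T v c e)"] by (simp add: case_prod_beta)
  finally have "real (card ?X) \<le> real (\<Sum>(v, c, e)\<in>?W \<times> color_pairs. card (PiE V (?T v c e)))"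
    by (rule of_nat_mono)
  also have "\<dots> = (\<Sum>(v, c, e)\<in>?W \<times> color_pairs. real (card (PiE V (?T v c e))))"
    by (simp add: case_prod_beta)
  also have "\<dots> \<le> (\<Sum>(v, c, e)\<in>?W \<times> color_pairs. 2 ^ card B * 3 ^ rst * exp (- (L / 800)))"
  proof (rule sum_mono)
    fix t assume t: "t \<in> ?W \<times> color_pairs"
    obtain v c e where vce: "t = (v, c, e)" by (metis prod.exhaust)
    have v: "v \<in> ?W" and ce: "(c, e) \<in> color_pairs" using t unfolding vce by blast+
    let ?n = "card (?N v)"
    have nB: "?n \<le> card B" by (rule card_mono) (use finAB in auto)
    have ce': "c < 3" "e < 3" "c \<noteq> e" using ce by (auto simp: color_pairs_def)
    have c1: "card ({..<3} - {c, e}) = 1" using ce' by (subst card_Diff_subset) auto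
    have "card (PiE V (?T v c e)) = 1 ^ card (A \<union> ?N v) * 2 ^ card (B - ?N v) * 3 ^ (card V - card (A \<union> ?N v) - card (B - ?N v))"
    proof (rule card_PiE_classes[OF finV])
      show "card (?T v c e u) = 1" if "u \<in> A \<union> ?N v" for u using that c1 by auto
      show "card (?T v c e u) = 2" if "u \<in> B - ?N v" for u
      proof -
        have "u \<notin> A" using that sub by blast
        then show ?thesis using that ce' by simp
      qed
      show "card (?T v c e u) = 3" if "u \<in> V - (A \<union> ?N v) - (B - ?N v)" for u
      proof -
        have "u \<notin> A" "u \<notin> B" using that by auto
        then show ?thesis by simp
      qed
    qed (use sub in auto)
    also have "card (A \<union> ?N v) = card A + ?n"
      by (rule card_Un_disjoint) (use finAB sub in auto)
    also have "card (B - ?N v) = card B - ?n" by (rule card_Diff_subset) (use finAB in auto)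
    finally have "card (PiE V (?T v c e)) = 2 ^ (card B - ?n) * 3 ^ rst" using nB by simp
    then have "real (card (PiE V (?T v c e))) = 2 ^ (card B - ?n) * 3 ^ rst"
      by (simp only: of_nat_mult of_nat_power of_nat_numeral)
    also have "(2::real) ^ (card B - ?n) = 2 ^ card B / 2 ^ ?n" using nB by (simp add: power_diff)
    also have "\<dots> * 3 ^ rst = 2 ^ card B * 3 ^ rst / 2 ^ ?n" by simp
    finally have "real (card (PiE V (?T v c e))) = 2 ^ card B * 3 ^ rst / 2 ^ ?n" .
    also have "\<dots> = 2 ^ card B * 3 ^ rst * (1 / 2 ^ ?n)" by simp
    also have "\<dots> \<le> 2 ^ card B * 3 ^ rst * exp (- (L / 800))"
    proof (intro mult_left_mono)
      have "exp (L / 800) \<le> exp (real ?n / 2)" using v by (subst exp_le_cancel_iff) simp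
      also have "\<dots> \<le> 2 ^ ?n" by (rule exp_half_le_power2)
      finally show "1 / 2 ^ ?n \<le> exp (- (L / 800))" by (simp add: exp_minus field_simps)
    qed simp
    finally show "(case t of (v, c, e) \<Rightarrow> real (card (PiE V (?T v c e)))) \<le>
        (case t of (v, c, e) \<Rightarrow> 2 ^ card B * 3 ^ rst * exp (- (L / 800)))" unfolding vce prod.case .
  qed
  also have "\<dots> = 6 * real (card ?W) * (2 ^ card B * 3 ^ rst * exp (- (L / 800)))"
    by (simp add: card_cartesian_product card_color_pairs)
  also have "\<dots> \<le> 6 * (L / 2000) * (f * exp (L / 2000) * exp (- (L / 800)))"
  proof (rule mult_mono)
    have "card ?W \<le> card U0" by (rule card_mono) (use finU in auto)
    then show "6 * real (card ?W) \<le> 6 * (L / 2000)" using rest by linarith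
    show "2 ^ card B * 3 ^ rst * exp (- (L / 800)) \<le> f * exp (L / 2000) * exp (- (L / 800))"
      by (rule mult_right_mono[OF lowB]) simp
  qed (use L in auto)
  also have "\<dots> = f * (3 * L / 1000 * exp (- (3 * L / 4000)))"
  proof -
    have "exp (L / 2000) * exp (- (L / 800)) = exp (- (3 * L / 4000))" by (subst exp_add[symmetric]) simp
    then show ?thesis by (simp add: mult.assoc mult.left_commute)
  qed
  also have "\<dots> \<le> f * (1 / 1000)"
  proof (intro mult_left_mono)
    let ?y = "3 * L / 4000"
    \<comment> \<open>Equivalent to L \<ge> 32 * 10^6 / 3, ensured by the assumption 10^8 \<le>
      L.\<close>
    have "3 * L \<le> ?y\<^sup>2 / 2"
    proof -
      have "(32 * 10^6 / 3) * (3 * L) \<le> L * (3 * L)" using L by (intro mult_right_mono) simp_all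
      then show ?thesis by (simp add: power2_eq_square)
    qed
    also have "\<dots> \<le> exp ?y" using exp_lower_Taylor_quadratic[of ?y] L by simp
    finally have "3 * L * exp (- ?y) \<le> 1" by (simp add: exp_minus field_simps)
    then show "3 * L / 1000 * exp (- ?y) \<le> 1 / 1000" by simp
  qed simp
  finally show ?thesis by simp
qed

end

text \<open>The exact partition: \<open>I\<close> is isolated, \<open>S\<close> has small degree,
  and each vertex of a class has a neighbour in the other one, so that a constant colour on one
  class is absent from the other. The 997 leaves 1/1000 for each of three exceptions: constant on
  neither core, or constant on a core without extending to its enlarged class.\<close>

locale decomposed_graph =
  fixes V :: "'a set" and E :: "'a set set" and A X S I :: "'a set" and L :: real
  assumes sg: "simple_graph V E"
    and V: "V = A \<union> X \<union> S \<union> I"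
    and dis: "A \<inter> X = {}" "A \<inter> S = {}" "X \<inter> S = {}" "A \<inter> I = {}" "X \<inter> I = {}" "S \<inter> I = {}"
    and isolated: "v \<in> I \<Longrightarrow> {v, u} \<notin> E"
    and nonisolated: "v \<in> S \<Longrightarrow> \<exists>u\<in>V. {v, u} \<in> E"
    and light: "v \<in> S \<Longrightarrow> card {u \<in> V. {v, u} \<in> E} \<le> L / 100"
    and nbA: "v \<in> A \<Longrightarrow> \<exists>u\<in>X. {v, u} \<in> E"
    and nbX: "v \<in> X \<Longrightarrow> \<exists>u\<in>A. {v, u} \<in> E"
    and sizeA: "L / 2 \<le> card A" and sizeX: "L / 2 \<le> card X"
    and count: "997 * real (card (cols3 V E)) \<le> 1000 *
      (real (card {g \<in> cols3 V E. monochrom g A}) + real (card {g \<in> cols3 V E. monochrom g X}))"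
    and lowX: "2 ^ card X * 3 ^ (card V - card A - card X) \<le> card (cols3 V E) * exp (L / 2000)"
    and lowA: "2 ^ card A * 3 ^ (card V - card A - card X) \<le> card (cols3 V E) * exp (L / 2000)"
    and L: "10 ^ 8 \<le> L"

lemma (in decomposed_graph) swap_sides: "decomposed_graph V E X A S I L"
proof -
  have e: "card V - card X - card A = card V - card A - card X" by simp
  show ?thesis
    by (unfold_locales, unfold e)
       (use sg V dis isolated nonisolated light nbA nbX sizeA sizeX count lowX lowA L in auto)
qed

section \<open>Distributing the heavy vertices over the two classes\<close>

context core_graph
begin

text \<open>Moving an outside vertex into a class multiplies the product by 1/3 or 2/3, so the lower
  bound for the number of colourings persists.\<close>

lemma low_larger:
  assumes "A \<subseteq> A'" "B \<subseteq> X" "A' \<inter> X = {}" "A' \<union> X \<subseteq> V"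
  shows "2 ^ card X * 3 ^ (card V - card A' - card X) \<le> f * exp (L / 2000)"
proof -
  have fin: "finite A'" "finite X" using assms(4) finV by (auto intro: finite_subset)
  have le: "card A \<le> card A'" "card B \<le> card X" using assms fin by (auto intro: card_mono)
  have "card A' + card X = card (A' \<union> X)" using assms fin by (simp add: card_Un_disjoint)
  also have "\<dots> \<le> card V" using assms finV by (intro card_mono)
  finally have "rst = (card V - card A' - card X) + (card A' - card A) + (card X - card B)" using le by simp
  then have "(3::real) ^ rst = 3 ^ (card V - card A' - card X) * 3 ^ (card A' - card A) * 3 ^ (card X - card B)"
    by (simp add: power_add)
  moreover have "(2::real) ^ card X = 2 ^ card B * 2 ^ (card X - card B)"
    using le by (simp add: power_add[symmetric])
  moreover have "(2::real) ^ (card X - card B) \<le> 3 ^ (card A' - card A) * 3 ^ (card X - card B)"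
  proof -
    have "(2::real) ^ (card X - card B) \<le> 3 ^ (card X - card B)" by (intro power_mono) auto
    also have "\<dots> \<le> 3 ^ (card A' - card A) * 3 ^ (card X - card B)" by simp
    finally show ?thesis .
  qed
  then have "2 ^ card B * 3 ^ (card V - card A' - card X) * 2 ^ (card X - card B) \<le>
      2 ^ card B * 3 ^ (card V - card A' - card X) * (3 ^ (card A' - card A) * (3::real) ^ (card X - card B))"
    by (intro mult_left_mono) auto
  ultimately have "2 ^ card X * 3 ^ (card V - card A' - card X) \<le> 2 ^ card B * (3::real) ^ rst"
    by (simp add: mult_ac)
  then show ?thesis using lowB by linarith
qed

text \<open>A vertex of degree above L / 100 joins \<open>A\<close> if it has many neighbours in
  \<open>B\<close>, and \<open>B\<close> otherwise. By \<open>exceptional_few\<close> this destroys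
  few of the colourings that are constant on a class.\<close>

lemma decomposition: "\<exists>A' X S I. decomposed_graph V E A' X S I L"
proof -
  interpret sym: core_graph V E B A L by (rule core_sym)
  let ?deg = "\<lambda>v. card {w \<in> V. {v, w} \<in> E}"
  define W where "W = {v \<in> U0. L / 400 \<le> card {w \<in> B. {v, w} \<in> E}}"
  define H where "H = {v \<in> U0. \<not> ?deg v \<le> L / 100}"
  define S where "S = {v \<in> U0. ?deg v \<le> L / 100}"
  define A' where "A' = A \<union> (H \<inter> W)"
  define X where "X = B \<union> (H - W)"
  define I where "I = V - A - B - U0"
  have irr: "{v, v} \<notin> E" for v using simple_graph_edge(3)[OF sg] by blast
  \<comment> \<open>Of more than L / 100 neighbours, fewer than L / 400 lie in \<open>B\<close> and
    at most L / 2000 outside both classes; this leaves at least L / 400 in \<open>A\<close>.\<close>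
  have HW: "L / 400 \<le> card {w \<in> A. {v, w} \<in> E}" if "v \<in> H - W" for v
  proof -
    have "{w \<in> V. {v, w} \<in> E} \<subseteq> {w \<in> A. {v, w} \<in> E} \<union> {w \<in> B. {v, w} \<in> E} \<union> U0"
    proof
      fix w assume w: "w \<in> {w \<in> V. {v, w} \<in> E}"
      then have "v \<in> V" "{w, v} \<in> E" using simple_graph_edge[OF sg] by (auto simp: insert_commute)
      then show "w \<in> {w \<in> A. {v, w} \<in> E} \<union> {w \<in> B. {v, w} \<in> E} \<union> U0" using w by blast
    qed
    then have "?deg v \<le> card ({w \<in> A. {v, w} \<in> E} \<union> {w \<in> B. {v, w} \<in> E} \<union> U0)"
      by (rule card_mono[rotated]) (use finAB finV in simp)
    also have "\<dots> \<le> card ({w \<in> A. {v, w} \<in> E} \<union> {w \<in> B. {v, w} \<in> E}) + card U0" by (rule card_Un_le)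
    finally have "?deg v \<le> card {w \<in> A. {v, w} \<in> E} + card {w \<in> B. {v, w} \<in> E} + card U0"
      using card_Un_le[of "{w \<in> A. {v, w} \<in> E}" "{w \<in> B. {v, w} \<in> E}"] by linarith
    moreover have "\<not> ?deg v \<le> L / 100" "\<not> L / 400 \<le> card {w \<in> B. {v, w} \<in> E}"
      using that by (auto simp: H_def W_def)
    ultimately show ?thesis using rest L0 by linarith
  qed
  have n1: "real (card {g \<in> cols3 V E. monochrom g A \<and> \<not> monochrom g A'}) \<le> f / 1000"
  proof -
    have "{g \<in> cols3 V E. monochrom g A \<and> \<not> monochrom g A'} \<subseteq>
      {g \<in> cols3 V E. monochrom g A \<and> \<not> monochrom g (A \<union> W)}"
      unfolding A'_def monochrom_def by blast
    then have "card {g \<in> cols3 V E. monochrom g A \<and> \<not> monochrom g A'} \<le>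
      card {g \<in> cols3 V E. monochrom g A \<and> \<not> monochrom g (A \<union> W)}"
      by (rule card_mono[rotated]) (use finV in simp)
    then show ?thesis using exceptional_few unfolding W_def by linarith
  qed
  have e: "V - B - A = V - A - B" by auto
  have n2: "real (card {g \<in> cols3 V E. monochrom g B \<and> \<not> monochrom g X}) \<le> f / 1000"
  proof -
    let ?Z = "{v \<in> U0. L / 400 \<le> card {w \<in> A. {v, w} \<in> E}}"
    have "X \<subseteq> B \<union> ?Z" using HW unfolding X_def H_def by auto
    then have "{g \<in> cols3 V E. monochrom g B \<and> \<not> monochrom g X} \<subseteq>
      {g \<in> cols3 V E. monochrom g B \<and> \<not> monochrom g (B \<union> ?Z)}"
      unfolding monochrom_def by blast
    then have "card {g \<in> cols3 V E. monochrom g B \<and> \<not> monochrom g X} \<le>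
      card {g \<in> cols3 V E. monochrom g B \<and> \<not> monochrom g (B \<union> ?Z)}"
      by (rule card_mono[rotated]) (use finV in simp)
    then show ?thesis using sym.exceptional_few unfolding e by linarith
  qed
  have count: "997 * f \<le> 1000 * (real (card {g \<in> cols3 V E. monochrom g A'}) + real (card {g \<in> cols3 V E. monochrom g X}))"
  proof -
    let ?a = "{g \<in> cols3 V E. monochrom g A'}" and ?b = "{g \<in> cols3 V E. monochrom g X}"
    let ?c = "{g \<in> cols3 V E. monochrom g A \<and> \<not> monochrom g A'}"
    let ?d = "{g \<in> cols3 V E. monochrom g B \<and> \<not> monochrom g X}"
    let ?e = "{g \<in> cols3 V E. \<not> monochrom g A \<and> \<not> monochrom g B}"
    have "cols3 V E \<subseteq> ?a \<union> ?b \<union> ?c \<union> ?d \<union> ?e" by blast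
    then have "card (cols3 V E) \<le> card (?a \<union> ?b \<union> ?c \<union> ?d \<union> ?e)"
      by (rule card_mono[rotated]) (use finV in simp)
    also have "\<dots> \<le> card ?a + card ?b + card ?c + card ?d + card ?e"
      by (meson add_le_mono1 card_Un_le le_trans)
    finally have "f \<le> real (card ?a) + card ?b + card ?c + card ?d + card ?e" by linarith
    moreover have "1000 * real (card ?c) \<le> f" "1000 * real (card ?d) \<le> f" "1000 * real (card ?e) \<le> f"
      using n1 n2 not_monochrom_few by simp_all
    ultimately show ?thesis by argo
  qed
  have sub': "A \<subseteq> A'" "B \<subseteq> X" "A' \<inter> X = {}" "A' \<union> X \<subseteq> V"
    using sub by (auto simp: A'_def X_def H_def)
  have sz: "L / 2 \<le> card A'" "L / 2 \<le> card X"
  proof -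
    have "finite A'" "finite X" using sub'(4) finV by (auto intro: finite_subset)
    then have "card A \<le> card A'" "card B \<le> card X" using sub' by (auto intro: card_mono)
    then show "L / 2 \<le> card A'" "L / 2 \<le> card X" using sizeA sizeB by linarith+
  qed
  have nb: "\<exists>u\<in>T. {v, u} \<in> E" if "card {w \<in> T. {v, w} \<in> E} \<ge> L / 400" for T v
  proof (rule ccontr)
    assume "\<not> ?thesis"
    then have "{w \<in> T. {v, w} \<in> E} = {}" by blast
    then have "card {w \<in> T. {v, w} \<in> E} = 0" by (simp only: card.empty)
    then show False using that L0 by linarith
  qed
  have nbA: "\<exists>u\<in>X. {v, u} \<in> E" if "v \<in> A'" for v
  proof (cases "v \<in> A")
    case True
    have "\<exists>u\<in>B. {v, u} \<in> E"
    proof (rule ccontr)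
      assume "\<not> ?thesis"
      then have "{w \<in> B. {v, w} \<notin> E} = B" by blast
      then show False using missA[OF True] sizeB L0 by simp
    qed
    then show ?thesis by (auto simp: X_def)
  next
    case False
    then have "L / 400 \<le> card {w \<in> B. {v, w} \<in> E}" using that by (simp add: A'_def W_def)
    then show ?thesis using nb[of B v] by (auto simp: X_def)
  qed
  have nbX: "\<exists>u\<in>A'. {v, u} \<in> E" if "v \<in> X" for v
  proof (cases "v \<in> B")
    case True
    have "\<exists>u\<in>A. {v, u} \<in> E"
    proof (rule ccontr)
      assume "\<not> ?thesis"
      then have "{w \<in> A. {v, w} \<notin> E} = A" by blast
      then show False using missB[OF True] sizeA L0 by simp
    qed
    then show ?thesis by (auto simp: A'_def)
  next
    case False
    then have "v \<in> H - W" using that by (simp add: X_def)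
    then show ?thesis using nb[OF HW] by (auto simp: A'_def)
  qed
  have "decomposed_graph V E A' X S I L"
  proof
    show "V = A' \<union> X \<union> S \<union> I" using sub by (auto simp: A'_def X_def S_def I_def H_def)
    show "A' \<inter> X = {}" by (rule sub'(3))
    show "A' \<inter> S = {}" "X \<inter> S = {}" "A' \<inter> I = {}" "X \<inter> I = {}" "S \<inter> I = {}"
      by (auto simp: A'_def X_def S_def I_def H_def)
    show "{v, u} \<notin> E" if "v \<in> I" for v u
      using that simple_graph_edge(2)[OF sg, of v u] by (auto simp: I_def)
    show "\<exists>u\<in>V. {v, u} \<in> E" if "v \<in> S" for v using that by (simp add: S_def)
    show "card {u \<in> V. {v, u} \<in> E} \<le> L / 100" if "v \<in> S" for v using that by (simp add: S_def)
    show "2 ^ card X * 3 ^ (card V - card A' - card X) \<le> f * exp (L / 2000)" by (rule low_larger[OF sub'])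
    have "2 ^ card A' * 3 ^ (card V - card X - card A') \<le> f * exp (L / 2000)"
      by (rule sym.low_larger) (use sub' in auto)
    then show "2 ^ card A' * 3 ^ (card V - card A' - card X) \<le> f * exp (L / 2000)"
      by (simp add: add.commute)
    show "997 * f \<le> 1000 * (real (card {g \<in> cols3 V E. monochrom g A'}) + real (card {g \<in> cols3 V E. monochrom g X}))"
      by (rule count)
  qed (use sg sz nbA nbX L in auto)
  then show ?thesis by blast
qed

end

section \<open>Comparison of the sizes of competitors\<close>

text \<open>Starting from a split \<open>(a, n - a)\<close> that is \<open>m - a (n - a)\<close> edges short, moving \<open>k\<close> vertices
  to the smaller side suffices, where \<open>(k - 1)\<^sup>2\<close> is less than the shortage.\<close>

lemma rebalance:
  fixes a m n :: nat
  assumes "4 * m \<le> n\<^sup>2" "1 \<le> a" "a < n"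
  obtains a' where "1 \<le> a'" "a' < n" "m \<le> a' * (n - a')" "n - a \<le> n - a'"
  | k where "1 \<le> k" "a + k < n" "m \<le> (a + k) * (n - a - k)" "a * (n - a) + (k - 1)\<^sup>2 < m"
proof -
  let ?h = "n div 2"
  have mh: "m \<le> ?h * (n - ?h)"
  proof (cases "even n")
    case True
    then obtain h where n: "n = 2 * h" by (rule evenE)
    then have "4 * m \<le> 4 * (h * h)" using assms(1) by (simp add: power2_eq_square)
    then have "m \<le> h * h" by linarith
    then show ?thesis using n by simp
  next
    case False
    then obtain h where n: "n = 2 * h + 1" by (rule oddE)
    then have "4 * m \<le> 4 * (h * (h + 1)) + 1" using assms(1) by (simp add: power2_eq_square algebra_simps)
    then have "m \<le> h * (h + 1)" by linarith
    then show ?thesis using n by simp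
  qed
  show thesis
  proof (cases "?h \<le> a")
    case True
    show thesis by (rule that(1)[of ?h]) (use True mh assms in auto)
  next
    case False
    define P where "P k \<longleftrightarrow> m \<le> (a + k) * (n - a - k)" for k
    have Ph: "P (?h - a)" using mh False by (simp add: P_def)
    define k where "k = (LEAST k. P k)"
    have Pk: "P k" unfolding k_def by (rule LeastI[of P, OF Ph])
    have kh: "k \<le> ?h - a" unfolding k_def by (rule Least_le[of P, OF Ph])
    show thesis
    proof (cases "k = 0")
      case True
      show thesis by (rule that(1)[of a]) (use True Pk assms in \<open>auto simp: P_def\<close>)
    next
      case k0: False
      then have "\<not> P (k - 1)" unfolding k_def using not_less_Least[of "k - 1" P] by (simp add: k_def)
      obtain l where l: "k = Suc l" using k0 by (cases k) auto
      have nl: "\<not> P l" using \<open>\<not> P (k - 1)\<close> l by simp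
      have "a + Suc l \<le> ?h" using kh False l by linarith
      then have "2 * a + 2 * l + 2 \<le> n" by linarith
      then obtain c where c: "n = 2 * a + 2 * l + 2 + c" using le_Suc_ex by blast
      have na: "n - a = a + 2 * l + 2 + c" "n - a - l = a + l + 2 + c" using c by simp_all
      have "a * (n - a) + l\<^sup>2 \<le> (a + l) * (n - a - l)"
        unfolding na by (simp add: power2_eq_square algebra_simps)
      also have "\<dots> < m" using nl by (simp add: P_def)
      finally show thesis using that(2)[of k] k0 Pk c l by (simp add: P_def)
    qed
  qed
qed

lemma nat_ceil_div:
  fixes a d :: nat
  assumes "0 < a"
  obtains t where "d \<le> t * a" "t = 0 \<or> (t - 1) * a < d"
proof -
  define t where "t = (LEAST t. d \<le> t * a)"
  have ex: "d \<le> d * a" using assms by simp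
  have 1: "d \<le> t * a" unfolding t_def by (rule LeastI[of "\<lambda>t. d \<le> t * a", OF ex])
  have "t = 0 \<or> (t - 1) * a < d"
  proof (cases "t = 0")
    case False
    then have "\<not> d \<le> (t - 1) * a" using not_less_Least[of "t - 1" "\<lambda>t. d \<le> t * a"] by (simp add: t_def)
    then show ?thesis by simp
  qed simp
  then show thesis using that 1 by blast
qed

text \<open>Only the numbers are kept: class sizes \<open>a\<close> and \<open>x\<close>,
  \<open>s\<close> light and \<open>i\<close> isolated vertices, \<open>d\<close> edges at light
  vertices. \<open>H\<close> is the comparison with bipartite competitors. By
  \<open>50 * d \<le> s * a\<close> the light edges could be carried by about s / 50 further
  vertices of the class of size \<open>x\<close>, although the light vertices themselves cost a
  factor exponential in s.\<close>

locale numeric =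
  fixes a x s i d m n :: nat and f :: real
  assumes n: "n = a + x + s + i" and m4: "4 * m \<le> n\<^sup>2" and a100: "100 \<le> a" and x1: "1 \<le> x" and d: "50 * d \<le> s * a"
    and H: "1 \<le> a' \<Longrightarrow> 1 \<le> b' \<Longrightarrow> a' + b' \<le> n \<Longrightarrow> m \<le> a' * b' \<Longrightarrow>
      (3 * 2 ^ b' + 3 * 2 ^ a' - 6) * 3 ^ (n - a' - b') \<le> f"
begin

section \<open>Contradictions from particular competitors\<close>

lemma a16: "(16::real) \<le> 2 ^ a"
proof -
  have "(2::real) ^ 4 \<le> 2 ^ a" using a100 by (intro power_increasing) auto
  then show ?thesis by simp
qed

lemma H1:
  assumes "1 \<le> a'" "1 \<le> b'" "a' + b' \<le> n" "m \<le> a' * b'"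
  shows "3 * 2 ^ b' * 3 ^ (n - a' - b') \<le> f"
proof -
  have "(2::real) ^ 1 \<le> 2 ^ a'" using assms(1) by (intro power_increasing) auto
  then have "3 * 2 ^ b' * (3::real) ^ (n - a' - b') \<le> (3 * 2 ^ b' + 3 * 2 ^ a' - 6) * 3 ^ (n - a' - b')"
    by (intro mult_right_mono) auto
  then show ?thesis using H[OF assms] by linarith
qed

text \<open>The competitor keeps the side \<open>a\<close> and turns \<open>t\<close> spare vertices
  into members of the other side; each drops from three colours to two.\<close>

lemma Hx:
  assumes "t \<le> s + i" "m \<le> a * (x + t)"
  shows "3 * 2 ^ x * 3 ^ (s + i) * (2 / 3) ^ t \<le> f"
    and "(3 * 2 ^ x * 2 ^ t + 3 * 2 ^ a - 6) * 3 ^ (s + i) / 3 ^ t \<le> f"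
proof -
  have "n - a - (x + t) = s + i - t" using n by simp
  moreover have "(3::real) ^ (s + i - t) = 3 ^ (s + i) / 3 ^ t" using assms(1) by (simp add: power_diff)
  moreover have "a + (x + t) \<le> n" using n assms(1) by simp
  ultimately show "3 * 2 ^ x * 3 ^ (s + i) * (2 / 3) ^ t \<le> f"
    "(3 * 2 ^ x * 2 ^ t + 3 * 2 ^ a - 6) * 3 ^ (s + i) / 3 ^ t \<le> f"
    using H1[of a "x + t"] H[of a "x + t"] a100 x1 assms(2)
    by (simp_all add: power_add power_divide mult_ac)
qed

text \<open>\<open>e\<close> edges inside the class of size \<open>x\<close> cost 2^j, where e \<le>
  j^2 and \<open>j\<close> is at most a / 100. A competitor replaces them by about e / a \<le> j /
  100 spare vertices at a factor 2/3 each. Without enough spare vertices, all \<open>n\<close>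
  vertices are split and \<open>k\<close> of them change sides, where (k - 1)^2 < e makes 2^k
  affordable.\<close>

lemma inner_edges_contradiction:
  assumes q: "m + q = a * x + e + d" and e: "1 \<le> e" "4 * e \<le> (j + 1)\<^sup>2" and j: "100 * j \<le> a" "j \<le> x"
    and s0: "s \<le> 2 * s0"
    and f1: "997 * f * 2 ^ j \<le> 3000 * 2 ^ x * (2 / 3) ^ s0 * 3 ^ (s + i)"
    and f2: "s = 0 \<Longrightarrow> i = 0 \<Longrightarrow> q = 0 \<Longrightarrow> f * 2 ^ j \<le> 3 * 2 ^ x"
  shows False
proof -
  have j1: "1 \<le> j"
  proof (rule ccontr)
    assume "\<not> 1 \<le> j"
    then have "j = 0" by simp
    then show False using e by simp
  qed
  let ?Z = "2 ^ x * 3 ^ (s + i) :: real"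
  have Z: "?Z > 0" by simp
  have p23: "(2 / 3 :: real) ^ s0 \<le> 1" by (intro power_le_one) auto
  have f1': "997 * f * 2 ^ j \<le> 3000 * ?Z"
  proof -
    have "?Z * (2 / 3) ^ s0 \<le> ?Z * 1" using p23 by (intro mult_left_mono) auto
    then have "3000 * (?Z * (2 / 3) ^ s0) \<le> 3000 * ?Z" by simp
    moreover have "3000 * 2 ^ x * (2 / 3) ^ s0 * 3 ^ (s + i) = 3000 * (?Z * (2 / 3) ^ s0)" by (simp only: mult_ac)
    ultimately show ?thesis using f1 by linarith
  qed
  \<comment> \<open>The extra 1 in the exponent is a factor 2, which more than covers 1000/997; the
    factor 3 of each spare vertex is estimated by 4.\<close>
  have big: "False" if "3 * 2 ^ y \<le> f" "y + j \<ge> x + 2 * (s + i) + 1" for y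
  proof -
    have "997 * (3 * 2 ^ y) * 2 ^ j \<le> 997 * f * (2::real) ^ j" using that(1) by (intro mult_right_mono) auto
    then have "997 * (3 * 2 ^ y) * 2 ^ j \<le> 3000 * ?Z" using f1' by (rule order.trans)
    moreover have "997 * (3 * 2 ^ y) * 2 ^ j = 3 * (997 * (2::real) ^ (y + j))" by (simp add: power_add)
    ultimately have "997 * 2 ^ (y + j) \<le> 1000 * ?Z" by argo
    moreover have "(2::real) ^ (x + 2 * (s + i) + 1) \<le> 2 ^ (y + j)" using that(2) by (intro power_increasing) auto
    moreover have "?Z \<le> 2 ^ x * 4 ^ (s + i)" by (intro mult_left_mono power_mono) auto
    moreover have "(2::real) ^ (x + 2 * (s + i) + 1) = 2 * (2 ^ x * 4 ^ (s + i))" by (simp add: power_add power_mult)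
    ultimately show False using Z by argo
  qed
  obtain t where t: "e + d \<le> t * a" "t = 0 \<or> (t - 1) * a < e + d" using nat_ceil_div[of a "e + d"] a100 by auto
  have t1: "1 \<le> t" using t(1) e(1) by (cases t) auto
  have t2: "(t - 1) * a < e + d" using t(2) t1 by auto
  have "(j + 1)\<^sup>2 \<le> (2 * j)\<^sup>2" using j1 by (intro power_mono) auto
  then have ej: "e \<le> j * j" using e(2) by (simp add: power2_eq_square)
  have "100 * e \<le> j * a"
  proof -
    have "100 * (j * j) \<le> j * a" using j(1) mult_le_mono2[of "100 * j" a j] by simp
    then show ?thesis using ej by linarith
  qed
  then have "(100 * (t - 1)) * a < (j + 2 * s) * a" using t2 d by (simp add: algebra_simps)
  then have tj: "100 * (t - 1) < j + 2 * s" by simp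
  show False
  proof (cases "t \<le> s + i")
    case True
    have "m \<le> a * (x + t)" using q t(1) by (simp add: algebra_simps)
    then have "3 * 2 ^ x * 3 ^ (s + i) * (2 / 3) ^ t \<le> f" by (rule Hx(1)[OF True])
    then have "997 * (3 * 2 ^ x * 3 ^ (s + i) * (2 / 3) ^ t) * 2 ^ j \<le> 997 * f * 2 ^ j"
      by (intro mult_right_mono mult_left_mono) auto
    then have "997 * (3 * 2 ^ x * 3 ^ (s + i) * (2 / 3) ^ t) * (2::real) ^ j \<le> 3000 * 2 ^ x * (2 / 3) ^ s0 * 3 ^ (s + i)"
      using f1 by (rule order.trans)
    moreover have "997 * (3 * 2 ^ x * 3 ^ (s + i) * (2 / 3) ^ t) * 2 ^ j = 3 * (?Z * (997 * (2 / 3) ^ t * 2 ^ j))"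
      "3000 * 2 ^ x * (2 / 3) ^ s0 * 3 ^ (s + i) = 3 * (?Z * (1000 * (2 / 3) ^ s0))" by simp_all
    ultimately have "?Z * (997 * (2 / 3) ^ t * 2 ^ j) \<le> ?Z * (1000 * (2 / 3) ^ s0)" by argo
    then have *: "997 * (2 / 3) ^ t * 2 ^ j \<le> 1000 * (2 / 3 :: real) ^ s0" using Z by (simp only: mult_le_cancel_left_pos)
    \<comment> \<open>The competitor loses (2/3)^t, the graph (2/3)^s0 and 2^j; with this bound an
      excess of (4/3)^j remains, and already 4/3 > 1000/997.\<close>
    have "t \<le> s0 + j" using tj s0 j1 t1 by linarith
    then have "(2 / 3 :: real) ^ (s0 + j) \<le> (2 / 3) ^ t" by (intro power_decreasing) auto
    then have "997 * (2 / 3) ^ (s0 + j) * 2 ^ j \<le> 997 * (2 / 3) ^ t * (2::real) ^ j"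
      by (intro mult_right_mono) auto
    then have "997 * (2 / 3) ^ (s0 + j) * 2 ^ j \<le> 1000 * (2 / 3 :: real) ^ s0" using * by linarith
    moreover have "997 * (2 / 3) ^ (s0 + j) * 2 ^ j = (2 / 3 :: real) ^ s0 * (997 * (4 / 3) ^ j)"
      by (simp add: power_add power_mult_distrib[symmetric])
    ultimately have "(2 / 3 :: real) ^ s0 * (997 * (4 / 3) ^ j) \<le> (2 / 3) ^ s0 * 1000" by simp
    then have "997 * (4 / 3 :: real) ^ j \<le> 1000" by (subst (asm) mult_le_cancel_left_pos) auto
    moreover have "(4 / 3 :: real) ^ 1 \<le> (4 / 3) ^ j" using j1 by (intro power_increasing) auto
    ultimately show False by simp
  next
    case False
    \<comment> \<open>Too few spare vertices for the side \<open>a\<close>: now the competitor uses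
      all \<open>n\<close> vertices, and \<open>rebalance\<close> tells how many of them change
      sides.\<close>
    have na: "n - a = x + s + i" "1 \<le> a" "a < n" using n a100 x1 by auto
    show False
    proof (rule rebalance[OF m4 na(2,3)])
      fix a' assume a': "1 \<le> a'" "a' < n" "m \<le> a' * (n - a')" "n - a \<le> n - a'"
      have "3 * 2 ^ (n - a') * 3 ^ (n - a' - (n - a')) \<le> f" by (rule H1) (use a' in auto)
      then have lowf: "3 * 2 ^ (n - a') \<le> f" by simp
      have "s + i + 1 \<le> j"
      proof (cases "s + i = 0")
        case False': False
        have "100 * (s + i) \<le> 100 * (t - 1)" using False by simp
        then have "100 * (s + i) < j + 2 * s" using tj by (rule le_less_trans)
        then have "98 * (s + i) < j" by (simp add: algebra_simps)
        moreover have "s + i \<le> 98 * (s + i)" by simp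
        ultimately show ?thesis by linarith
      qed (use j1 in simp)
      then have "x + 2 * (s + i) + 1 \<le> n - a' + j" using a'(4) na(1) by simp
      then show False by (rule big[OF lowf])
    next
      fix k assume k: "1 \<le> k" "a + k < n" "m \<le> (a + k) * (n - a - k)" "a * (n - a) + (k - 1)\<^sup>2 < m"
      have ak: "1 \<le> a + k" "1 \<le> n - a - k" "a + k + (n - a - k) \<le> n" using k a100 by auto
      have r0: "n - (a + k) - (n - a - k) = 0" using k(2) by simp
      have lowf: "3 * 2 ^ (n - a - k) \<le> f" using H1[OF ak k(3)] r0 by simp
      show False
      proof (cases "s + i = 0")
        case True
        then have si: "s = 0" "i = 0" "d = 0" using d by auto
        then have ke: "(k - 1)\<^sup>2 + q < e" using k(4) q na(1) by simp
        show False
        proof (cases "q = 0")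
          case True
          have "4 * (k - 1)\<^sup>2 < (j + 1)\<^sup>2" using ke e(2) by linarith
          then have "(2 * (k - 1))\<^sup>2 < (j + 1)\<^sup>2" by (simp add: power_mult_distrib)
          then have "2 * (k - 1) < j + 1" by (rule power_less_imp_less_base) simp
          then have kj: "k \<le> j" using j1 by linarith
          \<comment> \<open>Here k = j can occur, so no factor may be given away. The exact bound
            \<open>f2\<close> is used, and strictness comes from the second term of the competitor,
            in which the other side is constant.\<close>
          have "(3 * 2 ^ (n - a - k) + 3 * 2 ^ (a + k) - 6) * 3 ^ (n - (a + k) - (n - a - k)) \<le> f"
            by (rule H[OF ak k(3)])
          then have "3 * 2 ^ (n - a - k) + 3 * 2 ^ (a + k) - 6 \<le> f" using r0 by simp
          moreover have "(2::real) ^ 2 \<le> 2 ^ (a + k)" using a100 by (intro power_increasing) auto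
          ultimately have "3 * 2 ^ (x - k) < f" using si na(1) by simp
          then have "3 * 2 ^ (x - k) * 2 ^ j < f * 2 ^ j" by (intro mult_strict_right_mono) auto
          also have "\<dots> \<le> 3 * 2 ^ x" by (rule f2[OF si(1,2) True])
          finally have "(2::real) ^ (x - k + j) < 2 ^ x" by (simp add: power_add)
          then have "x - k + j < x" by (subst (asm) power_strict_increasing_iff) auto
          then show False using kj by linarith
        next
          case False
          \<comment> \<open>A missing pair across reduces the shortage of edges just enough to gain
            the factor 2 that \<open>big\<close> asks for.\<close>
          have "k + 1 \<le> j"
          proof (rule ccontr)
            assume "\<not> ?thesis"
            then have "j - 1 \<le> k - 1" by simp
            then have "(j - 1)\<^sup>2 \<le> (k - 1)\<^sup>2" by (intro power_mono) auto
            then have "(j - 1)\<^sup>2 + 2 \<le> e" using ke False by linarith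
            then have "4 * (j - 1)\<^sup>2 + 8 \<le> (j + 1)\<^sup>2" using e(2) by linarith
            moreover obtain l where "j = Suc l" using j1 by (cases j) auto
            ultimately have "4 * (l * l) + 8 \<le> l * l + 4 * l + 4" by (simp add: power2_eq_square algebra_simps)
            then have "3 * (l * l) + 4 \<le> 4 * l" by linarith
            moreover have "2 * l \<le> l * l + 1" by (cases l) auto
            ultimately show False by linarith
          qed
          then have "x + 2 * (s + i) + 1 \<le> n - a - k + j" using si na(1) j(2) by simp
          then show False by (rule big[OF lowf])
        qed
      next
        case si: False
        \<comment> \<open>That \<open>t\<close> exceeds the number of spare vertices makes this
          number tiny compared with \<open>j\<close>, so the factor 3 of each spare vertex is
          outweighed.\<close>
        have "100 * (s + i) \<le> 100 * (t - 1)" using False by simp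
        then have "100 * (s + i) < j + 2 * s" using tj by (rule le_less_trans)
        then have sj: "98 * (s + i) < j" by (simp add: algebra_simps)
        have "a * (s + i) + (k - 1)\<^sup>2 < e + d"
          using k(4) q na(1) by (simp add: algebra_simps)
        moreover have "d \<le> a * (s + i)"
        proof -
          have "50 * d \<le> a * (s + i)" using d by (simp add: algebra_simps)
          then show ?thesis by linarith
        qed
        ultimately have "(k - 1)\<^sup>2 < e" by linarith
        then have "4 * (k - 1)\<^sup>2 < (j + 1)\<^sup>2" using e(2) by linarith
        then have "(2 * (k - 1))\<^sup>2 < (j + 1)\<^sup>2" by (simp add: power_mult_distrib)
        then have "2 * (k - 1) < j + 1" by (rule power_less_imp_less_base) simp
        then have k2: "2 * k \<le> j + 2" using k(1) by linarith
        have gen: "x + 2 * w + 1 \<le> x + w - k + j" if "98 * w < j" "1 \<le> w" "2 * k \<le> j + 2" "k \<le> x + w" for w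
          using that by linarith
        have na': "n - a = x + (s + i)" using na(1) by simp
        have "x + 2 * (s + i) + 1 \<le> x + (s + i) - k + j"
          by (rule gen[OF sj _ k2]) (use si k(2) na' in linarith)+
        then have "x + 2 * (s + i) + 1 \<le> n - a - k + j" unfolding na' .
        then show False by (rule big[OF lowf])
      qed
    qed
  qed
qed

text \<open>The light vertices cost (2/3)^s0 with s0 \<ge> s / 2, but their edges need at most s /
  50 + 1 vertices in a competitor. If one vertex is enough, (2/3)^2 loses to 2/3; otherwise
  \<open>s\<close> is large and t + 2 \<le> s0.\<close>

lemma many_light_contradiction:
  assumes q: "m + q = a * x + d" and ax: "a \<le> x" and s0: "2 \<le> s0" "s0 \<le> s" "s \<le> 2 * s0"
    and f1: "997 * f \<le> 1000 * ((2 / 3) ^ s0 * 3 ^ (s + i) * (3 * 2 ^ x + 3 * 2 ^ a))"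
  shows False
proof -
  let ?R = "3 ^ (s + i) :: real"
  have R: "?R > 0" by simp
  have ax2: "(2::real) ^ a \<le> 2 ^ x" using ax by (intro power_increasing) auto
  obtain t where t: "d \<le> t * a" "t = 0 \<or> (t - 1) * a < d" using nat_ceil_div[of a d] a100 by auto
  show False
  proof (cases "t \<le> 1")
    case True
    then have "d \<le> 1 * a" using t(1) by (meson le_trans mult_le_mono1)
    then have "m \<le> a * (x + 1)" using q by simp
    then have "(3 * 2 ^ x * 2 ^ 1 + 3 * 2 ^ a - 6) * 3 ^ (s + i) / 3 ^ 1 \<le> f" using s0 by (intro Hx(2)) auto
    then have "?R * (2 * 2 ^ x + 2 ^ a - 2) \<le> f" by (simp add: algebra_simps)
    moreover have "(2 / 3 :: real) ^ s0 \<le> (2 / 3) ^ 2" using s0 by (intro power_decreasing) auto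
    then have "(2 / 3) ^ s0 * ?R * (3 * 2 ^ x + 3 * 2 ^ a) \<le> (2 / 3) ^ 2 * ?R * (3 * 2 ^ x + 3 * 2 ^ a)"
      by (intro mult_right_mono) auto
    then have "(2 / 3) ^ s0 * ?R * (3 * 2 ^ x + 3 * 2 ^ a) \<le> ?R * (4 / 3 * (2 ^ x + 2 ^ a))"
      by (simp add: power2_eq_square algebra_simps)
    ultimately have "?R * (997 * (2 * 2 ^ x + 2 ^ a - 2)) \<le> ?R * (4000 / 3 * (2 ^ x + 2 ^ a))"
      using f1 by argo
    then have "997 * (2 * 2 ^ x + 2 ^ a - 2) \<le> 4000 / 3 * (2 ^ x + (2::real) ^ a)"
      using R by (simp only: mult_le_cancel_left_pos)
    then show False using ax2 a16 by argo
  next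
    case False
    then have "(t - 1) * a < d" using t by auto
    then have "(50 * (t - 1)) * a < s * a" using d by linarith
    then have ts: "50 * (t - 1) < s" by simp
    then have t2: "t + 2 \<le> s0" "t \<le> s + i" using False s0 by linarith+
    have "m \<le> a * (x + t)" using q t(1) by (simp add: algebra_simps)
    then have "3 * 2 ^ x * ?R * (2 / 3) ^ t \<le> f" by (rule Hx(1)[OF t2(2)])
    moreover have "(2 / 3 :: real) ^ s0 \<le> (2 / 3) ^ (t + 2)" using t2 by (intro power_decreasing) auto
    then have "(2 / 3) ^ s0 * ?R * (3 * 2 ^ x + 3 * 2 ^ a) \<le> (2 / 3) ^ (t + 2) * ?R * (3 * 2 ^ x + 3 * 2 ^ x)"
      using ax2 by (intro mult_mono) auto
    moreover have "(2 / 3) ^ (t + 2) * ?R * (3 * 2 ^ x + 3 * 2 ^ x) = 8 / 9 * (3 * 2 ^ x * ?R * (2 / 3) ^ t)"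
      by (simp add: power2_eq_square)
    moreover have "3 * 2 ^ x * ?R * (2 / 3) ^ t > 0" by simp
    ultimately show False using f1 by argo
  qed
qed

text \<open>One edge too many for K_{a,x}, with at least two vertices to spare. Depending on the
  ratio of the sides, K_{a-2,x+3}, K_{a-1,x+3} or K_{a+1,x-2} has a x + 1 edges and more colourings;
  the thresholds are exactly those at which the first two have enough edges.\<close>

lemma pendant_spare_contradiction:
  assumes m: "m = a * x + 1" and ax: "a \<le> x" and y: "2 \<le> s + i"
    and f1: "997 * f \<le> 1000 * (2 / 3 * 3 ^ (s + i) * (3 * 2 ^ x + 3 * 2 ^ a))"
  shows False
proof -
  obtain y where y': "s + i = y + 2" using y le_Suc_ex by (metis add.commute)
  let ?R = "3 ^ y :: real"
  have n': "n = a + x + y + 2" using n y' by simp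
  have ax2: "(2::real) ^ a \<le> 2 ^ x" using ax by (intro power_increasing) auto
  have R: "?R > 0" by simp
  have "(3::real) ^ (s + i) = 9 * ?R" using y' by (simp add: power_add)
  then have "997 * f \<le> 1000 * (2 / 3 * (9 * ?R) * (3 * 2 ^ x + 3 * 2 ^ a))" using f1 by simp
  also have "\<dots> = 18000 * (?R * (2 ^ x + 2 ^ a))" by (simp add: algebra_simps)
  finally have f2: "997 * f \<le> 18000 * (?R * (2 ^ x + 2 ^ a))" .
  have p: "?R * 2 ^ x > 0" by simp
  consider "2 * x + 7 \<le> 3 * a" | "3 * a < 2 * x + 7" "x + 4 \<le> 3 * a" | "3 * a < x + 4" by linarith
  then show False
  proof cases
    case 1
    obtain c where c: "a = c + 2" using a100 by (intro that[of "a - 2"]) simp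
    have "m \<le> c * (x + 3)" using m 1 c by (simp add: algebra_simps)
    then have "3 * 2 ^ (x + 3) * 3 ^ (n - c - (x + 3)) \<le> f" using n' c a100 by (intro H1) auto
    moreover have "n - c - (x + 3) = y + 1" using n' c by simp
    ultimately have "72 * (?R * 2 ^ x) \<le> f" by (simp add: power_add mult_ac)
    moreover have "?R * (2 ^ x + 2 ^ a) \<le> ?R * (2 * 2 ^ x)" using ax2 by (intro mult_left_mono) auto
    ultimately show False using f2 p by argo
  next
    case 2
    obtain c where c: "a = c + 1" using a100 by (intro that[of "a - 1"]) simp
    have "m \<le> c * (x + 3)" using m 2 c by (simp add: algebra_simps)
    then have "3 * 2 ^ (x + 3) * 3 ^ (n - c - (x + 3)) \<le> f" using n' c a100 by (intro H1) auto
    moreover have "n - c - (x + 3) = y" using n' c by simp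
    ultimately have "24 * (?R * 2 ^ x) \<le> f" by (simp add: power_add mult_ac)
    moreover have "(2::real) ^ (a + 10) \<le> 2 ^ x" using 2 a100 by (intro power_increasing) auto
    then have "2 ^ a \<le> 2 ^ x / (1024::real)" by (simp add: power_add)
    then have "?R * (2 ^ x + 2 ^ a) \<le> ?R * (2 ^ x + 2 ^ x / 1024)" by (intro mult_left_mono add_left_mono) auto
    then have "?R * (2 ^ x + 2 ^ a) \<le> 1025 / 1024 * (?R * 2 ^ x)" by (simp add: algebra_simps)
    ultimately show False using f2 p by argo
  next
    case 3
    obtain c where c: "x = c + 2" using ax a100 by (intro that[of "x - 2"]) simp
    have "m \<le> (a + 1) * c" using m 3 c a100 by (simp add: algebra_simps)
    then have "3 * 2 ^ c * 3 ^ (n - (a + 1) - c) \<le> f" using n' c a100 ax by (intro H1) auto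
    moreover have "n - (a + 1) - c = y + 3" using n' c by simp
    ultimately have "81 * (?R * 2 ^ c) \<le> f" by (simp add: power_add mult_ac)
    moreover have "?R * 2 ^ x = 4 * (?R * 2 ^ c)" using c by (simp add: power_add)
    moreover have "(2::real) ^ (a + 10) \<le> 2 ^ x" using 3 a100 by (intro power_increasing) auto
    then have "2 ^ a \<le> 2 ^ x / (1024::real)" by (simp add: power_add)
    then have "?R * (2 ^ x + 2 ^ a) \<le> ?R * (2 ^ x + 2 ^ x / 1024)" by (intro mult_left_mono add_left_mono) auto
    then have "?R * (2 ^ x + 2 ^ a) \<le> 1025 / 1024 * (?R * 2 ^ x)" by (simp add: algebra_simps)
    ultimately show False using f2 p by argo
  qed
qed

text \<open>Two light vertices joined only to each other. If all pairs across are present, this is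
  the pendant count with two spare vertices; otherwise K_{a,x} already has \<open>m\<close> edges
  and the light vertices become free.\<close>

lemma isolated_edge_contradiction:
  assumes q: "m + q = a * x + 1" and ax: "a \<le> x" and s: "s = 2"
    and f1: "997 * f \<le> 1000 * (2 / 3 * 3 ^ (s + i) * (3 * 2 ^ x + 3 * 2 ^ a))"
  shows False
proof (cases "q = 0")
  case True
  then show False using pendant_spare_contradiction[OF _ ax _ f1] q s by simp
next
  case False
  then have "m \<le> a * (x + 0)" using q by simp
  then have "(3 * 2 ^ x * 2 ^ 0 + 3 * 2 ^ a - 6) * 3 ^ (s + i) / 3 ^ 0 \<le> f" by (intro Hx(2)) auto
  then have "3 ^ (s + i) * (3 * 2 ^ x + 3 * 2 ^ a - 6) \<le> f" by (simp add: mult.commute)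
  then have "(3::real) ^ (s + i) * (997 * (3 * 2 ^ x + 3 * 2 ^ a - 6)) \<le> 3 ^ (s + i) * (2000 / 3 * (3 * 2 ^ x + 3 * 2 ^ a))"
    using f1 by argo
  then have "997 * (3 * 2 ^ x + 3 * 2 ^ a - 6) \<le> 2000 / 3 * (3 * 2 ^ x + 3 * (2::real) ^ a)"
    by (subst (asm) mult_le_cancel_left_pos) auto
  moreover have "(2::real) ^ a \<le> 2 ^ x" using ax by (intro power_increasing) auto
  ultimately show False using a16 by argo
qed

text \<open>Otherwise the sides are close enough for K_{a-1,x+2} to have \<open>m\<close> edges, at
  the price of one spare vertex. The conclusion makes the colourings constant on the larger side
  negligible in the next lemmas; 1024 is a convenient power of 2.\<close>

lemma one_light_unbalanced:
  assumes q: "m + q = a * x + d" and ax: "a \<le> x" and s: "s = 1"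
    and f1: "997 * f \<le> 1000 * (2 * 3 ^ i * (3 * 2 ^ x + 3 * 2 ^ a))"
  shows "1024 * 2 ^ a \<le> (2::real) ^ x"
proof (rule ccontr)
  assume neg: "\<not> ?thesis"
  let ?R = "3 ^ i :: real"
  have R: "?R > 0" by simp
  have "5 * x \<le> 7 * a"
  proof (rule ccontr)
    assume "\<not> ?thesis"
    then have "(2::real) ^ (a + 10) \<le> 2 ^ x" using a100 by (intro power_increasing) auto
    then show False using neg by (simp add: power_add)
  qed
  obtain c where c: "a = c + 1" using a100 by (intro that[of "a - 1"]) simp
  have "50 * d \<le> a" using d s by simp
  then have "m \<le> c * (x + 2)" using q c \<open>5 * x \<le> 7 * a\<close> a100 by (simp add: algebra_simps)
  then have "(3 * 2 ^ (x + 2) + 3 * 2 ^ c - 6) * 3 ^ (n - c - (x + 2)) \<le> f" using n c s a100 by (intro H) auto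
  moreover have "n - c - (x + 2) = i" using n c s by simp
  moreover have "(2::real) ^ a = 2 * 2 ^ c" using c by simp
  ultimately have "?R * (12 * 2 ^ x + 3 / 2 * 2 ^ a - 6) \<le> f" by (simp add: power_add algebra_simps)
  then have "?R * (997 * (12 * 2 ^ x + 3 / 2 * 2 ^ a - 6)) \<le> ?R * (6000 * (2 ^ x + 2 ^ a))" using f1 by argo
  then have le: "997 * (12 * 2 ^ x + 3 / 2 * 2 ^ a - 6) \<le> 6000 * (2 ^ x + (2::real) ^ a)"
    using R by (simp only: mult_le_cancel_left_pos)
  show False
  proof (cases "a = x")
    case True
    then show False using le a16 by simp
  next
    case False
    then have "(2::real) ^ (a + 1) \<le> 2 ^ x" using ax by (intro power_increasing) auto
    then have "2 * 2 ^ a \<le> (2::real) ^ x" by (simp only: power_add power_one_right mult.commute)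
    then show False using le a16 by argo
  qed
qed

text \<open>If \<open>q\<close> were at least \<open>d\<close>, K_{a,x} would have \<open>m\<close>
  edges and the light vertex would be free, gaining about 3/2.\<close>

lemma one_light_few_missing:
  assumes q: "m + q = a * x + d" and s: "s = 1" and un: "1024 * 2 ^ a \<le> (2::real) ^ x"
    and f1: "997 * f \<le> 1000 * (2 * 3 ^ i * (3 * 2 ^ x + 3 * 2 ^ a))"
  shows "q < d"
proof (rule ccontr)
  assume "\<not> ?thesis"
  then have "m \<le> a * (x + 0)" using q by simp
  then have "3 * 2 ^ x * 3 ^ (s + i) * (2 / 3) ^ 0 \<le> f" by (intro Hx(1)) auto
  then have "3 ^ i * (9 * 2 ^ x) \<le> f" using s by (simp add: mult_ac)
  then have "(3::real) ^ i * (997 * (9 * 2 ^ x)) \<le> 3 ^ i * (6000 * (2 ^ x + 2 ^ a))" using f1 by argo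
  then have "997 * (9 * 2 ^ x) \<le> 6000 * (2 ^ x + (2::real) ^ a)"
    by (subst (asm) mult_le_cancel_left_pos) auto
  then show False using un zero_less_power[of "2::real" x] by argo
qed

text \<open>K_{a,x+1} carries the light edges and keeps 6 * 2^x colourings per colouring of the
  isolated vertices, which 9/2 * 2^x plus a negligible term cannot match.\<close>

lemma one_light_bad_contradiction:
  assumes q: "m + q = a * x + d" and s: "s = 1" and un: "1024 * 2 ^ a \<le> (2::real) ^ x"
    and f1: "997 * f \<le> 1000 * (3 ^ i * (9 / 2 * 2 ^ x + 6 * 2 ^ a))"
  shows False
proof -
  have "50 * d \<le> a" using d s by simp
  then have "m \<le> a * (x + 1)" using q by simp
  then have "3 * 2 ^ x * 3 ^ (s + i) * (2 / 3) ^ 1 \<le> f" using s by (intro Hx(1)) auto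
  then have "3 ^ i * (6 * 2 ^ x) \<le> f" using s by (simp add: mult_ac)
  then have "(3::real) ^ i * (997 * (6 * 2 ^ x)) \<le> 3 ^ i * (1000 * (9 / 2 * 2 ^ x + 6 * 2 ^ a))" using f1 by argo
  then have "997 * (6 * 2 ^ x) \<le> 1000 * (9 / 2 * 2 ^ x + 6 * (2::real) ^ a)"
    by (subst (asm) mult_le_cancel_left_pos) auto
  then show False using un zero_less_power[of "2::real" x] by argo
qed

text \<open>With \<open>a\<close> missing pairs a vertex of the larger side could be freed:
  K_{a,x-1} suffices, a gain of about 3/2.\<close>

lemma no_light_few_missing:
  assumes q: "m + q = a * x" and ax: "a \<le> x" and s: "s = 0"
    and f1: "997 * f \<le> 1000 * (3 ^ i * (3 * 2 ^ x + 3 * 2 ^ a))"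
  shows "q < a"
proof (rule ccontr)
  assume "\<not> ?thesis"
  obtain c where c: "x = c + 1" using a100 ax by (intro that[of "x - 1"]) simp
  have "m \<le> a * c" using q c \<open>\<not> q < a\<close> by simp
  then have "(3 * 2 ^ c + 3 * 2 ^ a - 6) * 3 ^ (n - a - c) \<le> f" using n c s a100 ax by (intro H) auto
  moreover have "n - a - c = i + 1" using n c s by simp
  moreover have x2: "(2::real) ^ x = 2 * 2 ^ c" using c by simp
  ultimately have "3 ^ i * (9 / 2 * 2 ^ x + 9 * 2 ^ a - 18) \<le> f" by (simp add: algebra_simps)
  then have "(3::real) ^ i * (997 * (9 / 2 * 2 ^ x + 9 * 2 ^ a - 18)) \<le> 3 ^ i * (3000 * (2 ^ x + 2 ^ a))" using f1 by argo
  then have "997 * (9 / 2 * 2 ^ x + 9 * 2 ^ a - 18) \<le> 3000 * (2 ^ x + (2::real) ^ a)"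
    by (subst (asm) mult_le_cancel_left_pos) auto
  moreover have "(2::real) ^ a \<le> 2 ^ x" using ax by (intro power_increasing) auto
  ultimately show False using a16 by argo
qed

end

section \<open>The structure of maximisers\<close>

text \<open>Concentrating the deleted edges at one vertex of \<open>X\<close> keeps the number of
  edges, and fewer than \<open>card A\<close> of them fit there. A deleted set that is not a star
  would then have strictly fewer colourings.\<close>

lemma maximizer_star:
  fixes V :: "'a set"
  assumes mx: "maximizes_colorings 3 n m V E" and sub: "A \<subseteq> V" "X \<subseteq> V" "A \<inter> X = {}"
    and E: "E \<subseteq> bip A X" and D: "card (bip A X - E) < card A" and ax: "card A \<le> card X"
  shows "semi_complete_plus_isolated (card A) (card X) V E"
proof -
  let ?D = "bip A X - E"
  have sg: "simple_graph V E" and fin: "finite V" and n: "card V = n" and m: "card E = m"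
    using mx by (auto simp: maximizes_colorings_def graph_with_def simple_graph_def)
  have finAX: "finite A" "finite X" using fin sub(1,2) by (blast intro: finite_subset)+
  have ED: "E = bip A X - ?D" using E by blast
  have DX: "card ?D < card X" using D ax by simp
  have star: "\<exists>v. \<forall>e\<in>?D. v \<in> e"
  proof (rule ccontr)
    assume ns: "\<not> ?thesis"
    obtain T where T: "T \<subseteq> A" "card T = card ?D" using obtain_subset_with_card_n[of "card ?D" A] D by auto
    have "X \<noteq> {}" using DX by auto
    then obtain y where y: "y \<in> X" by blast
    let ?B = "bip T {y}"
    have Ty: "T \<inter> {y} = {}" using T y sub by blast
    have Bsub: "?B \<subseteq> bip A X" using T y by (auto simp: bip_def)
    have cB: "card ?B = card ?D" using T card_bip[OF Ty] by simp
    let ?E = "bip A X - ?B"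
    have fb: "finite (bip A X)" using finAX by simp
    have "card ?E = card (bip A X) - card ?D"
      using Bsub fb cB by (simp add: card_Diff_subset finite_subset)
    moreover have "card (bip A X) - card ?D = card E"
    proof -
      have "card ?D = card (bip A X) - card E" by (rule card_Diff_subset[OF finite_subset[OF E fb] E])
      then show ?thesis using card_mono[OF fb E] by simp
    qed
    ultimately have "card ?E = m" using m by simp
    moreover have sg': "simple_graph V ?E"
      using bip_nsets[OF sub(3,1,2)] fin by (auto simp: simple_graph_def)
    ultimately have "graph_with n m V ?E" using n by (simp add: graph_with_def)
    then have "num_colorings 3 V ?E \<le> num_colorings 3 V E" using mx by (simp add: maximizes_colorings_def)
    then have "card (cols3 V ?E) \<le> card (cols3 V E)"
      using num_colorings_cols3[OF sg] num_colorings_cols3[OF sg'] by simp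
    moreover have "card (cols3 V (bip A X - ?D)) < card (cols3 V ?E)"
    proof -
      have "card T < card A" using T D by simp
      from card_bip_minus_star_ge[OF fin sub T(1) this y refl] card_bip_minus_le(2)[OF fin sub _ D DX refl ns]
      show ?thesis using T(2) by fastforce
    qed
    ultimately show False using ED by simp
  qed
  have "semi_complete (card A) (card X) (A \<union> X) E"
    unfolding semi_complete_def complete_bipartite_def
  proof (intro conjI exI)
    show "1 \<le> card A" using D by simp
    show "card A \<le> card X" by (rule ax)
    show "finite A" "finite X" "A \<inter> X = {}" by fact+
    show "A \<union> X = A \<union> X" "card A = card A" "card X = card X" by (rule refl)+
    show "bip A X = {{x, y} |x y. x \<in> A \<and> y \<in> X}" by (rule bip_def)
    show "?D \<subseteq> bip A X" by blast
    show "card ?D < card A" by (rule D)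
    show "\<forall>e\<in>?D. (SOME v. \<forall>e\<in>?D. v \<in> e) \<in> e" using someI_ex[OF star] by blast
    show "E = bip A X - ?D" by (rule ED)
  qed
  then show ?thesis unfolding semi_complete_plus_isolated_def using sub by blast
qed

locale extremal_graph = decomposed_graph +
  fixes m n :: nat
  assumes mx: "maximizes_colorings 3 n m V E" and m4: "4 * m \<le> n\<^sup>2"
begin

lemma extremal_swap: "extremal_graph V E X A S I L m n"
  by (intro extremal_graph.intro swap_sides extremal_graph_axioms.intro mx m4)

section \<open>Edge counts and extension counts of an extremal graph\<close>

lemma basic: "finite V" "card V = n" "card E = m" "E \<subseteq> nsets V 2"
  using mx by (auto simp: maximizes_colorings_def graph_with_def simple_graph_def)

lemma finite_parts: "finite A" "finite X" "finite S" "finite I"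
  using basic(1) V by (auto intro: finite_subset)

lemma card_V: "n = card A + card X + card S + card I"
proof -
  have "card V = card (A \<union> X \<union> S) + card I"
    unfolding V by (rule card_Un_disjoint) (use finite_parts dis in auto)
  also have "card (A \<union> X \<union> S) = card (A \<union> X) + card S"
    by (rule card_Un_disjoint) (use finite_parts dis in auto)
  also have "card (A \<union> X) = card A + card X"
    by (rule card_Un_disjoint) (use finite_parts dis in auto)
  finally show ?thesis using basic(2) by simp
qed

lemma subsets: "A \<subseteq> V" "X \<subseteq> V" "S \<subseteq> V" "I \<subseteq> V" using V by auto

lemma sizes: "100 \<le> card A" "100 \<le> card X" "L \<le> 2 * real (card A)" "L \<le> 2 * real (card X)"
  using sizeA sizeX L by auto

lemma edgeD: "{u, v} \<in> E \<Longrightarrow> u \<in> V \<and> v \<in> V \<and> u \<noteq> v \<and> u \<notin> I \<and> v \<notin> I"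
  using simple_graph_edge[OF sg, of u v] isolated[of u v] isolated[of v u] by (auto simp: insert_commute)

lemma edgeE:
  assumes "e \<in> E" obtains u v where "e = {u, v}" "u \<noteq> v"
  using assms basic(4) by (auto simp: nsets_def card_2_iff)

lemma colsD: "g \<in> cols3 V E \<Longrightarrow> v \<in> V \<Longrightarrow> g v < 3"
  "g \<in> cols3 V E \<Longrightarrow> {v, w} \<in> E \<Longrightarrow> g v \<noteq> g w"
  using edgeD by (auto simp: list_colorings_def)

abbreviation "f \<equiv> real (card (cols3 V E))"
abbreviation "n1 \<equiv> card {g \<in> cols3 V E. monochrom g A}"
abbreviation "n2 \<equiv> card {g \<in> cols3 V E. monochrom g X}"
abbreviation "q \<equiv> card (bip A X - E)"
abbreviation "lightE \<equiv> {e \<in> E. e \<inter> S \<noteq> {}}"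

lemma f_pos: "f > 0"
proof -
  have "0 < (2::real) ^ card X * 3 ^ (card V - card A - card X)" by simp
  then have "0 < f * exp (L / 2000)" using lowX by linarith
  then show ?thesis by (simp add: zero_less_mult_iff)
qed

lemma maximizer_bound:
  assumes "1 \<le> a'" "1 \<le> b'" "a' + b' \<le> n" "m \<le> a' * b'"
  shows "(3 * 2 ^ b' + 3 * 2 ^ a' - 6) * 3 ^ (n - a' - b') \<le> f"
  using maximizer_ge_bipartite[OF mx assms] num_colorings_cols3[OF sg] by simp

lemma inner_edge_not_mono:
  assumes "edges_in Y E \<noteq> {}" "g \<in> cols3 V E" shows "\<not> monochrom g Y"
proof
  assume mono: "monochrom g Y"
  obtain e where e: "e \<in> E" "e \<subseteq> Y" using assms by (auto simp: edges_in_def)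
  obtain u v where uv: "e = {u, v}" using edgeE[OF e(1)] by blast
  have "g u \<noteq> g v" using colsD(2)[OF assms(2)] e uv by blast
  then show False using mono e uv by (auto simp: monochrom_def)
qed

text \<open>Degrees in \<open>S\<close> are at most L / 100, and L is at most twice the size of
  \<open>A\<close>; this is the origin of the 50.\<close>

lemma light_edges: "50 * card lightE \<le> card S * card A"
proof -
  let ?N = "\<lambda>v. {u \<in> V. {v, u} \<in> E}"
  have finN: "finite (?N v)" for v using basic(1) by simp
  define G where "G v = (\<lambda>u. {v, u}) ` ?N v" for v
  have "lightE \<subseteq> (\<Union>v\<in>S. G v)"
  proof
    fix e assume e: "e \<in> lightE"
    then obtain u v where uv: "e = {u, v}" using edgeE by blast
    have "{u, v} \<in> E" "{v, u} \<in> E" using e uv by (auto simp: insert_commute)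
    then have *: "v \<in> ?N u" "u \<in> ?N v" using edgeD[of u v] by auto
    have "{u, v} \<in> G u" unfolding G_def using *(1) by (rule imageI)
    then have 1: "e \<in> G u" using uv by simp
    have "{v, u} \<in> G v" unfolding G_def using *(2) by (rule imageI)
    then have 2: "e \<in> G v" using uv by (simp add: insert_commute)
    have "u \<in> S \<or> v \<in> S" using e uv by auto
    then show "e \<in> (\<Union>v\<in>S. G v)" using 1 2 by blast
  qed
  then have "card lightE \<le> card (\<Union>v\<in>S. G v)"
    by (rule card_mono[rotated]) (use finite_parts finN in \<open>auto simp: G_def\<close>)
  also have "\<dots> \<le> (\<Sum>v\<in>S. card (G v))" by (rule card_UN_le[OF finite_parts(3)])
  also have "\<dots> \<le> (\<Sum>v\<in>S. card (?N v))" unfolding G_def by (intro sum_mono card_image_le finN)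
  finally have "real (card lightE) \<le> (\<Sum>v\<in>S. real (card (?N v)))" unfolding of_nat_sum[symmetric] by (rule of_nat_mono)
  also have "\<dots> \<le> (\<Sum>v\<in>S. L / 100)" by (intro sum_mono light)
  also have "\<dots> = real (card S) * L / 100" by simp
  also have "\<dots> \<le> real (card S) * (2 * real (card A)) / 100"
    by (intro divide_right_mono mult_left_mono sizes(3)) auto
  finally have "50 * real (card lightE) \<le> real (card S) * real (card A)" by (simp add: mult.commute)
  then have "real (50 * card lightE) \<le> real (card S * card A)" by simp
  then show ?thesis by (simp only: of_nat_le_iff)
qed

lemma edge_count:
  assumes "edges_in A E = {}"
  shows "m + q = card A * card X + card (edges_in X E) + card lightE"
proof -
  have finE: "finite E" using basic(1,4) by (meson finite_imp_finite_nsets finite_subset)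
  have "E = (E \<inter> bip A X) \<union> edges_in X E \<union> lightE"
  proof
    show "E \<subseteq> (E \<inter> bip A X) \<union> edges_in X E \<union> lightE"
    proof
      fix e assume e: "e \<in> E"
      then obtain u v where uv: "e = {u, v}" by (rule edgeE)
      have "u \<in> A \<union> X \<union> S" "v \<in> A \<union> X \<union> S" using edgeD[of u v] e uv V by auto
      moreover have "\<not> (u \<in> A \<and> v \<in> A)" using assms e uv by (auto simp: edges_in_def)
      ultimately consider "u \<in> S \<or> v \<in> S" | "u \<in> X \<and> v \<in> X" | "u \<in> A \<and> v \<in> X \<or> u \<in> X \<and> v \<in> A" by blast
      then show "e \<in> (E \<inter> bip A X) \<union> edges_in X E \<union> lightE"
        by cases (use e uv bip_iff[OF dis(1), of u v] in \<open>auto simp: edges_in_def\<close>)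
    qed
  qed (auto simp: edges_in_def)
  then have "m = card ((E \<inter> bip A X) \<union> edges_in X E \<union> lightE)" using basic(3) by simp
  also have "\<dots> = card ((E \<inter> bip A X) \<union> edges_in X E) + card lightE"
  proof (rule card_Un_disjoint)
    show "((E \<inter> bip A X) \<union> edges_in X E) \<inter> lightE = {}"
      using dis by (auto simp: edges_in_def bip_def)
  qed (use finE in \<open>auto simp: edges_in_def\<close>)
  also have "card ((E \<inter> bip A X) \<union> edges_in X E) = card (E \<inter> bip A X) + card (edges_in X E)"
  proof (rule card_Un_disjoint)
    show "(E \<inter> bip A X) \<inter> edges_in X E = {}"
      using dis by (auto simp: edges_in_def bip_def)
  qed (use finE in \<open>auto simp: edges_in_def\<close>)
  finally have "m = card (E \<inter> bip A X) + card (edges_in X E) + card lightE" .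
  moreover have "card (bip A X) = card (E \<inter> bip A X) + q"
  proof -
    have "card (bip A X) = card ((E \<inter> bip A X) \<union> (bip A X - E))" by (rule arg_cong[where f=card]) blast
    also have "\<dots> = card (E \<inter> bip A X) + q"
      by (rule card_Un_disjoint) (use finE finite_parts in auto)
    finally show ?thesis .
  qed
  ultimately show ?thesis using card_bip[OF dis(1)] by simp
qed

lemma numeric_params: "numeric (card A) (card X) (card S) (card I) (card lightE) m n f"
  by unfold_locales (use card_V m4 sizes light_edges maximizer_bound in auto)

text \<open>The number of ways to extend a colouring to the light vertices, uniformly for all
  families, since it is used for colourings constant on \<open>A\<close> and on \<open>X\<close>
  separately.\<close>

definition ext_factor :: "nat \<Rightarrow> bool" where
  "ext_factor K \<longleftrightarrow> (\<forall>F\<subseteq>cols3 V E. card F \<le> K * card ((\<lambda>g. restrict g (V - S)) ` F))"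

lemma ext_factor_dominated:
  assumes T: "T \<subseteq> S" "\<And>w. w \<in> T \<Longrightarrow> \<exists>u\<in>V - T. {w, u} \<in> E"
  shows "ext_factor (2 ^ card T * 3 ^ (card S - card T))"
  unfolding ext_factor_def
proof (intro allI impI)
  fix F assume F: "F \<subseteq> cols3 V E"
  let ?r = "\<lambda>W F. (\<lambda>g. restrict g W) ` F"
  have finT: "finite T" using T(1) finite_parts finite_subset by blast
  have TV: "T \<subseteq> V" using T subsets by blast
  have 1: "card F \<le> 2 ^ card T * card (?r (V - T) F)"
    by (rule card_dominated_le[OF basic(1) TV T(2) F])
  have 2: "card (?r (V - T) F) \<le> 3 ^ card (S - T) * card (?r (V - T - (S - T)) (?r (V - T) F))"
  proof (rule card_free_le)
    show "?r (V - T) F \<subseteq> cols3 (V - T) E" using F by (auto intro: restrict_list_colorings)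
  qed (use basic subsets in auto)
  have 3: "?r (V - T - (S - T)) (?r (V - T) F) = ?r (V - S) F"
  proof -
    have "V - T - (S - T) = V - S" "(V - T) \<inter> (V - S) = V - S" using T(1) by auto
    then show ?thesis by (simp add: image_image)
  qed
  have 4: "card (S - T) = card S - card T" using T finT by (simp add: card_Diff_subset)
  show "card F \<le> 2 ^ card T * 3 ^ (card S - card T) * card (?r (V - S) F)"
    using order.trans[OF 1 mult_le_mono2[OF 2]] unfolding 3 4 by (simp only: mult.assoc)
qed

text \<open>Each vertex of \<open>X\<close> has a neighbour in \<open>A\<close> and thus avoids the
  colour of \<open>A\<close>. Whether it has the cyclically next colour decides between the two left
  and gives a proper 2-colouring of \<open>X\<close>.\<close>

lemma card_monochrom_two_colorings:
  "card {h \<in> cols3 (A \<union> X) E. monochrom h A} \<le> 3 * card (two_colorings X E)"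
proof -
  let ?F = "{h \<in> cols3 (A \<union> X) E. monochrom h A}"
  obtain a0 where a0: "a0 \<in> A" using sizes(1) by fastforce
  let ?h = "\<lambda>h. (h a0, \<lambda>x\<in>X. h x = (h a0 + 1) mod 3)"
  have hA: "h v = h a0" if "h \<in> ?F" "v \<in> A" for h v using that a0 by (auto simp: monochrom_def)
  have h3: "h v < 3" if "h \<in> ?F" "v \<in> A \<union> X" for h v using that by (auto simp: list_colorings_def)
  have hX: "h v \<noteq> h a0" if h: "h \<in> ?F" and v: "v \<in> X" for h v
  proof -
    obtain u where u: "u \<in> A" "{v, u} \<in> E" using nbX[OF v] by blast
    then have "h v \<noteq> h u" using h v unfolding list_colorings_def by blast
    then show ?thesis using hA[OF h u(1)] by simp
  qed
  have mod: "\<And>c d e :: nat. c < 3 \<Longrightarrow> d < 3 \<Longrightarrow> e < 3 \<Longrightarrow> d \<noteq> c \<Longrightarrow> e \<noteq> c \<Longrightarrow>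
     (d = (c + 1) mod 3 \<longleftrightarrow> e = (c + 1) mod 3) \<longleftrightarrow> d = e"
    by presburger
  have "inj_on ?h ?F"
  proof (rule inj_onI)
    fix h k assume hk: "h \<in> ?F" "k \<in> ?F" "?h h = ?h k"
    have c: "h a0 = k a0" using hk(3) by simp
    show "h = k"
    proof (rule extensionalityI[of _ "A \<union> X"])
      show "h \<in> extensional (A \<union> X)" "k \<in> extensional (A \<union> X)" using hk by (auto simp: list_colorings_def PiE_def)
      fix v assume v: "v \<in> A \<union> X"
      show "h v = k v"
      proof (cases "v \<in> A")
        case True
        then show ?thesis using hA[OF hk(1)] hA[OF hk(2)] c by simp
      next
        case False
        then have vX: "v \<in> X" using v by blast
        have "(\<lambda>x\<in>X. h x = (h a0 + 1) mod 3) = (\<lambda>x\<in>X. k x = (k a0 + 1) mod 3)"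
          using arg_cong[OF hk(3), of snd] by (simp only: snd_conv)
        from fun_cong[OF this, of v] have "(h v = (h a0 + 1) mod 3) = (k v = (h a0 + 1) mod 3)" using vX c by simp
        then show ?thesis using mod[of "h a0" "h v" "k v"] h3[OF hk(1)] h3[OF hk(2)] hX[OF hk(1) vX] hX[OF hk(2) vX] a0 v c
          by auto
      qed
    qed
  qed
  then have "card ?F = card (?h ` ?F)" by (simp add: card_image)
  also have "\<dots> \<le> card ({..<3::nat} \<times> two_colorings X E)"
  proof (rule card_mono)
    show "finite ({..<3::nat} \<times> two_colorings X E)" using finite_parts by (simp add: finite_two_colorings)
    show "?h ` ?F \<subseteq> {..<3} \<times> two_colorings X E"
    proof (rule image_subsetI)
      fix h assume h: "h \<in> ?F"
      have "(h u = (h a0 + 1) mod 3) \<noteq> (h v = (h a0 + 1) mod 3)" if uv: "u \<in> X" "v \<in> X" "{u, v} \<in> E" for u v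
      proof -
        have "h u \<noteq> h v" using h uv unfolding list_colorings_def by blast
        then show ?thesis using mod[of "h a0" "h u" "h v"] h3[OF h] hX[OF h] uv a0 by auto
      qed
      then have "(\<lambda>x\<in>X. h x = (h a0 + 1) mod 3) \<in> two_colorings X E" by (simp add: two_colorings_def)
      then show "?h h \<in> {..<3} \<times> two_colorings X E" using h3[OF h] a0 by auto
    qed
  qed
  finally show ?thesis by (simp add: card_cartesian_product)
qed

text \<open>Three layers are forgotten in turn: light vertices with factor \<open>K\<close>,
  isolated ones with factor 3 each, and the common colour of \<open>A\<close>.\<close>

lemma n1_le:
  assumes K: "ext_factor K"
  shows "n1 \<le> K * 3 ^ card I * (3 * card (two_colorings X E))"
proof -
  let ?F = "{g \<in> cols3 V E. monochrom g A}"
  let ?r = "\<lambda>W F. (\<lambda>g. restrict g W) ` F"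
  have "?F \<subseteq> cols3 V E" by (rule Collect_restrict)
  from K[unfolded ext_factor_def, rule_format, OF this]
  have 1: "card ?F \<le> K * card (?r (V - S) ?F)" .
  have 2: "card (?r (V - S) ?F) \<le> 3 ^ card I * card (?r (V - S - I) (?r (V - S) ?F))"
  proof (rule card_free_le)
    show "?r (V - S) ?F \<subseteq> cols3 (V - S) E" by (auto intro: restrict_list_colorings)
    show "I \<subseteq> V - S" using V dis by auto
  qed (use basic in auto)
  have 3: "?r (V - S - I) (?r (V - S) ?F) = ?r (A \<union> X) ?F"
  proof -
    have "V - S - I = A \<union> X" "(V - S) \<inter> (A \<union> X) = A \<union> X" using V dis by auto
    then show ?thesis by (simp add: image_image)
  qed
  have "card (?r (A \<union> X) ?F) \<le> card {h \<in> cols3 (A \<union> X) E. monochrom h A}"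
  proof (rule card_mono)
    show "finite {h \<in> cols3 (A \<union> X) E. monochrom h A}" using finite_parts by simp
    show "?r (A \<union> X) ?F \<subseteq> {h \<in> cols3 (A \<union> X) E. monochrom h A}"
    proof (rule image_subsetI)
      fix g assume g: "g \<in> ?F"
      then have "restrict g (A \<union> X) \<in> cols3 (A \<union> X) E" using subsets by (intro restrict_list_colorings[of _ V]) auto
      moreover have "monochrom (restrict g (A \<union> X)) A" using g by (auto simp: monochrom_def)
      ultimately show "restrict g (A \<union> X) \<in> {h \<in> cols3 (A \<union> X) E. monochrom h A}" by simp
    qed
  qed
  then have 4: "card (?r (A \<union> X) ?F) \<le> 3 * card (two_colorings X E)"
    using card_monochrom_two_colorings by (rule order.trans)
  have "card ?F \<le> K * (3 ^ card I * card (?r (A \<union> X) ?F))"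
    using order.trans[OF 1 mult_le_mono2[OF 2]] unfolding 3 .
  also have "\<dots> \<le> K * (3 ^ card I * (3 * card (two_colorings X E)))" by (intro mult_le_mono2 4)
  finally show ?thesis by (simp only: mult.assoc)
qed

lemma two_colorings_le: "card (two_colorings X E) \<le> 2 ^ card X"
proof -
  have "card (two_colorings X E) \<le> card (PiE X (\<lambda>_. UNIV :: bool set))"
    by (rule card_mono) (use finite_parts in \<open>auto simp: two_colorings_def intro!: finite_PiE\<close>)
  then show ?thesis using finite_parts by (simp add: card_PiE)
qed

lemma half_ext_factor:
  obtains s0 where "card S \<le> 2 * s0" "s0 \<le> card S" "ext_factor (2 ^ s0 * 3 ^ (card S - s0))"
proof -
  have irr: "{w, w} \<notin> E" for w using edgeD[of w w] by blast
  obtain T where T: "T \<subseteq> S" "card S \<le> 2 * card T" "\<And>w. w \<in> T \<Longrightarrow> \<exists>u\<in>V - T. {w, u} \<in> E"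
    using half_dominated[OF finite_parts(3) subsets(3) irr nonisolated] by metis
  show thesis
    by (rule that[of "card T"]) (use T ext_factor_dominated card_mono[OF finite_parts(3)] in auto)
qed

lemma ext_power: "s0 \<le> s \<Longrightarrow> real (2 ^ s0 * 3 ^ (s - s0)) = (2 / 3) ^ s0 * 3 ^ s"
  by (simp only: of_nat_mult of_nat_power of_nat_numeral) (simp add: power_diff power_divide)

end

section \<open>Exclusion of inner edges and classification of the light vertices\<close>

context extremal_graph
begin

text \<open>An edge inside \<open>X\<close> rules out colourings constant on \<open>X\<close>;
  almost all colourings are then constant on \<open>A\<close> and 2-colour \<open>X\<close>
  properly, which costs 2^j.\<close>

lemma inner_edges_impossible:
  assumes eA: "edges_in A E = {}" and eX: "edges_in X E \<noteq> {}"
  shows False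
proof -
  interpret num: numeric "card A" "card X" "card S" "card I" "card lightE" m n f by (rule numeric_params)
  let ?e = "card (edges_in X E)" and ?c2 = "card (two_colorings X E)"
  have n2: "n2 = 0"
    using inner_edge_not_mono[OF eX] finite_list_colorings[OF basic(1)] by (auto intro!: card_eq_0_iff[THEN iffD2])
  then have f1: "997 * f \<le> 1000 * real n1" using count by simp
  then have n1pos: "0 < n1" using f_pos by (cases "n1 = 0") auto
  obtain s0 where s0: "card S \<le> 2 * s0" "s0 \<le> card S" "ext_factor (2 ^ s0 * 3 ^ (card S - s0))"
    by (rule half_ext_factor)
  note n1le = n1_le[OF s0(3)]
  have c2pos: "0 < ?c2" using n1le n1pos by (cases "?c2 = 0") auto
  then have "two_colorings X E \<noteq> {}" by auto
  then obtain j where j: "?c2 * 2 ^ j \<le> 2 ^ card X" "4 * ?e \<le> (j + 1)\<^sup>2"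
    using card_two_colorings_le[OF basic(4) finite_parts(2)] by blast
  have jx: "j \<le> card X"
  proof -
    have "1 * 2 ^ j \<le> ?c2 * 2 ^ j" using c2pos by (intro mult_le_mono1) simp
    then have "(2::nat) ^ j \<le> 2 ^ card X" using j(1) by linarith
    then show ?thesis by (simp add: power_increasing_iff)
  qed
  have finE: "finite (edges_in X E)" using finite_parts by (auto simp: edges_in_def intro!: finite_subset[of _ "Pow X"])
  have e1: "1 \<le> ?e" using eX finE by (simp add: Suc_le_eq card_gt_0_iff)
  let ?R = "3 ^ (card S + card I) :: real"
  have main: "997 * f * 2 ^ j \<le> 3000 * 2 ^ card X * (2 / 3) ^ s0 * ?R"
  proof -
    have "real n1 \<le> real (2 ^ s0 * 3 ^ (card S - s0)) * 3 ^ card I * (3 * real ?c2)"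
      using of_nat_mono[OF n1le, where 'a=real] by simp
    then have "real n1 \<le> (2 / 3) ^ s0 * 3 ^ card S * 3 ^ card I * (3 * real ?c2)"
      unfolding ext_power[OF s0(2)] .
    then have "997 * f * 2 ^ j \<le> 1000 * ((2 / 3) ^ s0 * 3 ^ card S * 3 ^ card I * (3 * real ?c2)) * 2 ^ j"
      using f1 by (intro mult_right_mono) auto
    also have "\<dots> = 3000 * (2 / 3) ^ s0 * ?R * (real ?c2 * 2 ^ j)" by (simp add: power_add)
    also have "\<dots> \<le> 3000 * (2 / 3) ^ s0 * ?R * 2 ^ card X"
    proof (intro mult_left_mono)
      have "real (?c2 * 2 ^ j) \<le> real (2 ^ card X)" using j(1) by (rule of_nat_mono)
      then show "real ?c2 * 2 ^ j \<le> 2 ^ card X" by simp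
    qed simp
    finally show ?thesis by (simp only: mult_ac)
  qed
  \<comment> \<open>\<open>lowX\<close> limits the loss 2^j to about e^(L/2000), hence j \<le> 4 + L
    / 1000.\<close>
  have j100: "100 * j \<le> card A"
  proof -
    have si: "card V - card A - card X = card S + card I" using card_V basic(2) by simp
    have p: "(2 / 3 :: real) ^ s0 \<le> 1" by (intro power_le_one) auto
    have "997 * f * 2 ^ j \<le> 3000 * (2 ^ card X * ?R) * 1"
      by (rule order.trans[OF main]) (use p in \<open>simp add: mult_left_le mult_ac\<close>)
    also have "\<dots> \<le> 3000 * (f * exp (L / 2000))" using lowX unfolding si by simp
    finally have "f * (997 * 2 ^ j) \<le> f * (3000 * exp (L / 2000))" by (simp add: mult_ac)
    then have "997 * 2 ^ j \<le> 3000 * exp (L / 2000)" using f_pos by (simp only: mult_le_cancel_left_pos)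
    then have "2 ^ j \<le> 4 * exp (L / 2000)" using exp_gt_zero[of "L / 2000"] by linarith
    moreover have "(2::real)\<^sup>2 \<le> exp 1 ^ 2" using exp_ge_add_one_self[of 1] by (intro power_mono) auto
    then have "4 \<le> exp (2::real)" by (simp add: exp_of_nat_mult[symmetric])
    then have "4 * exp (L / 2000) \<le> exp 2 * exp (L / 2000)" by (intro mult_right_mono) auto
    ultimately have "2 ^ j \<le> exp (2 + L / 2000)" unfolding exp_add by linarith
    then have "exp (real j / 2) \<le> exp (2 + L / 2000)" using exp_half_le_power2[of j] by linarith
    then have "real j / 2 \<le> 2 + L / 2000" by (simp only: exp_le_cancel_iff)
    moreover have "100000000 \<le> L" using L by simp
    ultimately have "100 * real j \<le> L / 2" by argo
    also have "\<dots> \<le> real (card A)" by (rule sizeA)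
    finally have "real (100 * j) \<le> real (card A)" by simp
    then show ?thesis by (simp only: of_nat_le_iff)
  qed
  \<comment> \<open>Here the graph contains the complete bipartite graph on all of \<open>V\<close>,
    so every colouring is constant on a class, and by the inner edge that class is \<open>A\<close>.
    No 997/1000 enters.\<close>
  have f2: "f * 2 ^ j \<le> 3 * 2 ^ card X" if s: "card S = 0" and i: "card I = 0" and q: "q = 0"
  proof -
    have SI: "S = {}" "I = {}" using s i finite_parts by auto
    have bE: "bip A X \<subseteq> E" using q finite_parts by auto
    have "cols3 V E \<subseteq> {g \<in> cols3 V E. monochrom g A}"
    proof
      fix g assume g: "g \<in> cols3 V E"
      have gV: "g \<in> V \<rightarrow> {..<3}" using g by (auto simp: list_colorings_def)
      have d: "g u \<noteq> g v" if "u \<in> A" "v \<in> X" for u v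
      proof -
        have "{u, v} \<in> E" using bE that by (auto simp: bip_def)
        then show ?thesis by (rule colsD(2)[OF g])
      qed
      have "A \<noteq> {}" "X \<noteq> {}" using sizes by auto
      then have "(\<exists>c<3. \<forall>u\<in>A. g u = c) \<or> (\<exists>c<3. \<forall>u\<in>X. g u = c)"
        by (intro split_colorings_mono_cases[OF gV subsets(1,2) d])
      then have "monochrom g A" using inner_edge_not_mono[OF eX g] by (auto simp: monochrom_def)
      then show "g \<in> {g \<in> cols3 V E. monochrom g A}" using g by simp
    qed
    then have "card (cols3 V E) \<le> n1" by (rule card_mono[rotated]) (use basic in simp)
    also have "n1 \<le> 1 * 3 ^ card I * (3 * ?c2)"
    proof (rule n1_le)
      have "ext_factor (2 ^ card ({} :: 'a set) * 3 ^ (card S - card ({} :: 'a set)))"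
        by (rule ext_factor_dominated) auto
      then show "ext_factor 1" using s by simp
    qed
    finally have "card (cols3 V E) * 2 ^ j \<le> 3 * ?c2 * 2 ^ j" using i by simp
    also have "\<dots> \<le> 3 * 2 ^ card X" using j(1) by simp
    finally have "real (card (cols3 V E) * 2 ^ j) \<le> real (3 * 2 ^ card X)" by (rule of_nat_mono)
    then show ?thesis by simp
  qed
  show False
    using num.inner_edges_contradiction[OF edge_count[OF eA] e1 j(2) j100 jx s0(1) main] f2 by blast
qed

lemma count_bound:
  assumes K: "ext_factor K" "real K = (2 / 3) ^ s0 * 3 ^ card S"
  shows "997 * f \<le> 1000 * ((2 / 3) ^ s0 * 3 ^ (card S + card I) * (3 * 2 ^ card X + 3 * 2 ^ card A))"
proof -
  interpret sym: extremal_graph V E X A S I L m n by (rule extremal_swap)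
  have b: "real N \<le> (2 / 3) ^ s0 * 3 ^ (card S + card I) * (3 * 2 ^ y)"
    if "N \<le> K * 3 ^ card I * (3 * c)" "c \<le> 2 ^ y" for N c y
  proof -
    have "N \<le> K * 3 ^ card I * (3 * 2 ^ y)"
      by (rule order.trans[OF that(1)]) (intro mult_le_mono2 that(2))
    then have "real N \<le> real (K * 3 ^ card I * (3 * 2 ^ y))" by (rule of_nat_mono)
    also have "\<dots> = real K * 3 ^ card I * (3 * 2 ^ y)" by simp
    finally show ?thesis unfolding K(2) by (simp add: power_add mult_ac)
  qed
  have "real n1 \<le> (2 / 3) ^ s0 * 3 ^ (card S + card I) * (3 * 2 ^ card X)"
    by (rule b[OF n1_le[OF K(1)] two_colorings_le])
  moreover have "real n2 \<le> (2 / 3) ^ s0 * 3 ^ (card S + card I) * (3 * 2 ^ card A)"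
    by (rule b[OF sym.n1_le[OF K(1)] sym.two_colorings_le])
  moreover have "(2 / 3) ^ s0 * 3 ^ (card S + card I) * (3 * 2 ^ card X + 3 * 2 ^ card A) =
    (2 / 3) ^ s0 * 3 ^ (card S + card I) * (3 * 2 ^ card X) + (2 / 3) ^ s0 * 3 ^ (card S + card I) * (3 * 2 ^ card A :: real)"
    by (rule distrib_left)
  ultimately show ?thesis using count by argo
qed

text \<open>\<open>v\<close> is joined only to \<open>u\<close>. Either \<open>u\<close> has a
  neighbour outside and both lose a factor 2/3, or the two form an isolated edge with 6
  extensions.\<close>

lemma two_light_impossible:
  assumes eA: "edges_in A E = {}" and eX: "edges_in X E = {}" and ax: "card A \<le> card X"
    and S: "S = {u, v}" "u \<noteq> v" and v: "\<And>w. w \<in> V - S \<Longrightarrow> {v, w} \<notin> E"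
  shows False
proof -
  interpret num: numeric "card A" "card X" "card S" "card I" "card lightE" m n f by (rule numeric_params)
  have cS: "card S = 2" using S by simp
  have q: "m + q = card A * card X + card lightE" using edge_count[OF eA] eX by simp
  have uvV: "u \<in> V" "v \<in> V" using S subsets by auto
  obtain w where "w \<in> V" "{v, w} \<in> E" using nonisolated[of v] S by auto
  then have vu: "{v, u} \<in> E" using v[of w] S edgeD[of v w] by auto
  show False
  proof (cases "\<exists>w\<in>V - S. {u, w} \<in> E")
    case True
    \<comment> \<open>The only neighbour of \<open>v\<close> is itself in \<open>S\<close>, so
      \<open>S\<close> cannot be forgotten at once: first \<open>v\<close> with witness
      \<open>u\<close>, then \<open>u\<close> with a witness outside.\<close>
    have "ext_factor 4"
      unfolding ext_factor_def
    proof (intro allI impI)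
      fix F assume F: "F \<subseteq> cols3 V E"
      let ?r = "\<lambda>W F. (\<lambda>g. restrict g W) ` F"
      have 1: "card F \<le> 2 ^ card {v} * card (?r (V - {v}) F)"
        by (rule card_dominated_le[OF basic(1) _ _ F]) (use uvV vu S in auto)
      have 2: "card (?r (V - {v}) F) \<le> 2 ^ card {u} * card (?r (V - {v} - {u}) (?r (V - {v}) F))"
      proof (rule card_dominated_le)
        show "?r (V - {v}) F \<subseteq> cols3 (V - {v}) E" using F by (auto intro: restrict_list_colorings)
        show "\<exists>z\<in>V - {v} - {u}. {w, z} \<in> E" if "w \<in> {u}" for w using that True S by auto
      qed (use basic uvV S in auto)
      have 3: "?r (V - {v} - {u}) (?r (V - {v}) F) = ?r (V - S) F"
      proof -
        have "V - {v} - {u} = V - S" "(V - {v}) \<inter> (V - S) = V - S" using S by auto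
        then show ?thesis by (simp add: image_image)
      qed
      show "card F \<le> 4 * card (?r (V - S) F)"
        using order.trans[OF 1 mult_le_mono2[OF 2]] unfolding 3 by simp
    qed
    then show False
      by (intro num.many_light_contradiction[OF q ax _ _ _ count_bound[where ?s0.0=2 and K=4]])
         (use cS in \<open>auto simp: power2_eq_square\<close>)
  next
    case False
    have "lightE = {{u, v}}"
    proof
      show "{{u, v}} \<subseteq> lightE" using vu S by (auto simp: insert_commute)
      show "lightE \<subseteq> {{u, v}}"
      proof
        fix e assume e: "e \<in> lightE"
        then obtain y z where yz: "e = {y, z}" "y \<noteq> z" using edgeE by blast
        have E: "{y, z} \<in> E" "{z, y} \<in> E" using e yz by (auto simp: insert_commute)
        then have V: "y \<in> V" "z \<in> V" using edgeD by auto
        have "y \<in> S \<Longrightarrow> z \<in> S" using E V v[of z] False S by auto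
        moreover have "z \<in> S \<Longrightarrow> y \<in> S" using E V v[of y] False S by auto
        moreover have "y \<in> S \<or> z \<in> S" using e yz by auto
        ultimately show "e \<in> {{u, v}}" using yz S by auto
      qed
    qed
    then have d: "card lightE = 1" by simp
    have "ext_factor (2 ^ card {v} * 3 ^ (card S - card {v}))"
      by (rule ext_factor_dominated) (use S vu uvV in auto)
    then have "ext_factor 6" using cS by simp
    then show False
      using num.isolated_edge_contradiction[OF q[unfolded d] ax cS] count_bound[where ?s0.0=1 and K=6] cS by simp
  qed
qed

text \<open>Two or more light vertices are too expensive. With none, the graph lies in a complete
  bipartite graph with fewer than \<open>card A\<close> deletions; a single one either belongs to
  the larger side or is a pendant vertex.\<close>

lemma structure_bipartite:
  assumes eA: "edges_in A E = {}" and eX: "edges_in X E = {}" and ax: "card A \<le> card X"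
  shows "\<exists>a b. semi_complete_plus_isolated a b V E \<or> complete_bipartite_plus_pendant a b V E"
proof -
  interpret num: numeric "card A" "card X" "card S" "card I" "card lightE" m n f by (rule numeric_params)
  interpret sym: extremal_graph V E X A S I L m n by (rule extremal_swap)
  have q: "m + q = card A * card X + card lightE" using edge_count[OF eA] eX by simp
  have edge_cases: "e \<in> lightE \<or> e \<in> bip A X" if e: "e \<in> E" for e
  proof -
    obtain y z where yz: "e = {y, z}" using edgeE[OF e] by blast
    have "y \<in> A \<union> X \<union> S" "z \<in> A \<union> X \<union> S" using edgeD[of y z] e yz V by auto
    moreover have "\<not> (y \<in> A \<and> z \<in> A)" "\<not> (y \<in> X \<and> z \<in> X)" using eA eX e yz by (auto simp: edges_in_def)
    ultimately show ?thesis using e yz bip_iff[OF dis(1), of y z] by auto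
  qed
  have irr: "{w, w} \<notin> E" for w using edgeD[of w w] by blast
  consider "card S = 0" | "card S = 1" | "card S = 2" | "3 \<le> card S" by linarith
  then show ?thesis
  proof cases
    case 1
    then have "S = {}" using finite_parts by simp
    then have sub: "E \<subseteq> bip A X" using edge_cases by auto
    have d: "card lightE = 0" using \<open>S = {}\<close> by simp
    obtain s0 where s0: "s0 \<le> card S" "ext_factor (2 ^ s0 * 3 ^ (card S - s0))" by (rule half_ext_factor)
    then have "ext_factor 1" using 1 by simp
    then have "q < card A"
      using num.no_light_few_missing[of q] q d ax 1 count_bound[where ?s0.0=0 and K=1] by simp
    then show ?thesis using maximizer_star[OF mx subsets(1,2) dis(1) sub _ ax] by blast
  next
    case 2
    then obtain l where l: "S = {l}" by (auto simp: card_1_singleton_iff)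
    have lV: "l \<in> V" "l \<notin> A" "l \<notin> X" using l subsets dis by auto
    let ?NA = "{w \<in> A. {l, w} \<in> E}" and ?NX = "{w \<in> X. {l, w} \<in> E}"
    have lightE_eq: "lightE = (\<lambda>w. {l, w}) ` (?NA \<union> ?NX)"
    proof
      show "lightE \<subseteq> (\<lambda>w. {l, w}) ` (?NA \<union> ?NX)"
      proof
        fix e assume e: "e \<in> lightE"
        then obtain y z where yz: "e = {y, z}" "y \<noteq> z" using edgeE by blast
        then have "y = l \<or> z = l" using e l by auto
        then obtain w where w: "e = {l, w}" "w \<noteq> l" using yz by (auto simp: insert_commute)
        then have "w \<in> A \<union> X" using edgeD[of l w] e V l by auto
        then show "e \<in> (\<lambda>w. {l, w}) ` (?NA \<union> ?NX)" using w e by auto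
      qed
    qed (use l in auto)
    have finN: "finite ?NA" "finite ?NX" using finite_parts by auto
    have "inj_on (\<lambda>w. {l, w}) (?NA \<union> ?NX)" using lV by (auto simp: inj_on_def doubleton_eq_iff)
    then have "card lightE = card (?NA \<union> ?NX)" unfolding lightE_eq by (rule card_image)
    also have "\<dots> = card ?NA + card ?NX" by (rule card_Un_disjoint) (use finN dis in auto)
    finally have d: "card lightE = card ?NA + card ?NX" .
    obtain w0 where "w0 \<in> V" "{l, w0} \<in> E" using nonisolated[of l] l by auto
    then have "w0 \<in> V - {l}" "{l, w0} \<in> E" using irr by auto
    then have "ext_factor (2 ^ card {l} * 3 ^ (card S - card {l}))"
      by (intro ext_factor_dominated) (use l in auto)
    then have K: "ext_factor 2" using 2 by simp
    have f1: "997 * f \<le> 1000 * (2 / 3 * 3 ^ (card S + card I) * (3 * 2 ^ card X + 3 * 2 ^ card A))"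
      using count_bound[where ?s0.0=1 and K=2, OF K] 2 by simp
    then have f1': "997 * f \<le> 1000 * (2 * 3 ^ card I * (3 * 2 ^ card X + 3 * 2 ^ card A))" using 2 by simp
    note un = num.one_light_unbalanced[OF q ax 2 f1']
    note qd = num.one_light_few_missing[OF q 2 un f1']
    have n2: "real n2 \<le> 6 * 2 ^ card A * 3 ^ card I"
    proof -
      have "n2 \<le> 2 * 3 ^ card I * (3 * card (two_colorings A E))" by (rule sym.n1_le[OF K])
      also have "\<dots> \<le> 2 * 3 ^ card I * (3 * 2 ^ card A)" by (intro mult_le_mono2 sym.two_colorings_le)
      finally have "real n2 \<le> real (2 * 3 ^ card I * (3 * 2 ^ card A))" by (rule of_nat_mono)
      then show ?thesis by (simp add: mult_ac)
    qed
    \<comment> \<open>K_{a,x+1} has 6 * 2^x * 3^i colourings constant on the side \<open>a\<close>;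
      the threshold is three quarters of this and excludes all but the two admissible kinds of
      neighbourhood below.\<close>
    have not_bad: "\<not> real n1 \<le> 9 / 2 * 2 ^ card X * 3 ^ card I"
    proof
      assume "real n1 \<le> 9 / 2 * 2 ^ card X * 3 ^ card I"
      then have "997 * f \<le> 1000 * (9 / 2 * 2 ^ card X * 3 ^ card I + 6 * 2 ^ card A * 3 ^ card I)"
        using n2 count by argo
      then have "997 * f \<le> 1000 * (3 ^ card I * (9 / 2 * 2 ^ card X + 6 * 2 ^ card A))"
        by (simp add: algebra_simps)
      then show False by (rule num.one_light_bad_contradiction[OF q 2 un])
    qed
    obtain a0 where a0: "a0 \<in> A" using sizes(1) by fastforce
    have A3: "\<exists>c<3. \<forall>w\<in>A. g w = c" if "g \<in> cols3 V E" "monochrom g A" for g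
    proof -
      have "\<forall>w\<in>A. g w = g a0" using that(2) a0 by (auto simp: monochrom_def)
      moreover have "g a0 < 3" using colsD(1)[OF that(1)] a0 subsets by auto
      ultimately show ?thesis by blast
    qed
    have gX: "g w \<noteq> c" if h: "g \<in> cols3 V E" "\<forall>w\<in>A. g w = c" "w \<in> X" for g c w
    proof -
      obtain z where z: "z \<in> A" "{w, z} \<in> E" using nbX[OF h(3)] by blast
      then show ?thesis using colsD(2)[OF h(1) z(2)] h(2) by auto
    qed
    \<comment> \<open>Split by whether the light vertex repeats the colour of \<open>A\<close>: any
      neighbour in \<open>A\<close> empties \<open>?F1\<close>, and each neighbour in
      \<open>X\<close> halves \<open>?F2\<close>.\<close>
    let ?F1 = "{g \<in> cols3 V E. \<exists>c<3. (\<forall>w\<in>A. g w = c) \<and> g l = c}"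
    let ?F2 = "{g \<in> cols3 V E. \<exists>c<3. (\<forall>w\<in>A. g w = c) \<and> g l \<noteq> c}"
    have n1_split: "n1 \<le> card ?F1 + card ?F2"
    proof -
      have "{g \<in> cols3 V E. monochrom g A} \<subseteq> ?F1 \<union> ?F2" using A3 by blast
      then have "n1 \<le> card (?F1 \<union> ?F2)" by (rule card_mono[rotated]) (use basic in simp)
      then show ?thesis using card_Un_le[of ?F1 ?F2] by linarith
    qed
    have F1: "card ?F1 \<le> 3 * (2 ^ card X * 3 ^ card I)"
    proof -
      let ?T = "\<lambda>c w. if w \<in> insert l A then {c} else if w \<in> X then {..<3} - {c} else {..<3::nat}"
      have "?F1 \<subseteq> (\<Union>c<3. PiE V (?T c))"
      proof
        fix g assume "g \<in> ?F1"
        then obtain c where g: "g \<in> cols3 V E" and c: "c < 3" "\<forall>w\<in>A. g w = c" "g l = c" by blast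
        have "g \<in> PiE V (?T c)"
          by (rule PiE_I) (use g c colsD(1)[OF g] gX[OF g c(2)] in \<open>auto simp: list_colorings_def\<close>)
        then show "g \<in> (\<Union>c<3. PiE V (?T c))" using c by blast
      qed
      moreover have cT: "card (PiE V (?T c)) = 2 ^ card X * 3 ^ card I" if "c < 3" for c
      proof -
        have "card (PiE V (?T c)) = 1 ^ card (insert l A) * 2 ^ card X * 3 ^ (card V - card (insert l A) - card X)"
        proof (rule card_PiE_classes[OF basic(1)])
          show "card (?T c w) = 2" if "w \<in> X" for w
          proof -
            have "w \<notin> insert l A" using that lV dis by auto
            then show ?thesis using that \<open>c < 3\<close> by simp
          qed
        qed (use subsets lV dis in auto)
        moreover have "card V - card (insert l A) - card X = card I"
          using card_V basic(2) 2 finite_parts lV by simp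
        ultimately show ?thesis by simp
      qed
      ultimately have "card ?F1 \<le> card (\<Union>c<3. PiE V (?T c))"
        by (intro card_mono finite_UN_I finite_PiE basic(1)) auto
      also have "\<dots> \<le> (\<Sum>c<3. card (PiE V (?T c)))" by (rule card_UN_le) simp
      also have "\<dots> = 3 * (2 ^ card X * 3 ^ card I)" using cT by simp
      finally show ?thesis .
    qed
    have F2: "card ?F2 \<le> 6 * (2 ^ (card X - card P) * 3 ^ card I)" if P: "P \<subseteq> ?NX" for P
    proof -
      let ?T = "\<lambda>(c, e) w. if w \<in> A then {c} else if w = l then {e} else if w \<in> P then {3 - c - e}
        else if w \<in> X then {..<3} - {c} else {..<3::nat}"
      have fP: "finite P" "P \<subseteq> X" using P finN finite_subset by auto
      have "?F2 \<subseteq> (\<Union>ce\<in>color_pairs. PiE V (?T ce))"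
      proof
        fix g assume "g \<in> ?F2"
        then obtain c where g: "g \<in> cols3 V E" and c: "c < 3" "\<forall>w\<in>A. g w = c" "g l \<noteq> c" by blast
        have ce: "(c, g l) \<in> color_pairs" using c colsD(1)[OF g lV(1)] by (auto simp: color_pairs_def)
        have gP: "g w = 3 - c - g l" if "w \<in> P" for w
        proof -
          have "w \<in> X" "{l, w} \<in> E" using that P by auto
          then have "g w \<noteq> c" "g w \<noteq> g l" "g w < 3"
            using gX[OF g c(2)] colsD(2)[OF g, of l w] colsD(1)[OF g, of w] subsets by auto
          then show ?thesis using c colsD(1)[OF g lV(1)] by linarith
        qed
        have "g \<in> PiE V (?T (c, g l))"
        proof (rule PiE_I)
          show "g w \<in> ?T (c, g l) w" if "w \<in> V" for w
            using c gP colsD(1)[OF g that] gX[OF g c(2)] by simp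
          show "g w = undefined" if "w \<notin> V" for w using that g by (auto simp: list_colorings_def)
        qed
        then show "g \<in> (\<Union>ce\<in>color_pairs. PiE V (?T ce))" using ce by blast
      qed
      moreover have cT: "card (PiE V (?T ce)) = 2 ^ (card X - card P) * 3 ^ card I" if ce: "ce \<in> color_pairs" for ce
      proof -
        obtain c e where ce': "ce = (c, e)" by (metis prod.exhaust)
        have c3: "c < 3" using ce ce' by (auto simp: color_pairs_def)
        have "card (PiE V (?T (c, e))) = 1 ^ card (insert l A \<union> P) * 2 ^ card (X - P) *
            3 ^ (card V - card (insert l A \<union> P) - card (X - P))"
        proof (rule card_PiE_classes[OF basic(1)])
          show "card (?T (c, e) w) = 2" if "w \<in> X - P" for w
          proof -
            have "w \<notin> A" "w \<noteq> l" "w \<notin> P" "w \<in> X" using that lV dis by auto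
            then show ?thesis using c3 by simp
          qed
        qed (use subsets lV dis fP in auto)
        moreover have "card (insert l A \<union> P) = Suc (card A + card P)"
        proof -
          have "card (insert l A \<union> P) = card (insert l A) + card P"
            by (rule card_Un_disjoint) (use finite_parts fP lV dis in auto)
          then show ?thesis using finite_parts lV by simp
        qed
        moreover have "card (X - P) = card X - card P" "card P \<le> card X"
          using fP finite_parts by (simp_all add: card_Diff_subset card_mono)
        moreover have "card V = card A + card X + 1 + card I" using card_V basic(2) 2 by simp
        ultimately show ?thesis unfolding ce' by simp
      qed
      moreover have fin_cp: "finite color_pairs" by (simp add: color_pairs_def)
      ultimately have "card ?F2 \<le> card (\<Union>ce\<in>color_pairs. PiE V (?T ce))"
        by (intro card_mono finite_UN_I finite_PiE basic(1)) (auto split: prod.splits)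
      also have "\<dots> \<le> (\<Sum>ce\<in>color_pairs. card (PiE V (?T ce)))" by (rule card_UN_le[OF fin_cp])
      also have "\<dots> = 6 * (2 ^ (card X - card P) * 3 ^ card I)" using cT card_color_pairs by simp
      finally show ?thesis .
    qed
    have x2: "2 \<le> card X" using sizes by linarith
    \<comment> \<open>With neighbours on both sides only half of \<open>?F2\<close> remains, 3 * 2^x
      instead of 6 * 2^x.\<close>
    have one_side: "?NA = {} \<or> ?NX = {}"
    proof (rule ccontr)
      assume "\<not> ?thesis"
      then obtain y z where yz: "y \<in> ?NA" "z \<in> ?NX" by blast
      have "?F1 = {}"
      proof (rule ccontr)
        assume "?F1 \<noteq> {}"
        then obtain g c where "g \<in> cols3 V E" "\<forall>w\<in>A. g w = c" "g l = c" by blast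
        then show False using colsD(2)[of g l y] yz by auto
      qed
      then have "card ?F1 = 0" by (simp only: card.empty)
      moreover have "card ?F2 \<le> 6 * (2 ^ (card X - 1) * 3 ^ card I)" using F2[of "{z}"] yz by simp
      ultimately have "n1 \<le> 6 * (2 ^ (card X - 1) * 3 ^ card I)" using n1_split by linarith
      then have "real n1 \<le> real (6 * (2 ^ (card X - 1) * 3 ^ card I))" by (rule of_nat_mono)
      also have "\<dots> = 3 * 2 ^ card X * 3 ^ card I"
        using x2 power_Suc[of "2::real" "card X - 1"] by simp
      finally have "real n1 \<le> 3 * 2 ^ card X * 3 ^ card I" .
      moreover have "3 * 2 ^ card X * 3 ^ card I \<le> 9 / 2 * 2 ^ card X * (3::real) ^ card I"
        by (intro mult_right_mono) auto
      ultimately show False using not_bad by linarith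
    qed
    \<comment> \<open>Two neighbours in \<open>X\<close> leave 3 + 6/4 = 9/2, exactly the excluded
      threshold.\<close>
    have NX1: "card ?NX \<le> 1"
    proof (rule ccontr)
      assume "\<not> ?thesis"
      then obtain P where P: "P \<subseteq> ?NX" "card P = 2"
        using obtain_subset_with_card_n[of 2 ?NX] by auto
      have "n1 \<le> 3 * (2 ^ card X * 3 ^ card I) + 6 * (2 ^ (card X - 2) * 3 ^ card I)"
        using n1_split F1 F2[OF P(1), unfolded P(2)] by linarith
      then have "real n1 \<le> real (3 * (2 ^ card X * 3 ^ card I) + 6 * (2 ^ (card X - 2) * 3 ^ card I))"
        by (rule of_nat_mono)
      also have "\<dots> = 9 / 2 * 2 ^ card X * 3 ^ card I"
      proof -
        have "card X = 2 + (card X - 2)" using x2 by simp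
        then have "(2::real) ^ card X = 2 ^ (2 + (card X - 2))" by (rule arg_cong)
        then have "(2::real) ^ card X = 4 * 2 ^ (card X - 2)" unfolding power_add by simp
        then show ?thesis by simp
      qed
      finally show False using not_bad by simp
    qed
    show ?thesis
    proof (cases "?NX = {}")
      case True
      \<comment> \<open>The light vertex joins the larger side. It adds \<open>card A - d\<close>
        missing pairs to \<open>q\<close>, and q < d keeps the total below
        \<open>card A\<close>.\<close>
      let ?X = "insert l X"
      have dis': "A \<inter> ?X = {}" using dis lV by auto
      have sub: "E \<subseteq> bip A ?X"
      proof
        fix e assume "e \<in> E"
        then consider "e \<in> lightE" | "e \<in> bip A X" using edge_cases by blast
        then show "e \<in> bip A ?X"
        proof cases
          case 1
          then obtain w where w: "e = {l, w}" "w \<in> A" unfolding lightE_eq using True by auto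
          then show ?thesis using bip_iff[OF dis', of l w] by simp
        qed (auto simp: bip_def)
      qed
      have cX: "card ?X = card X + 1" using finite_parts lV by simp
      have fb: "finite (bip A ?X)" using finite_parts by simp
      have "card (bip A ?X - E) = card A * (card X + 1) - m"
        using card_Diff_subset[OF finite_subset[OF sub fb] sub] card_bip[OF dis'] cX basic(3) by simp
      moreover have "card lightE \<le> card A" using light_edges 2 by simp
      moreover have "m + q = card A * card X + card lightE" by (rule q)
      ultimately have "card (bip A ?X - E) < card A" using qd sizes(1) by simp
      then show ?thesis using maximizer_star[OF mx subsets(1) _ dis' sub] subsets lV ax cX by fastforce
    next
      case False
      then have NA: "?NA = {}" using one_side by blast
      have "card ?NX \<noteq> 0" unfolding card_0_eq[OF finN(2)] by (rule False)
      then have "card ?NX = 1" using NX1 by linarith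
      then obtain u where u: "?NX = {u}" by (auto simp: card_1_singleton_iff)
      have d1: "card lightE = 1" using d NA u by simp
      have q0: "q = 0" using qd d1 by simp
      have lE: "lightE = {{l, u}}" unfolding lightE_eq NA u by simp
      \<comment> \<open>An isolated vertex together with the light one would be two spare vertices,
        so the pendant shape fills all of \<open>V\<close>.\<close>
      have i0: "card I = 0"
      proof (rule ccontr)
        assume "card I \<noteq> 0"
        then show False using num.pendant_spare_contradiction[OF _ ax _ f1] q q0 d1 2 by simp
      qed
      have "bip A X - E = {}" using q0 finite_parts by (simp add: card_eq_0_iff)
      then have E: "E = insert {u, l} (bip A X)"
        using edge_cases lE by (auto simp: insert_commute)
      have "complete_bipartite_plus_pendant (card A) (card X) V E"
        unfolding complete_bipartite_plus_pendant_def complete_bipartite_def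
      proof (intro conjI exI)
        show "1 \<le> card A" using sizes by simp
        show "card A \<le> card X" by (rule ax)
        show "finite A" "finite X" "A \<inter> X = {}" using finite_parts dis by auto
        show "A \<union> X = A \<union> X" "card A = card A" "card X = card X" by (rule refl)+
        show "bip A X = {{x, y} |x y. x \<in> A \<and> y \<in> X}" by (rule bip_def)
        show "u \<in> A \<union> X" using u by auto
        show "l \<notin> A \<union> X" using lV by auto
        show "V = insert l (A \<union> X)" using V l i0 finite_parts by auto
        show "E = insert {u, l} (bip A X)" by (rule E)
      qed
      then show ?thesis by blast
    qed
  next
    case 3
    then obtain u v where uv: "S = {u, v}" "u \<noteq> v" by (auto simp: card_2_iff)
    show ?thesis
    proof (cases "\<forall>y\<in>S. \<exists>w\<in>V - S. {y, w} \<in> E")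
      case True
      have "ext_factor (2 ^ card S * 3 ^ (card S - card S))"
        by (rule ext_factor_dominated) (use True in auto)
      then have K: "ext_factor 4" using 3 by simp
      have False
        by (rule num.many_light_contradiction[OF q ax _ _ _ count_bound[where ?s0.0=2, OF K]])
           (use 3 in \<open>auto simp: power2_eq_square\<close>)
      then show ?thesis by blast
    next
      case False
      then obtain y where y: "y \<in> S" "\<And>w. w \<in> V - S \<Longrightarrow> {y, w} \<notin> E" by blast
      then have "y = u \<or> y = v" using uv by blast
      then have False
      proof
        assume "y = v"
        then show False using two_light_impossible[OF eA eX ax uv] y by blast
      next
        assume "y = u"
        moreover have "S = {v, u}" "v \<noteq> u" using uv by auto
        ultimately show False using two_light_impossible[OF eA eX ax, of v u] y by blast
      qed
      then show ?thesis by blast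
    qed
  next
    case 4
    obtain s0 where s0: "card S \<le> 2 * s0" "s0 \<le> card S" "ext_factor (2 ^ s0 * 3 ^ (card S - s0))"
      by (rule half_ext_factor)
    have False
      by (rule num.many_light_contradiction[OF q ax _ s0(2,1) count_bound[OF s0(3) ext_power[OF s0(2)]]])
         (use 4 s0 in linarith)
    then show ?thesis by blast
  qed
qed

text \<open>Inner edges in both classes would leave no colouring constant on a class. So one class
  is free of them, and then \<open>inner_edges_impossible\<close> frees the other.\<close>

theorem extremal_structure:
  "\<exists>a b. semi_complete_plus_isolated a b V E \<or> complete_bipartite_plus_pendant a b V E"
proof -
  interpret sym: extremal_graph V E X A S I L m n by (rule extremal_swap)
  have "edges_in A E = {} \<or> edges_in X E = {}"
  proof (rule ccontr)
    assume "\<not> ?thesis"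
    then have "{g \<in> cols3 V E. monochrom g A} = {}" "{g \<in> cols3 V E. monochrom g X} = {}"
      using inner_edge_not_mono by blast+
    then have "n1 = 0" "n2 = 0" by (simp_all only: card.empty)
    then show False using count f_pos by simp
  qed
  then have e: "edges_in A E = {}" "edges_in X E = {}"
    using inner_edges_impossible sym.inner_edges_impossible by blast+
  show ?thesis
  proof (cases "card A \<le> card X")
    case True
    then show ?thesis by (rule structure_bipartite[OF e])
  next
    case False
    then show ?thesis by (intro sym.structure_bipartite e) simp
  qed
qed

end

section \<open>Approximate structure of maximisers\<close>

lemma ln_4_3: "1 / 4 \<le> lp - 2 * lr"
proof -
  have "ln (3/4) \<le> (3/4 :: real) - 1" by (rule ln_le_minus_one) simp
  moreover have "lp - 2 * lr = - ln (3 / 4 :: real)"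
  proof -
    have "2 * lr = ln ((3/2) ^ 2)" by (subst ln_realpow) simp_all
    also have "\<dots> = ln (3 * (3/4))" by (simp add: power2_eq_square)
    also have "\<dots> = lp + ln (3 / 4)" by (subst ln_mult) simp_all
    finally show ?thesis by simp
  qed
  ultimately show ?thesis by simp
qed

lemma cost_center_le:
  assumes c: "center m n \<alpha>" and m: "m > 0" "4 * m \<le> n\<^sup>2" and n: "n > 0"
  shows "sqrt m / 2 \<le> \<alpha>" "\<alpha> \<le> sqrt m" "m / \<alpha> \<le> 2 * sqrt m" "sqrt m \<le> m / \<alpha>" "cost m \<alpha> \<le> 5 / 2 * sqrt m"
proof -
  show 1: "sqrt m / 2 \<le> \<alpha>" "\<alpha> \<le> sqrt m"
    using center_props[OF c m n] sparse_opt_bounds(3)[OF m(1)] by linarith+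
  have L: "sqrt m > 0" "sqrt m * sqrt m = m" using m by simp_all
  then have \<alpha>: "\<alpha> > 0" using 1 by linarith
  have "m \<le> 2 * sqrt m * \<alpha>"
  proof -
    have "sqrt m * (sqrt m / 2) \<le> sqrt m * \<alpha>" using 1 L by (intro mult_left_mono) auto
    then show ?thesis using L by simp
  qed
  then show 2: "m / \<alpha> \<le> 2 * sqrt m" using \<alpha> by (simp add: field_simps)
  have "sqrt m * \<alpha> \<le> sqrt m * sqrt m" using 1 L by (intro mult_left_mono) auto
  then show "sqrt m \<le> m / \<alpha>" using \<alpha> L by (simp add: field_simps)
  have "\<alpha> * lp \<le> sqrt m * (3 / 2)" using 1 log_bounds L \<alpha> by (intro mult_mono) auto
  moreover have "lr * (m / \<alpha>) \<le> 1 / 2 * (2 * sqrt m)" using 2 log_bounds L \<alpha> m by (intro mult_mono) auto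
  moreover have "cost m \<alpha> = \<alpha> * lp + lr * (m / \<alpha>)" by (simp add: cost_def)
  ultimately show "cost m \<alpha> \<le> 5 / 2 * sqrt m" by linarith
qed

text \<open>Here \<open>x\<^sub>i\<close> counts the vertices with list \<open>{i}\<close>, \<open>y\<^sub>i\<close> those with the complementary list, and \<open>z\<close>
  those with all three colours. Replacing \<open>x\<^sub>1, x\<^sub>2 + x\<^sub>3, y\<^sub>1 + y\<^sub>2 + y\<^sub>3\<close> by the bipartite profile with
  smaller side \<open>x\<^sub>1 + (x\<^sub>2 + x\<^sub>3) / 2\<close> does not lose edges and saves cost.\<close>

lemma profile_stability:
  fixes m n L \<alpha> x1 x2 x3 y1 y2 y3 z d \<kappa> T :: real
  assumes c: "center m n \<alpha>" and m: "m > 0" "4 * m \<le> n\<^sup>2" and n: "n > 0" and L: "L = sqrt m"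
    and nn: "0 \<le> x2" "0 \<le> x3" "0 \<le> y1" "0 \<le> y2" "0 \<le> y3" "0 \<le> z" "x2 \<le> x1" "x3 \<le> x1"
    and sum: "x1 + x2 + x3 + y1 + y2 + y3 + z \<le> n"
    and edges: "m \<le> x1 * (x2 + x3) + x2 * x3 + x1 * y1 + x2 * y2 + x3 * y3 + d"
    and d: "0 \<le> d" "2 * sqrt d \<le> \<kappa>"
    and cst: "(x1 + x2 + x3) * lp + (y1 + y2 + y3) * lr + z * lr / 2 \<le> cost m \<alpha> + \<kappa>"
    and \<kappa>: "0 < \<kappa>" "\<kappa> * L = T\<^sup>2 / 100" "\<kappa> \<le> T / 100000" and T: "0 < T" "T \<le> L / 1000"
  shows "\<bar>x1 - \<alpha>\<bar> \<le> T" "x2 + x3 + y2 + y3 + z \<le> T" "m / \<alpha> - 6 * T \<le> y1" "y1 \<le> m / \<alpha> + 4 * T"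
    "x1 * (x2 + x3) + x2 * x3 + x2 * y2 + x3 * y3 + d \<le> 8 * T * L" "x1 * y1 \<le> m + 12 * T * L"
proof -
  note al = cost_center_le[OF c m n, folded L]
  have L0: "L > 0" "L * L = m" using m L by simp_all
  then have \<alpha>: "\<alpha> > 0" using al by linarith
  have p: "1 \<le> lp" "lp \<le> 3 / 2" "1 / 3 \<le> lr" "lr \<le> 1 / 2" "lp \<le> 3 * lr" "1 / 2 \<le> lp - lr" "1 / 4 \<le> lp - 2 * lr"
    using log_bounds ln_4_3 by linarith+
  have \<kappa>L: "\<kappa> \<le> L / 100000000" using \<kappa> T by linarith
  define R where "R = x2 + x3"
  define Y where "Y = y1 + y2 + y3"
  define H where "H = x1 + R / 2"
  \<comment> \<open>\<open>Q\<close> counts the edges lost because the vertices of \<open>y2\<close>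
    and \<open>y3\<close> face the smaller classes \<open>x2\<close> and \<open>x3\<close> instead
    of \<open>x1\<close>.\<close>
  define Q where "Q = (x1 - x2) * y2 + (x1 - x3) * y3"
  have R0: "0 \<le> R" "R \<le> 2 * x1" and Y0: "0 \<le> Y" and Q0: "0 \<le> Q" and x10: "0 \<le> x1"
    using nn by (auto simp: R_def Y_def Q_def)
  have key1: "m + Q - d \<le> x1 * R + R\<^sup>2 / 4 + x1 * Y"
  proof -
    have "x2 * x3 \<le> R\<^sup>2 / 4" unfolding R_def using zero_le_power2[of "x2 - x3"]
      by (simp add: power2_eq_square algebra_simps)
    moreover have "x1 * (x2 + x3) + x2 * x3 + x1 * y1 + x2 * y2 + x3 * y3 = x1 * R + x2 * x3 + x1 * Y - Q"
      unfolding R_def Y_def Q_def by (simp add: algebra_simps)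
    ultimately show ?thesis using edges by linarith
  qed
  have d4: "d \<le> \<kappa>\<^sup>2 / 4"
  proof -
    have "(2 * sqrt d)\<^sup>2 \<le> \<kappa>\<^sup>2" using d by (intro power_mono) auto
    then show ?thesis using d by (simp add: power_mult_distrib)
  qed
  have "\<kappa> * \<kappa> \<le> \<kappa> * (L / 100000000)" using \<kappa>L \<kappa> by (intro mult_left_mono) auto
  then have "\<kappa> * \<kappa> \<le> \<kappa> * L / 100000000" by simp
  moreover have "d \<le> \<kappa> * \<kappa> / 4" using d4 by (simp add: power2_eq_square)
  moreover have "0 \<le> \<kappa> * L" using \<kappa> L0 by simp
  ultimately have dL: "d \<le> \<kappa> * L / 100" by argo
  have "\<kappa> * L \<le> L * L" using \<kappa>L L0 by (intro mult_right_mono) auto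
  then have dm: "d \<le> m / 100" using dL L0 by linarith
  have cost0: "(x1 + R) * lp + Y * lr + z * lr / 2 \<le> cost m \<alpha> + \<kappa>"
    using cst by (simp add: R_def Y_def add.assoc)
  have HY: "m + Q - d \<le> H * (Y + R)"
  proof -
    have "0 \<le> R * Y / 2 + R\<^sup>2 / 4" using R0 Y0 by simp
    moreover have "H * (Y + R) = x1 * R + R\<^sup>2 / 4 + x1 * Y + (R * Y / 2 + R\<^sup>2 / 4)"
      by (simp add: H_def power2_eq_square field_simps)
    ultimately show ?thesis using key1 by linarith
  qed
  have H0: "0 \<le> H" using x10 R0 by (simp add: H_def)
  have YR: "Y + R \<le> 8 * L"
  proof -
    have "Y * (1 / 3) \<le> Y * lr" "R * 1 \<le> R * lp" using p Y0 R0 by (intro mult_left_mono; simp)+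
    moreover have "0 \<le> x1 * lp" "0 \<le> z * lr" using p x10 nn by simp_all
    moreover have "(x1 + R) * lp = x1 * lp + R * lp" by (simp add: algebra_simps)
    ultimately have "Y / 3 + R \<le> 5 / 2 * L + \<kappa>" using cost0 al(5) by argo
    then show ?thesis using R0 \<kappa>L L0 by argo
  qed
  have HL: "L / 10 \<le> H"
  proof -
    have "99 / 100 * m \<le> H * (8 * L)" using HY dm Q0 mult_left_mono[OF YR H0] by linarith
    then have "99 / 100 * L * L \<le> H * 8 * L" using L0 by (simp add: mult.assoc)
    then have "99 / 100 * L \<le> H * 8" using L0 by (simp only: mult_le_cancel_right_pos)
    then show ?thesis using L0 by argo
  qed
  then have Hpos: "H > 0" using L0 by linarith
  have key2: "H * lp + lr * ((m + Q - d) / H) + R / 8 + z / 6 \<le> cost m \<alpha> + \<kappa>"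
    and cond: "m - d \<le> H * (n - H) \<or> m - d \<le> H\<^sup>2"
  proof -
    have zz: "z / 6 \<le> z * lr / 2" using mult_left_mono[OF p(3) nn(6)] by simp
    \<comment> \<open>The side opposite \<open>H\<close> has size Y + R / 2, which fits into
      \<open>n\<close>, if x1 \<le> Y; otherwise it is bounded by Y + R, and the constraint becomes
      m - d \<le> H^2. Saving R lp / 2 outweighs the added lr R / 2 or lr R by at least R /
      8.\<close>
    have "H * lp + lr * ((m + Q - d) / H) + R / 8 \<le> (x1 + R) * lp + Y * lr \<and> (m - d \<le> H * (n - H) \<or> m - d \<le> H\<^sup>2)"
    proof (cases "x1 \<le> Y")
      case True
      have "R * x1 \<le> R * Y" using True R0 by (intro mult_left_mono)
      moreover have "H * (Y + R / 2) = x1 * R + R\<^sup>2 / 4 + x1 * Y + (R * Y - R * x1) / 2"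
        by (simp add: H_def power2_eq_square field_simps)
      moreover have "x1 * R + R\<^sup>2 / 4 + x1 * Y + 0 \<le> x1 * R + R\<^sup>2 / 4 + x1 * Y + (R * Y - R * x1) / 2"
        using calculation(1) by (intro add_left_mono) simp
      ultimately have le: "m + Q - d \<le> H * (Y + R / 2)" using key1 by (metis add.right_neutral order.trans)
      then have "(m + Q - d) / H \<le> Y + R / 2" using Hpos by (simp add: field_simps)
      then have "lr * ((m + Q - d) / H) \<le> lr * (Y + R / 2)" using p by (intro mult_left_mono) auto
      moreover have "R * (1 / 2) \<le> R * (lp - lr)" using p R0 by (intro mult_left_mono)
      ultimately have 1: "H * lp + lr * ((m + Q - d) / H) + R / 8 \<le> (x1 + R) * lp + Y * lr"
        using R0 unfolding H_def by (simp add: algebra_simps)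
      have "Y + R / 2 \<le> n - H" using sum nn(6) unfolding H_def R_def Y_def by argo
      then have "H * (Y + R / 2) \<le> H * (n - H)" using H0 by (intro mult_left_mono)
      then show ?thesis using 1 le Q0 by linarith
    next
      case False
      have "(m + Q - d) / H \<le> Y + R" using HY Hpos by (simp add: field_simps)
      then have "lr * ((m + Q - d) / H) \<le> lr * (Y + R)" using p by (intro mult_left_mono) auto
      moreover have "R * (1 / 4) \<le> R * (lp - 2 * lr)" using p R0 by (intro mult_left_mono)
      ultimately have 1: "H * lp + lr * ((m + Q - d) / H) + R / 8 \<le> (x1 + R) * lp + Y * lr"
        unfolding H_def by (simp add: algebra_simps)
      have "x1 * Y \<le> x1 * x1" using False x10 by (intro mult_left_mono) auto
      moreover have "H\<^sup>2 = x1 * R + R\<^sup>2 / 4 + x1 * x1" by (simp add: H_def power2_eq_square field_simps)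
      ultimately show ?thesis using 1 key1 Q0 by linarith
    qed
    then show "H * lp + lr * ((m + Q - d) / H) + R / 8 + z / 6 \<le> cost m \<alpha> + \<kappa>"
      "m - d \<le> H * (n - H) \<or> m - d \<le> H\<^sup>2" using cost0 zz by linarith+
  qed
  note st = cost_stability[OF c m n Hpos d(1) cond]
  have "lr * (d / H) \<le> \<kappa>"
  proof -
    have "0 \<le> \<kappa> * L" using \<kappa>(1) L0(1) by (simp only: mult_nonneg_nonneg less_imp_le)
    then have "d \<le> \<kappa> * L / 10" using dL by linarith
    then have "d \<le> \<kappa> * (L / 10)" by simp
    also have "\<dots> \<le> \<kappa> * H" using HL \<kappa> by (intro mult_left_mono) auto
    finally have "d / H \<le> \<kappa>" using Hpos by (simp add: field_simps)
    moreover have "0 \<le> d / H" using d Hpos by simp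
    ultimately show ?thesis using mult_mono[of lr 1 "d / H" \<kappa>] p by simp
  qed
  moreover have "lr * ((m + Q - d) / H) = lr * m / H + lr * (Q / H) - lr * (d / H)"
    by (simp add: add_divide_distrib diff_divide_distrib distrib_left right_diff_distrib)
  ultimately have key3: "cost m H + lr * (Q / H) + R / 8 + z / 6 \<le> cost m \<alpha> + 2 * \<kappa>"
    using key2 unfolding cost_def by linarith
  have "lp * sqrt d \<le> 3 / 2 * sqrt d" using p d by (intro mult_right_mono) auto
  then have "lp * sqrt d \<le> \<kappa>" using d real_sqrt_ge_zero[OF d(1)] by linarith
  \<comment> \<open>All linear deviations, \<open>Q / H\<close>, \<open>R\<close> and
    \<open>z\<close>, are now of order \<kappa>. The deviation of \<open>H\<close> costs only
    quadratically, so it is bounded by the larger \<open>T\<close>, with T^2 a multiple of \<kappa>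
    L.\<close>
  then have key4: "lr * (Q / H) + R / 8 + z / 6 \<le> 3 * \<kappa>" using key3 st(1) by linarith
  have QH: "0 \<le> Q / H" using Q0 Hpos by simp
  have "1 / 3 * (Q / H) \<le> lr * (Q / H)" using p QH by (intro mult_right_mono)
  then have QR: "Q / H \<le> 9 * \<kappa>" "R \<le> 24 * \<kappa>" "z \<le> 18 * \<kappa>" using key4 QH R0 nn(6) by argo+
  have H3: "H \<le> 3 * L"
  proof -
    have "H * 1 \<le> H * lp" using p H0 by (intro mult_left_mono)
    moreover have "0 \<le> lr * m / H" using p m Hpos by simp
    ultimately have "H \<le> cost m H" unfolding cost_def by linarith
    moreover have "cost m H \<le> cost m \<alpha> + 2 * \<kappa>"
    proof -
      have "0 \<le> lr * (Q / H)" using mult_nonneg_nonneg[OF _ QH, of lr] p by linarith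
      then show ?thesis using key3 R0 nn(6) by argo
    qed
    ultimately show ?thesis using al(5) \<kappa>L L0 by argo
  qed
  have cH: "cost m H - cost m \<alpha> \<le> 2 * \<kappa>"
  proof -
    have "0 \<le> lr * (Q / H)" using mult_nonneg_nonneg[OF _ QH, of lr] p by linarith
    then show ?thesis using key3 R0 nn(6) by argo
  qed
  have "(H - \<alpha>)\<^sup>2 \<le> (T / 4)\<^sup>2"
    using st(2)
  proof
    assume "(H - \<alpha>)\<^sup>2 \<le> d"
    also have "d \<le> (\<kappa> / 2)\<^sup>2" using d4 by (simp add: power_divide)
    also have "\<dots> \<le> (T / 4)\<^sup>2" using \<kappa> T by (intro power_mono) auto
    finally show ?thesis .
  next
    assume "lp * (H - \<alpha>)\<^sup>2 \<le> H * (cost m H - cost m \<alpha>)"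
    moreover have "1 * (H - \<alpha>)\<^sup>2 \<le> lp * (H - \<alpha>)\<^sup>2" using p by (intro mult_right_mono) auto
    moreover have "H * (cost m H - cost m \<alpha>) \<le> H * (2 * \<kappa>)" using cH H0 by (intro mult_left_mono)
    moreover have "H * (2 * \<kappa>) \<le> 3 * L * (2 * \<kappa>)" using H3 \<kappa> by (intro mult_right_mono) auto
    moreover have "3 * L * (2 * \<kappa>) = 6 * (T\<^sup>2 / 100)" using \<kappa>(2) by (simp add: algebra_simps)
    moreover have "(T / 4)\<^sup>2 = T\<^sup>2 / 16" by (simp add: power_divide)
    ultimately show ?thesis using zero_le_power2[of T] by argo
  qed
  then have "\<bar>H - \<alpha>\<bar> \<le> \<bar>T / 4\<bar>" by (simp only: abs_le_square_iff)
  then have "\<bar>H - \<alpha>\<bar> \<le> T / 4" using T by simp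
  then have x1: "\<bar>x1 - \<alpha>\<bar> \<le> T / 2" using QR(2) R0 \<kappa>(3) T unfolding H_def by argo
  then have x1u: "x1 \<le> \<alpha> + T / 2" by linarith
  from x1 show "\<bar>x1 - \<alpha>\<bar> \<le> T" using T by linarith
  \<comment> \<open>The leading class is larger than the others by a multiple of L, so each vertex
    of \<open>y2\<close> or \<open>y3\<close> shows up in \<open>Q\<close> with that weight.\<close>
  have gap: "L / 4 \<le> x1 - R" using x1 al(1) QR(2) \<kappa>(3) T L0 by argo
  have y23: "y2 + y3 \<le> 108 * \<kappa>"
  proof -
    have "L / 4 \<le> x1 - x2" "L / 4 \<le> x1 - x3" using gap nn by (simp_all add: R_def)
    then have "L / 4 * y2 \<le> (x1 - x2) * y2" "L / 4 * y3 \<le> (x1 - x3) * y3" using nn by (intro mult_right_mono; simp)+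
    moreover have "L / 4 * (y2 + y3) = L / 4 * y2 + L / 4 * y3" by (rule distrib_left)
    ultimately have "L / 4 * (y2 + y3) \<le> Q" unfolding Q_def by linarith
    also have "Q \<le> 9 * \<kappa> * H" using QR(1) Hpos by (simp add: field_simps)
    also have "\<dots> \<le> 9 * \<kappa> * (3 * L)" using H3 \<kappa> by (intro mult_left_mono) auto
    finally have "L * (y2 + y3) \<le> L * (108 * \<kappa>)" by (simp add: algebra_simps)
    then show ?thesis using L0 by (simp only: mult_le_cancel_left_pos)
  qed
  have "x2 + x3 + y2 + y3 + z \<le> 150 * \<kappa>" using y23 QR by (simp add: R_def)
  then show "x2 + x3 + y2 + y3 + z \<le> T" using \<kappa>(3) T by linarith
  have x1H: "x1 \<le> 3 * L" using H3 R0 by (simp add: H_def)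
  have oth: "x1 * (x2 + x3) + x2 * x3 + x2 * y2 + x3 * y3 + d \<le> T * L"
  proof -
    have "x2 * x3 \<le> x1 * x3" "x2 * y2 \<le> x1 * y2" "x3 * y3 \<le> x1 * y3" "0 \<le> x1 * x2"
      using nn by (intro mult_right_mono; simp)+ (use nn x10 in simp)
    then have "x1 * (x2 + x3) + x2 * x3 + x2 * y2 + x3 * y3 \<le> x1 * (2 * R + (y2 + y3))"
      by (simp add: R_def algebra_simps)
    also have "\<dots> \<le> 3 * L * (156 * \<kappa>)" using x1H QR(2) y23 R0 nn x10 by (intro mult_mono) auto
    finally have "x1 * (x2 + x3) + x2 * x3 + x2 * y2 + x3 * y3 \<le> 468 * (\<kappa> * L)" by (simp add: algebra_simps)
    moreover have "\<kappa> * L \<le> T / 100000 * L" using \<kappa>(3) L0 by (intro mult_right_mono) auto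
    moreover have "0 < T * L" using T L0 by simp
    ultimately show ?thesis using dL by argo
  qed
  have TL: "0 < T * L" using T L0 by simp
  then show "x1 * (x2 + x3) + x2 * x3 + x2 * y2 + x3 * y3 + d \<le> 8 * T * L" using oth by simp
  show y1u: "y1 \<le> m / \<alpha> + 4 * T"
  proof -
    have "y1 * lr \<le> Y * lr" "0 \<le> R * lp" "0 \<le> z * lr" using p nn R0 by (intro mult_right_mono; simp add: Y_def)+ (use p nn R0 in simp_all)
    moreover have "(x1 + R) * lp = x1 * lp + R * lp" by (simp add: algebra_simps)
    ultimately have "y1 * lr \<le> cost m \<alpha> + \<kappa> - x1 * lp" using cost0 by argo
    also have "\<dots> = (\<alpha> - x1) * lp + lr * (m / \<alpha>) + \<kappa>" by (simp add: cost_def algebra_simps)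
    also have "(\<alpha> - x1) * lp \<le> T / 2 * (3 * lr)"
    proof (cases "x1 \<le> \<alpha>")
      case True
      then show ?thesis using x1 p by (intro mult_mono) auto
    next
      case False
      then have "(\<alpha> - x1) * lp \<le> 0" using p by (simp add: mult_nonpos_nonneg)
      moreover have "0 \<le> T / 2 * (3 * lr)" using T p by simp
      ultimately show ?thesis by linarith
    qed
    also have "\<kappa> \<le> \<kappa> * (3 * lr)" using p \<kappa> by (simp add: mult_le_cancel_left1)
    finally have "y1 * lr \<le> (3 / 2 * T + m / \<alpha> + 3 * \<kappa>) * lr" by (simp add: algebra_simps)
    moreover have "0 < lr" using p by linarith
    ultimately have "y1 \<le> 3 / 2 * T + m / \<alpha> + 3 * \<kappa>" by (simp only: mult_le_cancel_right_pos)
    then show ?thesis using \<kappa>(3) T by linarith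
  qed
  show "m / \<alpha> - 6 * T \<le> y1"
  proof -
    have "m - T * L \<le> x1 * y1" using edges oth by linarith
    also have "\<dots> \<le> (\<alpha> + T / 2) * y1" using x1u nn by (intro mult_right_mono) auto
    finally have 1: "m - T * L \<le> \<alpha> * y1 + T * y1 / 2" by (simp add: algebra_simps)
    have "y1 \<le> 3 * L" using y1u al(3) T L0 by argo
    then have "T * y1 \<le> T * (3 * L)" using T by (intro mult_left_mono) auto
    then have "m \<le> \<alpha> * y1 + 5 / 2 * (T * L)" using 1 by linarith
    moreover have "T * L \<le> T * (2 * \<alpha>)" using al(1) T by (intro mult_left_mono) auto
    ultimately have "m \<le> \<alpha> * (y1 + 5 * T)" by (simp add: algebra_simps)
    then have "m / \<alpha> \<le> y1 + 5 * T" using \<alpha> by (simp add: field_simps)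
    then show ?thesis using T by linarith
  qed
  show "x1 * y1 \<le> m + 12 * T * L"
  proof -
    have "x1 * y1 \<le> (\<alpha> + T / 2) * (m / \<alpha> + 4 * T)" using x1u y1u nn \<alpha> T m by (intro mult_mono) auto
    also have "\<dots> = m + 4 * (T * \<alpha>) + T * (m / \<alpha>) / 2 + 2 * (T * T)" using \<alpha> by (simp add: field_simps)
    also have "T * \<alpha> \<le> T * L" using al T by (intro mult_left_mono) auto
    also have "T * (m / \<alpha>) \<le> T * (2 * L)" using al(3) T by (intro mult_left_mono) auto
    also have "T * T \<le> T * L" using T L0 by (intro mult_left_mono) auto
    finally show ?thesis using TL by (simp add: mult.commute)
  qed
qed

section \<open>Exponential lower and upper bounds for the number of colourings\<close>

lemma powers_exp:
  assumes "a + b \<le> n"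
  shows "(2::real) ^ b * 3 ^ (n - a - b) = exp (n * lp - a * lp - b * lr)"
proof -
  have 2: "(2::real) ^ b = exp (real b * (lp - lr))"
    using log_bounds(7) by (simp add: exp_of_nat_mult)
  have 3: "(3::real) ^ (n - a - b) = exp (real (n - a - b) * lp)" by (simp add: exp_of_nat_mult)
  have "real (n - a - b) = real n - real a - real b" using assms by linarith
  then show ?thesis unfolding 2 3 exp_add[symmetric] by (simp only: left_diff_distrib right_diff_distrib) simp
qed

lemma maximizer_lower:
  assumes mx: "maximizes_colorings 3 n m V E" and m: "m \<ge> 16" "4 * m \<le> n\<^sup>2" and c: "center m n \<alpha>"
  shows "exp (n * lp - cost m \<alpha> - 4) \<le> num_colorings 3 V E"
proof -
  obtain a b :: nat where ab: "1 \<le> a" "1 \<le> b" "a + b \<le> n" "m \<le> a * b" "a * lp + b * lr \<le> cost m \<alpha> + 4"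
    using integer_near_center[OF c m] by metis
  have "exp (n * lp - cost m \<alpha> - 4) \<le> exp (n * lp - a * lp - b * lr)" using ab(5) by simp
  also have "\<dots> = 2 ^ b * 3 ^ (n - a - b)" using powers_exp[OF ab(3)] by simp
  also have "\<dots> \<le> (3 * 2 ^ b + 3 * 2 ^ a - 6) * 3 ^ (n - a - b)"
  proof (intro mult_right_mono)
    have "(2::real) ^ 1 \<le> 2 ^ a" "(2::real) ^ 1 \<le> 2 ^ b" using ab by (intro power_increasing; simp)+
    then show "(2::real) ^ b \<le> 3 * 2 ^ b + 3 * 2 ^ a - 6" by simp
  qed simp
  also have "\<dots> \<le> num_colorings 3 V E" by (rule maximizer_ge_bipartite[OF mx ab(1-4)])
  finally show ?thesis .
qed

lemma card_free_functions:
  assumes "finite V" "F \<subseteq> cols3 V E"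
  shows "card F \<le> 3 ^ card V"
proof -
  have "card F \<le> card (PiE V (\<lambda>_. {..<3::nat}))"
    by (rule card_mono) (use assms in \<open>auto simp: list_colorings_def intro!: finite_PiE\<close>)
  then show ?thesis using assms by (simp add: card_PiE)
qed

text \<open>By \<open>half_dominated\<close> at least half of the non-isolated vertices lose a
  factor 2/3. Against the lower bound for maximisers this limits their number to O(L).\<close>

lemma nonisolated_bound:
  assumes sg: "simple_graph V E" and U: "U = {v \<in> V. \<exists>w\<in>V. {v, w} \<in> E}"
  shows "real (card (cols3 V E)) \<le> exp (card V * lp - card U * lr / 2)"
proof -
  have finV: "finite V" using sg by (simp add: simple_graph_def)
  have UV: "U \<subseteq> V" "finite U" using U finV by auto
  have irr: "\<And>w. {w, w} \<notin> E" using simple_graph_edge(3)[OF sg] by blast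
  have iso: "\<And>w. w \<in> U \<Longrightarrow> \<exists>u\<in>V. {w, u} \<in> E" using U by blast
  obtain T where T: "T \<subseteq> U" "card U \<le> 2 * card T" "\<And>w. w \<in> T \<Longrightarrow> \<exists>u\<in>V - T. {w, u} \<in> E"
    using half_dominated[OF UV(2,1) irr iso] by metis
  have TV: "T \<subseteq> V" using T UV by blast
  let ?F = "(\<lambda>f. restrict f (V - T)) ` cols3 V E"
  have "card (cols3 V E) \<le> 2 ^ card T * card ?F" by (rule card_dominated_le[OF finV TV T(3)]) auto
  also have "\<dots> \<le> 2 ^ card T * 3 ^ card (V - T)"
    by (intro mult_le_mono2 card_free_functions[of _ _ E]) (use finV restrict_list_colorings[of _ V E] in auto)
  also have "card (V - T) = card V - 0 - card T" using TV finV by (simp add: card_Diff_subset finite_subset)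
  finally have "real (card (cols3 V E)) \<le> real (2 ^ card T * 3 ^ (card V - 0 - card T))" by (rule of_nat_mono)
  also have "\<dots> = 2 ^ card T * 3 ^ (card V - 0 - card T)" by simp
  also have "\<dots> = exp (card V * lp - real 0 * lp - card T * lr)"
    using powers_exp[of 0 "card T" "card V"] card_mono[OF finV TV] by simp
  also have "\<dots> \<le> exp (card V * lp - card U * lr / 2)"
  proof -
    have "real (card U) \<le> real (2 * card T)" using T(2) by (rule of_nat_mono)
    then have "real (card U) * lr \<le> 2 * real (card T) * lr" using log_bounds by (intro mult_right_mono) auto
    then show ?thesis by simp
  qed
  finally show ?thesis .
qed

text \<open>A vertex with all three colours in its list would be free of charge; domination of half
  of these vertices makes each cost \<open>lr / 2\<close> on average, so they become rare.\<close>

lemma leaf_bound: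
  assumes fin: "finite U" and irr: "\<And>w. {w, w} \<notin> E" and iso: "\<And>w. w \<in> U \<Longrightarrow> \<exists>u\<in>U. {w, u} \<in> E"
    and A: "\<And>v. v \<in> U \<Longrightarrow> A v \<subseteq> {..<3::nat}"
    and part: "U = P1 \<union> P2 \<union> Z" "P1 \<inter> P2 = {}" "P1 \<inter> Z = {}" "P2 \<inter> Z = {}"
    and P: "\<And>v. v \<in> P1 \<Longrightarrow> card (A v) = 1" "\<And>v. v \<in> P2 \<Longrightarrow> card (A v) = 2" "\<And>v. v \<in> Z \<Longrightarrow> card (A v) = 3"
  shows "real (card (list_colorings U E A)) \<le> exp (card U * lp - card P1 * lp - card P2 * lr - card Z * lr / 2)"
proof -
  have finP: "finite P1" "finite P2" "finite Z" using fin part(1) by auto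
  have ZU: "Z \<subseteq> U" using part by auto
  obtain T where T: "T \<subseteq> Z" "card Z \<le> 2 * card T" "\<And>w. w \<in> T \<Longrightarrow> \<exists>u\<in>U - T. {w, u} \<in> E"
    using half_dominated[OF finP(3) ZU irr iso] ZU by (metis subsetD)
  let ?F = "(\<lambda>f. restrict f (U - T)) ` list_colorings U E A"
  have TU: "T \<subseteq> U" "finite T" using T ZU finP finite_subset by auto
  have sub3: "list_colorings U E A \<subseteq> cols3 U E"
    using A by (fastforce simp: list_colorings_def)
  have 1: "card (list_colorings U E A) \<le> 2 ^ card T * card ?F"
    by (rule card_dominated_le[OF fin TU(1) T(3) sub3])
  have fA: "finite (A v)" if "v \<in> U" for v using A[OF that] finite_subset by blast
  have "card ?F \<le> card (PiE (U - T) A)"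
  proof (rule card_mono)
    show "finite (PiE (U - T) A)" using fin fA by (intro finite_PiE) auto
    show "?F \<subseteq> PiE (U - T) A" by (auto simp: list_colorings_def)
  qed
  also have "\<dots> = 1 ^ card P1 * 2 ^ card P2 * 3 ^ (card (U - T) - card P1 - card P2)"
    by (rule card_PiE_classes) (use fin part T P in auto)
  finally have 2: "card ?F \<le> 2 ^ card P2 * 3 ^ (card (U - T) - card P1 - card P2)" by simp
  have cU: "card U = card P1 + card P2 + card Z"
  proof -
    have "card U = card (P1 \<union> P2) + card Z" unfolding part(1) by (rule card_Un_disjoint) (use finP part in auto)
    also have "card (P1 \<union> P2) = card P1 + card P2" by (rule card_Un_disjoint) (use finP part in auto)
    finally show ?thesis .
  qed
  have TZ: "card T \<le> card Z" by (rule card_mono[OF finP(3) T(1)])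
  have cUT: "card (U - T) = card U - card T" by (rule card_Diff_subset[OF TU(2,1)])
  have "card (list_colorings U E A) \<le> 2 ^ card T * (2 ^ card P2 * 3 ^ (card (U - T) - card P1 - card P2))"
    by (rule order.trans[OF 1 mult_le_mono2[OF 2]])
  also have "\<dots> = 2 ^ (card P2 + card T) * 3 ^ (card U - card P1 - (card P2 + card T))"
    using cUT by (simp add: power_add)
  finally have "real (card (list_colorings U E A)) \<le> real (2 ^ (card P2 + card T) * 3 ^ (card U - card P1 - (card P2 + card T)))"
    by (rule of_nat_mono)
  also have "\<dots> = 2 ^ (card P2 + card T) * 3 ^ (card U - card P1 - (card P2 + card T))" by simp
  also have "\<dots> = exp (card U * lp - card P1 * lp - real (card P2 + card T) * lr)"
    by (rule powers_exp) (use cU TZ in simp)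
  also have "\<dots> \<le> exp (card U * lp - card P1 * lp - card P2 * lr - card Z * lr / 2)"
  proof -
    have "real (card Z) \<le> real (2 * card T)" using T(2) by (rule of_nat_mono)
    then have "real (card Z) * lr \<le> 2 * real (card T) * lr" using log_bounds by (intro mult_right_mono) auto
    then show ?thesis by (simp add: algebra_simps)
  qed
  finally show ?thesis .
qed

section \<open>Reading a size profile off the container\<close>

lemma color_lists:
  fixes S :: "nat set"
  assumes "S \<subseteq> {..<3}" "S \<noteq> {}"
  shows "(\<exists>c<3. S = {c}) \<or> (\<exists>c<3. S = {..<3} - {c}) \<or> S = {..<3}"
proof -
  have e: "{..<3::nat} = {0, 1, 2}" by auto
  have "S \<in> Pow {0, 1, 2}" using assms(1) e by simp
  then have "S \<in> {{0}, {1}, {2}, {0, 1}, {0, 2}, {1, 2}, {0, 1, 2}}"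
    using assms(2) by (auto simp: Pow_insert)
  moreover have "{..<3::nat} - {0} = {1, 2}" "{..<3::nat} - {1} = {0, 2}" "{..<3::nat} - {2} = {0, 1}" by auto
  moreover have "(0::nat) < 3" "(1::nat) < 3" "(2::nat) < 3" by simp_all
  ultimately show ?thesis using e by (elim insertE) (metis emptyE)+
qed

lemma disjoint_color_lists:
  fixes S T :: "nat set"
  assumes S: "S \<subseteq> {..<3}" "S \<noteq> {}" and T: "T \<subseteq> {..<3}" "T \<noteq> {}" and dis: "S \<inter> T = {}"
  shows "(\<exists>c<3. \<exists>d<3. c \<noteq> d \<and> S = {c} \<and> T = {d}) \<or>
    (\<exists>c<3. S = {c} \<and> T = {..<3} - {c}) \<or> (\<exists>c<3. T = {c} \<and> S = {..<3} - {c})"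
proof -
  have nf: "S \<noteq> {..<3}" "T \<noteq> {..<3}" using assms by auto
  have cc: "\<not> ((\<exists>c<3. S = {..<3} - {c}) \<and> (\<exists>c<3. T = {..<3} - {c}))"
  proof
    assume "(\<exists>c<3. S = {..<3} - {c}) \<and> (\<exists>c<3. T = {..<3} - {c})"
    then obtain c d where cd: "S = {..<3} - {c}" "T = {..<3} - {d}" "c < 3" "d < 3" by blast
    have "\<exists>e<3. e \<noteq> c \<and> e \<noteq> d" using cd(3,4) by presburger
    then show False using cd dis by auto
  qed
  have sc: "d = c" if "c < 3" "d < 3" "{c} \<inter> ({..<3} - {d}) = {}" for c d :: nat using that by auto
  from color_lists[OF S] color_lists[OF T] nf cc show ?thesis
    by (elim disjE) (use dis sc in \<open>metis Int_commute Int_insert_left_if1 insert_not_empty singletonI\<close>)+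
qed

text \<open>A conflict is charged to an end and a common colour: at most three colours per vertex,
  fewer than \<open>d\<close> conflicts for each.\<close>

lemma card_conflict_le:
  assumes fin: "finite U" and E: "\<And>e. e \<in> E \<Longrightarrow> \<exists>u\<in>U. \<exists>v\<in>U. e = {u, v}"
    and A: "\<And>v. v \<in> U \<Longrightarrow> A v \<subseteq> {..<3::nat}" and sp: "sparse_lists U E d A"
  shows "card {e \<in> E. \<exists>u v. e = {u, v} \<and> A u \<inter> A v \<noteq> {}} \<le> 3 * d * card U"
proof -
  let ?N = "\<lambda>(v, c). {w \<in> U. {v, w} \<in> E \<and> c \<in> A w}"
  define G where "G = (\<lambda>(v, c). (\<lambda>w. {v, w}) ` {w \<in> U. {v, w} \<in> E \<and> c \<in> A w})"
  let ?I = "Sigma U A"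
  have finA: "finite (A v)" if "v \<in> U" for v using A[OF that] finite_subset by blast
  have finI: "finite ?I" using fin finA by (intro finite_SigmaI) auto
  have "{e \<in> E. \<exists>u v. e = {u, v} \<and> A u \<inter> A v \<noteq> {}} \<subseteq> (\<Union>i\<in>?I. G i)"
  proof
    fix e assume "e \<in> {e \<in> E. \<exists>u v. e = {u, v} \<and> A u \<inter> A v \<noteq> {}}"
    then obtain u v c where e: "e \<in> E" "e = {u, v}" "c \<in> A u" "c \<in> A v" by blast
    have "u \<in> U" "v \<in> U" using E[OF e(1)] e(2) by (auto simp: doubleton_eq_iff)
    then have "e \<in> G (u, c)" "(u, c) \<in> ?I" using e by (auto simp: G_def)
    then show "e \<in> (\<Union>i\<in>?I. G i)" by blast
  qed
  then have "card {e \<in> E. \<exists>u v. e = {u, v} \<and> A u \<inter> A v \<noteq> {}} \<le> card (\<Union>i\<in>?I. G i)"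
    by (rule card_mono[rotated]) (use finI fin in \<open>auto simp: G_def\<close>)
  also have "\<dots> \<le> (\<Sum>i\<in>?I. card (G i))" by (rule card_UN_le[OF finI])
  also have "\<dots> \<le> (\<Sum>i\<in>?I. d)"
  proof (rule sum_mono)
    fix i assume "i \<in> ?I"
    then obtain v c where i: "i = (v, c)" "v \<in> U" "c \<in> A v" by blast
    have "card (G i) \<le> card {w \<in> U. {v, w} \<in> E \<and> c \<in> A w}"
      unfolding i G_def prod.case by (rule card_image_le) (use fin in simp)
    also have "\<dots> \<le> d" using sp i by (auto simp: sparse_lists_def less_imp_le)
    finally show "card (G i) \<le> d" .
  qed
  also have "\<dots> = card ?I * d" by simp
  also have "card ?I = (\<Sum>v\<in>U. card (A v))" by (rule card_SigmaI[OF fin]) (use finA in blast)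
  also have "\<dots> \<le> (\<Sum>v\<in>U. 3)"
    by (rule sum_mono) (use A card_mono[of "{..<3::nat}"] in fastforce)
  finally show ?thesis by (simp add: mult.commute mult.left_commute)
qed

text \<open>Markov's inequality for the number of missing neighbours.\<close>

lemma card_bad_le:
  assumes fin: "finite A" "finite B" and dis: "A \<inter> B = {}" and K: "0 \<le> K"
  shows "real (card {v \<in> A. \<not> real (card {w \<in> B. {v, w} \<notin> E}) \<le> K}) * K \<le> card (bip A B - E)"
proof -
  let ?W = "{v \<in> A. \<not> real (card {w \<in> B. {v, w} \<notin> E}) \<le> K}"
  let ?M = "\<lambda>v. {w \<in> B. {v, w} \<notin> E}"
  have "real (card ?W) * K = (\<Sum>v\<in>?W. K)" by simp
  also have "\<dots> \<le> (\<Sum>v\<in>?W. real (card (?M v)))" by (rule sum_mono) auto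
  also have "\<dots> = real (card (Sigma ?W ?M))"
    using fin by (subst card_SigmaI) auto
  also have "card (Sigma ?W ?M) = card ((\<lambda>(x, y). {x, y}) ` Sigma ?W ?M)"
  proof (rule card_image[symmetric])
    show "inj_on (\<lambda>(x, y). {x, y}) (Sigma ?W ?M)"
      by (rule inj_on_subset[OF inj_on_doubleton[OF dis]]) auto
  qed
  also have "real \<dots> \<le> real (card (bip A B - E))"
  proof (intro of_nat_mono card_mono)
    show "finite (bip A B - E)" using fin by simp
    show "(\<lambda>(x, y). {x, y}) ` Sigma ?W ?M \<subseteq> bip A B - E" by (auto simp: bip_def)
  qed
  finally show ?thesis by simp
qed

text \<open>The bound L / 2 of \<open>cost_center_le\<close> leaves no room for error terms when the
  core is required to have at least L / 2 vertices.\<close>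

lemma center_lower:
  assumes c: "center m n \<alpha>" and m: "m > 0" "4 * m \<le> n\<^sup>2" and n: "n > 0"
  shows "55 / 100 * sqrt m \<le> \<alpha>"
proof -
  let ?u = "sparse_opt m"
  note u = sparse_opt_bounds[OF m(1)]
  have "m * lp \<le> m * (3 * lr)" using log_bounds m by (intro mult_left_mono) auto
  moreover have "m * (3 * lr) = 3 * ?u\<^sup>2 * lp" using u(2) by argo
  ultimately have "m * lp \<le> 3 * ?u\<^sup>2 * lp" by linarith
  moreover have "0 < lp" using log_bounds by linarith
  ultimately have "m \<le> 3 * ?u\<^sup>2" by (simp only: mult_le_cancel_right_pos)
  then have "(55 / 100 * sqrt m)\<^sup>2 \<le> ?u\<^sup>2" using m by (simp add: power_mult_distrib power_divide)
  then have "55 / 100 * sqrt m \<le> ?u" by (rule power2_le_imp_le) (use u in simp)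
  then show ?thesis using center_props(1)[OF c m n] by linarith
qed

lemma center_exists: "\<exists>\<alpha>. center m n \<alpha>"
  unfolding center_def using linear[of m "kappa3 * n\<^sup>2"] by blast

text \<open>The container is applied to the non-isolated vertices only, and vertices are sorted by
  their lists. Up to conflicts an edge joins two different singletons or a singleton and its
  complement; \<open>c\<close> is the colour with the most singletons.\<close>

lemma colour_profile:
  fixes V :: "'a set" and \<eta> :: real
  assumes sg: "simple_graph V E" and U: "U = {v \<in> V. \<exists>w\<in>V. {v, w} \<in> E}"
    and \<eta>: "1 / exp \<eta> + (1 / exp \<eta>) ^ D \<le> 1" and f0: "0 < card (cols3 V E)"
  obtains P Y :: "nat \<Rightarrow> 'a set" and Z and c d e :: nat where
    "U = P c \<union> P d \<union> P e \<union> (Y c \<union> Y d \<union> Y e) \<union> Z"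
    "card U = card (P c) + card (P d) + card (P e) + (card (Y c) + card (Y d) + card (Y e)) + card Z"
    "P c \<inter> Y c = {}" "card (P d) \<le> card (P c)" "card (P e) \<le> card (P c)"
    "card E \<le> card (P c) * (card (P d) + card (P e)) + card (P d) * card (P e)
       + card (E \<inter> bip (P c) (Y c)) + card (P d) * card (Y d) + card (P e) * card (Y e) + 3 * D * card U"
    "ln (card (cols3 V E)) \<le> card V * lp - (card (P c) + card (P d) + card (P e)) * lp
       - (card (Y c) + card (Y d) + card (Y e)) * lr - card Z * lr / 2 + 3 * card U * \<eta>"
proof -
  have finV: "finite V" using sg by (simp add: simple_graph_def)
  have UV: "U \<subseteq> V" "finite U" using U finV by auto
  have irr: "\<And>w. {w, w} \<notin> E" using simple_graph_edge(3)[OF sg] by blast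
  have EU: "u \<in> U \<and> v \<in> U" if "{u, v} \<in> E" for u v
    using simple_graph_edge[OF sg that] that U by (auto simp: insert_commute)
  have EU': "\<exists>u\<in>U. \<exists>v\<in>U. e = {u, v}" if e: "e \<in> E" for e
  proof -
    have "e \<in> nsets V 2" using e sg by (auto simp: simple_graph_def)
    then obtain u v where "e = {u, v}" by (auto simp: nsets_def card_2_iff)
    then show ?thesis using EU e by blast
  qed
  have iso: "\<exists>u\<in>U. {w, u} \<in> E" if "w \<in> U" for w using that U EU by blast
  let ?F = "(\<lambda>f. restrict f (V - (V - U))) ` cols3 V E"
  have 1: "card (cols3 V E) \<le> 3 ^ card (V - U) * card ?F" by (rule card_free_le[OF finV]) auto
  have VU: "V - (V - U) = U" using UV by auto
  have "card ?F \<le> card (cols3 U E)"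
    by (rule card_mono) (use UV restrict_list_colorings[of _ V E _ U] VU in auto)
  then have 2: "card (cols3 V E) \<le> 3 ^ card (V - U) * card (cols3 U E)" using order.trans[OF 1 mult_le_mono2] by blast
  obtain A where A: "\<forall>v\<in>U. A v \<subseteq> {..<3::nat}" "sparse_lists U E D A"
    "real (card (cols3 U E)) \<le> exp \<eta> ^ (\<Sum>v\<in>U. card {..<3::nat}) * card (list_colorings U E A)"
    using container[OF UV(2) exp_gt_zero \<eta>, of "\<lambda>_. {..<3}" E] by auto
  have lpos: "0 < card (list_colorings U E A)"
  proof (rule ccontr)
    assume "\<not> ?thesis"
    then have "card (cols3 U E) = 0" using A(3) by simp
    then show False using 2 f0 by simp
  qed
  \<comment> \<open>One surviving colouring shows that no list is empty.\<close>
  then obtain g where g: "g \<in> list_colorings U E A" by (metis card_gt_0_iff ex_in_conv)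
  have An: "A v \<noteq> {}" if "v \<in> U" for v using g that by (auto simp: list_colorings_def)
  define P where "P c = {v \<in> U. A v = {c}}" for c
  define Y where "Y c = {v \<in> U. A v = {..<3} - {c}}" for c
  define Z where "Z = {v \<in> U. A v = {..<3}}"
  have fin: "finite (P c)" "finite (Y c)" "finite Z" for c using UV by (auto simp: P_def Y_def Z_def)
  have c2: "card ({..<3::nat} - {c}) = 2" if "c < 3" for c using that by simp
  have PY: "P i \<inter> Y j = {}" if "j < 3" for i j
  proof -
    have "{i} \<noteq> {..<3} - {j}" using c2[OF that] by (metis card.empty card.insert empty_iff finite.emptyI numeral_2_eq_2 n_not_Suc_n One_nat_def)
    then show ?thesis by (auto simp: P_def Y_def)
  qed
  have PP: "P i \<inter> P j = {}" if "i \<noteq> j" for i j using that by (auto simp: P_def)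
  have YY: "Y i \<inter> Y j = {}" if "i \<noteq> j" "i < 3" "j < 3" for i j
  proof -
    have "{..<3} - {i} \<noteq> {..<3} - {j}" using that by auto
    then show ?thesis by (auto simp: Y_def)
  qed
  have PZ: "P i \<inter> Z = {}" for i
  proof -
    have "{i} \<noteq> {..<3::nat}" by (metis card_lessThan card.empty card.insert empty_iff finite.emptyI numeral_eq_one_iff semiring_norm(84,86) One_nat_def numeral_eq_iff)
    then show ?thesis by (auto simp: P_def Z_def)
  qed
  have YZ: "Y i \<inter> Z = {}" if "i < 3" for i using that by (auto simp: Y_def Z_def)
  have all: "v \<in> Z \<or> (\<exists>c<3. v \<in> P c) \<or> (\<exists>c<3. v \<in> Y c)" if v: "v \<in> U" for v
    using color_lists[OF A(1)[rule_format, OF v] An[OF v]] v by (auto simp: P_def Y_def Z_def)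
  have "\<exists>c<3. \<forall>i<3. card (P i) \<le> card (P c)"
  proof -
    have "card (P i) < Suc (card U)" for i using UV by (auto simp: P_def less_Suc_eq_le intro: card_mono)
    then show ?thesis
      using ex_has_greatest_nat[of "\<lambda>i. i < 3" 0 "\<lambda>i. card (P i)" "Suc (card U)"] by auto
  qed
  then obtain c where c: "c < 3" "\<And>i. i < 3 \<Longrightarrow> card (P i) \<le> card (P c)" by blast
  define d where "d = (if c = 0 then 1 else 0 :: nat)"
  define e where "e = 3 - c - d"
  have de: "d < 3" "e < 3" "c \<noteq> d" "c \<noteq> e" "d \<noteq> e" using c(1) unfolding d_def e_def by (cases "c = 0"; presburger)+
  have i3: "i = c \<or> i = d \<or> i = e" if "i < 3" for i using that c(1) de by linarith
  let ?P = "P c \<union> P d \<union> P e" and ?Y = "Y c \<union> Y d \<union> Y e"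
  have UPYZ: "U = ?P \<union> ?Y \<union> Z"
  proof
    show "U \<subseteq> ?P \<union> ?Y \<union> Z" using all i3 by blast
  qed (auto simp: P_def Y_def Z_def)
  have cP: "card ?P = card (P c) + card (P d) + card (P e)"
    using fin PP de by (simp add: card_Un_disjoint Int_Un_distrib2)
  have cY: "card ?Y = card (Y c) + card (Y d) + card (Y e)"
    using fin YY de c(1) by (simp add: card_Un_disjoint Int_Un_distrib2)
  have dPY: "?P \<inter> ?Y = {}" using PY de c(1) by blast
  have dPZ: "?P \<inter> Z = {}" using PZ by blast
  have dYZ: "?Y \<inter> Z = {}" using YZ de c(1) by blast
  have cU: "card U = card ?P + card ?Y + card Z"
  proof -
    have "card U = card (?P \<union> ?Y) + card Z" unfolding UPYZ by (rule card_Un_disjoint) (use fin dPZ dYZ in auto)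
    also have "card (?P \<union> ?Y) = card ?P + card ?Y" by (rule card_Un_disjoint) (use fin dPY in auto)
    finally show ?thesis .
  qed
  let ?C = "{e \<in> E. \<exists>u v. e = {u, v} \<and> A u \<inter> A v \<noteq> {}}"
  \<comment> \<open>Only the pair of the leading colour keeps the intersection with
    \<open>E\<close>: a lower bound on its actual edges is what later makes these two classes almost
    completely joined.\<close>
  have Esub: "E \<subseteq> bip (P c) (P d) \<union> bip (P c) (P e) \<union> bip (P d) (P e) \<union> (E \<inter> bip (P c) (Y c))
     \<union> bip (P d) (Y d) \<union> bip (P e) (Y e) \<union> ?C" (is "_ \<subseteq> ?S")
  proof
    fix x assume x: "x \<in> E"
    obtain u v where uv: "u \<in> U" "v \<in> U" "x = {u, v}" using EU'[OF x] by blast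
    show "x \<in> ?S"
    proof (cases "A u \<inter> A v = {}")
      case False
      then show ?thesis using x uv by blast
    next
      case True
      have bip1: "{u, v} \<in> bip Q R" "{v, u} \<in> bip Q R" if "u \<in> Q" "v \<in> R" for Q R u and v :: 'a
        using that by (auto simp: bip_def insert_commute) (metis insert_commute)?
      from disjoint_color_lists[OF A(1)[rule_format, OF uv(1)] An[OF uv(1)] A(1)[rule_format, OF uv(2)] An[OF uv(2)] True]
      consider i j where "i < 3" "j < 3" "i \<noteq> j" "u \<in> P i" "v \<in> P j" | i where "i < 3" "u \<in> P i" "v \<in> Y i"
        | i where "i < 3" "v \<in> P i" "u \<in> Y i"
        using uv by (auto simp: P_def Y_def)
      then show ?thesis
      proof cases
        case 1
        then have "x \<in> bip (P i) (P j)" "x \<in> bip (P j) (P i)" using bip1[of u "P i" v "P j"] bip1[of v "P j" u "P i"] uv by auto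
        then show ?thesis using i3[OF 1(1)] i3[OF 1(2)] 1(3) by auto
      next
        case 2
        then have "x \<in> bip (P i) (Y i)" using bip1[of u "P i" v "Y i"] uv by auto
        then show ?thesis using i3[OF 2(1)] x by auto
      next
        case 3
        then have "x \<in> bip (P i) (Y i)" using bip1[of v "P i" u "Y i"] uv by auto
        then show ?thesis using i3[OF 3(1)] x by auto
      qed
    qed
  qed
  have finE: "finite E" using sg finV by (meson finite_imp_finite_nsets finite_subset simple_graph_def)
  have "card E \<le> card ?S" by (rule card_mono[OF _ Esub]) (use fin finE in simp)
  also have "\<dots> \<le> card (bip (P c) (P d)) + card (bip (P c) (P e)) + card (bip (P d) (P e)) + card (E \<inter> bip (P c) (Y c))
     + card (bip (P d) (Y d)) + card (bip (P e) (Y e)) + card ?C"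
    by (meson add_le_mono1 card_Un_le le_trans)
  also have "\<dots> \<le> card (P c) * (card (P d) + card (P e)) + card (P d) * card (P e)
       + card (E \<inter> bip (P c) (Y c)) + card (P d) * card (Y d) + card (P e) * card (Y e) + 3 * D * card U"
    using card_conflict_le[OF UV(2) EU' A(1)[rule_format] A(2)] PP PY de c(1)
    by (simp add: card_bip algebra_simps)
  finally have edges: "card E \<le> card (P c) * (card (P d) + card (P e)) + card (P d) * card (P e)
       + card (E \<inter> bip (P c) (Y c)) + card (P d) * card (Y d) + card (P e) * card (Y e) + 3 * D * card U" .
  have leaf: "real (card (list_colorings U E A)) \<le> exp (card U * lp - card ?P * lp - card ?Y * lr - card Z * lr / 2)"
  proof (rule leaf_bound[OF UV(2) irr iso A(1)[rule_format] UPYZ dPY dPZ dYZ])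
    show "card (A v) = 1" if v: "v \<in> ?P" for v
    proof -
      obtain i where "v \<in> P i" using v by blast
      then show ?thesis by (simp add: P_def)
    qed
    show "card (A v) = 2" if v: "v \<in> ?Y" for v
    proof -
      obtain i where i: "i < 3" "v \<in> Y i" using v c(1) de by blast
      then have "A v = {..<3} - {i}" by (simp add: Y_def)
      then show ?thesis using c2[OF i(1)] by (simp only:)
    qed
    show "card (A v) = 3" if v: "v \<in> Z" for v
    proof -
      have "A v = {..<3}" using v by (simp add: Z_def)
      then show ?thesis by simp
    qed
  qed
  have "real (card (cols3 V E)) \<le> real (3 ^ card (V - U) * card (cols3 U E))" using 2 by (rule of_nat_mono)
  also have "\<dots> = 3 ^ card (V - U) * real (card (cols3 U E))" by simp
  also have "\<dots> \<le> 3 ^ card (V - U) * (exp \<eta> ^ (\<Sum>v\<in>U. card {..<3::nat}) *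
      exp (card U * lp - card ?P * lp - card ?Y * lr - card Z * lr / 2))"
    by (intro mult_left_mono order.trans[OF A(3)] leaf) auto
  also have "exp \<eta> ^ (\<Sum>v\<in>U. card {..<3::nat}) = exp (3 * card U * \<eta>)"
    by (simp add: exp_of_nat_mult[symmetric] mult_ac)
  also have "(3::real) ^ card (V - U) = exp (real (card (V - U)) * lp)" by (simp add: exp_of_nat_mult)
  also have "real (card (V - U)) = real (card V) - real (card U)"
    using UV finV by (simp add: card_Diff_subset card_mono of_nat_diff)
  finally have "real (card (cols3 V E)) \<le> exp (card V * lp - card ?P * lp - card ?Y * lr - card Z * lr / 2 + 3 * card U * \<eta>)"
    unfolding exp_add[symmetric] by (simp add: algebra_simps)
  then have "ln (real (card (cols3 V E))) \<le>
      ln (exp (card V * lp - card ?P * lp - card ?Y * lr - card Z * lr / 2 + 3 * card U * \<eta>))"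
    using f0 by (subst ln_le_cancel_iff) simp_all
  then have "ln (card (cols3 V E)) \<le> card V * lp - card ?P * lp - card ?Y * lr - card Z * lr / 2 + 3 * card U * \<eta>"
    by (simp only: ln_exp)
  then have lnf: "ln (card (cols3 V E)) \<le> card V * lp - (card (P c) + card (P d) + card (P e)) * lp
       - (card (Y c) + card (Y d) + card (Y e)) * lr - card Z * lr / 2 + 3 * card U * \<eta>"
    unfolding cP cY .
  show thesis
    by (rule that[OF UPYZ _ PY[OF c(1)] c(2)[OF de(1)] c(2)[OF de(2)] edges lnf]) (use cU cP cY in simp)
qed

lemma maximizer_core:
  fixes V :: "'a set"
  assumes mx: "maximizes_colorings 3 n m V E" and m4: "4 * m \<le> n\<^sup>2"
    and D: "1 / exp (1 / 10 ^ 22) + (1 / exp (1 / 10 ^ 22)) ^ D \<le> (1::real)"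
    and L: "L = sqrt (real m)" "10 ^ 43 * (real D + 1) \<le> L"
  shows "\<exists>A B. core_graph V E A B L"
proof -
  have g: "simple_graph V E" "card V = n" "card E = m" "finite V"
    using mx by (auto simp: maximizes_colorings_def graph_with_def simple_graph_def)
  let ?f = "card (cols3 V E)"
  have D0: "(10::real) ^ 43 * 1 \<le> 10 ^ 43 * (real D + 1)" by (intro mult_left_mono) auto
  then have L43: "10 ^ 43 \<le> L" using L(2) by simp
  then have Lpos: "L > 0" by (rule less_le_trans[rotated]) simp
  have Lm: "L * L = real m" using L by simp
  have mpos: "real m > 0" using Lm Lpos by (metis mult_pos_pos)
  have m16: "16 \<le> m"
  proof -
    have "4 * 4 \<le> L * L" using L43 by (intro mult_mono) auto
    then show ?thesis using Lm by simp
  qed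
  have m4': "4 * real m \<le> (real n)\<^sup>2" using m4 by (metis of_nat_le_iff of_nat_mult of_nat_numeral of_nat_power)
  have npos: "real n > 0" using m4' mpos by (cases n) auto
  obtain \<alpha> where c: "center (real m) (real n) \<alpha>" using center_exists by blast
  note al = cost_center_le[OF c mpos m4' npos, folded L(1)]
  note al55 = center_lower[OF c mpos m4' npos, folded L(1)]
  have \<alpha>: "\<alpha> > 0" using al Lpos by linarith
  have low: "exp (n * lp - cost m \<alpha> - 4) \<le> ?f"
    using maximizer_lower[OF mx m16 m4 c] num_colorings_cols3[OF g(1)] by simp
  have f0: "0 < ?f" by (rule ccontr) (use low in \<open>simp add: not_less\<close>)
  have lnlow: "n * lp - cost m \<alpha> - 4 \<le> ln ?f"
    using low f0 by (simp add: ln_ge_iff)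
  define U where "U = {v \<in> V. \<exists>w\<in>V. {v, w} \<in> E}"
  have finU: "finite U" using g by (simp add: U_def)
  have UN: "real (card U) \<le> 20 * L"
  proof -
    have "ln ?f \<le> n * lp - card U * lr / 2"
    proof -
      have "ln (real ?f) \<le> ln (exp (card V * lp - card U * lr / 2))"
        using nonisolated_bound[OF g(1) U_def] f0 by (subst ln_le_cancel_iff) simp_all
      then show ?thesis using g(2) by simp
    qed
    then have "card U * lr / 2 \<le> 5 / 2 * L + 4" using lnlow al(5) by linarith
    moreover have "real (card U) * (1 / 3) \<le> real (card U) * lr" using log_bounds by (intro mult_left_mono) auto
    moreover have "1000 \<le> L" using L43 by simp
    ultimately show ?thesis by argo
  qed
  obtain P Y :: "nat \<Rightarrow> 'a set" and Z and c1 c2 c3 :: nat where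
    pU: "U = P c1 \<union> P c2 \<union> P c3 \<union> (Y c1 \<union> Y c2 \<union> Y c3) \<union> Z"
    and pc: "card U = card (P c1) + card (P c2) + card (P c3) + (card (Y c1) + card (Y c2) + card (Y c3)) + card Z"
    and pd: "P c1 \<inter> Y c1 = {}" and pm: "card (P c2) \<le> card (P c1)" "card (P c3) \<le> card (P c1)"
    and pe: "card E \<le> card (P c1) * (card (P c2) + card (P c3)) + card (P c2) * card (P c3)
       + card (E \<inter> bip (P c1) (Y c1)) + card (P c2) * card (Y c2) + card (P c3) * card (Y c3) + 3 * D * card U"
    and pl: "ln ?f \<le> card V * lp - (card (P c1) + card (P c2) + card (P c3)) * lp
       - (card (Y c1) + card (Y c2) + card (Y c3)) * lr - card Z * lr / 2 + 3 * card U * (1 / 10 ^ 22)"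
    using colour_profile[OF g(1) U_def D f0] by metis
  define A0 B0 where "A0 = P c1" and "B0 = Y c1"
  define x1 x2 x3 y1 y2 y3 z where "x1 = real (card (P c1))" and "x2 = real (card (P c2))" and "x3 = real (card (P c3))"
    and "y1 = real (card (Y c1))" and "y2 = real (card (Y c2))" and "y3 = real (card (Y c3))" and "z = real (card Z)"
  note defs = x1_def x2_def x3_def y1_def y2_def y3_def z_def
  define d where "d = real (3 * D * card U)"
  \<comment> \<open>Chosen backwards: the core may lose 40000 T vertices per class, which must stay
    below L / 20000; \<kappa> is forced by \<kappa> L = T^2 / 100; and the container rate 10^-22 on
    at most 20 L vertices keeps the loss within \<kappa>.\<close>
  define T where "T = L / 10 ^ 9"
  define \<kappa> where "\<kappa> = L / 10 ^ 20"
  have finAB: "finite A0" "finite B0" using finU pU by (auto simp: A0_def B0_def)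
  define ee where "ee = real (card (E \<inter> bip A0 B0))"
  have edges: "real m \<le> x1 * (x2 + x3) + x2 * x3 + ee + x2 * y2 + x3 * y3 + d"
    using of_nat_mono[OF pe, where 'a=real] unfolding g(3) defs d_def ee_def A0_def B0_def by simp
  have ee: "ee \<le> x1 * y1"
  proof -
    have "card (E \<inter> bip A0 B0) \<le> card (bip A0 B0)" using finAB by (intro card_mono) auto
    also have "\<dots> = card A0 * card B0" by (rule card_bip) (use pd in \<open>simp add: A0_def B0_def\<close>)
    finally have "real (card (E \<inter> bip A0 B0)) \<le> real (card A0 * card B0)" by (rule of_nat_mono)
    then show ?thesis by (simp add: ee_def defs A0_def B0_def)
  qed
  have cU: "real (card U) = x1 + x2 + x3 + y1 + y2 + y3 + z" unfolding defs pc by simp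
  have "card U \<le> card V" using g(4) by (intro card_mono) (auto simp: U_def)
  then have sum: "x1 + x2 + x3 + y1 + y2 + y3 + z \<le> real n" using cU g(2) by linarith
  have d0: "0 \<le> d" by (simp add: d_def)
  \<comment> \<open>This is what L \<ge> 10^43 (D + 1) is for: the conflict edges number at most 60
    D L, below (\<kappa> / 2)^2.\<close>
  have dk: "2 * sqrt d \<le> \<kappa>"
  proof -
    have "d \<le> 60 * real D * L"
    proof -
      have "real D * real (card U) \<le> real D * (20 * L)" using UN by (intro mult_left_mono) auto
      then show ?thesis by (simp add: d_def algebra_simps)
    qed
    also have "\<dots> \<le> 60 * (L / 10 ^ 43) * L"
    proof (intro mult_right_mono mult_left_mono)
      have "10 ^ 43 * real D \<le> L" using L(2) by (simp add: algebra_simps)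
      then show "real D \<le> L / 10 ^ 43" by (simp add: field_simps)
    qed (use Lpos in auto)
    also have "\<dots> \<le> (\<kappa> / 2)\<^sup>2"
    proof -
      have "0 \<le> L * L" using Lpos by simp
      then show ?thesis by (simp add: \<kappa>_def power2_eq_square)
    qed
    finally have "sqrt d \<le> \<kappa> / 2" by (intro real_le_lsqrt) (use d0 Lpos in \<open>auto simp: \<kappa>_def\<close>)
    then show ?thesis by simp
  qed
  have cst: "(x1 + x2 + x3) * lp + (y1 + y2 + y3) * lr + z * lr / 2 \<le> cost m \<alpha> + \<kappa>"
  proof -
    have "3 * card U * (1 / 10 ^ 22) + 4 \<le> \<kappa>"
    proof -
      have "3 * card U * (1 / 10 ^ 22) \<le> 60 * L * (1 / 10 ^ 22 :: real)" using UN by (intro mult_right_mono) auto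
      moreover have "4 \<le> 40 * L * (1 / 10 ^ 22 :: real)" using L43 by simp
      moreover have "60 * L * (1 / 10 ^ 22) + 40 * L * (1 / 10 ^ 22) = \<kappa>" by (simp add: \<kappa>_def)
      ultimately show ?thesis by linarith
    qed
    then show ?thesis using pl lnlow g(2) unfolding defs by simp
  qed
  have st: "\<bar>x1 - \<alpha>\<bar> \<le> T" "x2 + x3 + y2 + y3 + z \<le> T" "m / \<alpha> - 6 * T \<le> y1" "y1 \<le> m / \<alpha> + 4 * T"
    "x1 * (x2 + x3) + x2 * x3 + x2 * y2 + x3 * y3 + d \<le> 8 * T * L" "x1 * y1 \<le> m + 12 * T * L"
    by (rule profile_stability[OF c mpos m4' npos L(1) _ _ _ _ _ _ _ _ sum _ d0 dk cst];
        use edges ee pm Lpos in \<open>simp add: defs T_def \<kappa>_def power2_eq_square\<close>)+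
  define K where "K = L / 2000"
  have miss: "real (card (bip A0 B0 - E)) \<le> 20 * T * L"
  proof -
    have "card (bip A0 B0) = card (E \<inter> bip A0 B0) + card (bip A0 B0 - E)"
    proof -
      have "card (bip A0 B0) = card ((E \<inter> bip A0 B0) \<union> (bip A0 B0 - E))" by (rule arg_cong[where f=card]) blast
      also have "\<dots> = card (E \<inter> bip A0 B0) + card (bip A0 B0 - E)"
        by (rule card_Un_disjoint) (use finAB in auto)
      finally show ?thesis .
    qed
    moreover have "card (bip A0 B0) = card A0 * card B0" by (rule card_bip) (use pd in \<open>simp add: A0_def B0_def\<close>)
    ultimately have "real (card A0 * card B0) = real (card (E \<inter> bip A0 B0)) + real (card (bip A0 B0 - E))"
      by (metis of_nat_add)
    then have "x1 * y1 = ee + real (card (bip A0 B0 - E))" by (simp add: defs ee_def A0_def B0_def)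
    then show ?thesis using edges st(5,6) by argo
  qed
  define A where "A = {v \<in> A0. real (card {w \<in> B0. {v, w} \<notin> E}) \<le> K}"
  define B where "B = {v \<in> B0. real (card {w \<in> A0. {v, w} \<notin> E}) \<le> K}"
  \<comment> \<open>A discarded vertex misses more than \<open>K\<close> = L / 2000 partners, and
    only 20 T L pairs are missing.\<close>
  have few: "real N \<le> 40000 * T" if "real N * K \<le> real (card (bip A0 B0 - E))" for N
  proof -
    have "real N * K \<le> 20 * T * L" using that miss by linarith
    then have "real N * L \<le> (40000 * T) * L" by (simp add: K_def)
    then show ?thesis using Lpos by (simp only: mult_le_cancel_right_pos)
  qed
  have dAB: "A0 \<inter> B0 = {}" using pd by (simp add: A0_def B0_def)
  have K0: "0 \<le> K" using Lpos by (simp add: K_def)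
  have A0A: "real (card (A0 - A)) \<le> 40000 * T"
  proof -
    have "A0 - A = {v \<in> A0. \<not> real (card {w \<in> B0. {v, w} \<notin> E}) \<le> K}" by (auto simp: A_def)
    then show ?thesis using few[of "card (A0 - A)"] card_bad_le[OF finAB dAB K0, of E] by simp
  qed
  have B0B: "real (card (B0 - B)) \<le> 40000 * T"
  proof -
    have "B0 - B = {v \<in> B0. \<not> real (card {w \<in> A0. {v, w} \<notin> E}) \<le> K}" by (auto simp: B_def)
    moreover have "B0 \<inter> A0 = {}" using dAB by blast
    ultimately show ?thesis
      using few[of "card (B0 - B)"] card_bad_le[OF finAB(2,1) _ K0, of E] bip_commute[of A0 B0] by simp
  qed
  have AB: "A \<subseteq> A0" "B \<subseteq> B0" by (auto simp: A_def B_def)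
  have cA: "real (card A) = x1 - real (card (A0 - A))" "real (card B) = y1 - real (card (B0 - B))"
  proof -
    have "card (A0 - A) = card A0 - card A" "card A \<le> card A0"
      using AB finAB by (simp_all add: card_Diff_subset finite_subset card_mono)
    then show "real (card A) = x1 - real (card (A0 - A))" by (simp add: defs A0_def of_nat_diff)
    have "card (B0 - B) = card B0 - card B" "card B \<le> card B0"
      using AB finAB by (simp_all add: card_Diff_subset finite_subset card_mono)
    then show "real (card B) = y1 - real (card (B0 - B))" by (simp add: defs B0_def of_nat_diff)
  qed
  have TL: "T = L / 1000000000" by (simp add: T_def)
  have lowA': "\<alpha> - L / 20000 \<le> card A" "card A \<le> \<alpha> + L / 20000"
    using cA(1) A0A st(1) TL Lpos of_nat_0_le_iff[of "card (A0 - A)", where 'a=real] by argo+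
  have lowB': "m / \<alpha> - L / 20000 \<le> card B" "card B \<le> m / \<alpha> + L / 20000"
    using cA(2) B0B st(3,4) TL Lpos of_nat_0_le_iff[of "card (B0 - B)", where 'a=real] by argo+
  have subV: "A \<subseteq> V" "B \<subseteq> V" "A \<inter> B = {}"
    using AB pU dAB by (auto simp: A0_def B0_def U_def)
  have cAB: "card A + card B \<le> n"
  proof -
    have "card A + card B = card (A \<union> B)"
      using subV g(4) by (simp add: card_Un_disjoint finite_subset)
    also have "\<dots> \<le> card V" using subV g(4) by (intro card_mono) auto
    finally show ?thesis using g(2) by simp
  qed
  have p: "1 \<le> lp" "lp \<le> 3 / 2" "1 / 3 \<le> lr" "lr \<le> 1 / 2" using log_bounds by linarith+
  have cs: "cost m \<alpha> = \<alpha> * lp + (m / \<alpha>) * lr" by (simp add: cost_def)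
  have fin4: "4 \<le> L / 20000" using L43 by simp
  have sc: "L / 20000 * lp \<le> L / 20000 * (3 / 2)" "L / 20000 * lr \<le> L / 20000 * (1 / 2)"
    using p Lpos by (intro mult_left_mono; simp)+
  have ebound: "exp (n * lp - X) \<le> ?f * exp (L / 2000)" if "cost m \<alpha> + 4 - L / 2000 \<le> X" for X
  proof -
    have "exp (n * lp - X) \<le> exp ((n * lp - cost m \<alpha> - 4) + L / 2000)" using that by simp
    also have "\<dots> = exp (n * lp - cost m \<alpha> - 4) * exp (L / 2000)" by (rule exp_add)
    also have "\<dots> \<le> ?f * exp (L / 2000)" using low by (intro mult_right_mono) auto
    finally show ?thesis .
  qed
  have "core_graph V E A B L"
  proof
    show "simple_graph V E" by (rule g)
    show "A \<subseteq> V" "B \<subseteq> V" "A \<inter> B = {}" by (rule subV)+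
    show "L / 2 \<le> card A" "card A \<le> 3 * L" using lowA' al55 al(2) Lpos by argo+
    show "L / 2 \<le> card B" "card B \<le> 3 * L" using lowB' al(3,4) Lpos by argo+
    show "card {w \<in> B. {v, w} \<notin> E} \<le> L / 2000" if "v \<in> A" for v
    proof -
      have "card {w \<in> B. {v, w} \<notin> E} \<le> card {w \<in> B0. {v, w} \<notin> E}"
        by (rule card_mono) (use finAB AB in auto)
      then show ?thesis using that by (simp add: A_def K_def)
    qed
    show "card {w \<in> A. {v, w} \<notin> E} \<le> L / 2000" if "v \<in> B" for v
    proof -
      have "card {w \<in> A. {v, w} \<notin> E} \<le> card {w \<in> A0. {v, w} \<notin> E}"
        by (rule card_mono) (use finAB AB in auto)
      then show ?thesis using that by (simp add: B_def K_def)
    qed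
    show "card {v \<in> V - A - B. \<exists>w\<in>V. {v, w} \<in> E} \<le> L / 2000"
    proof -
      have "{v \<in> V - A - B. \<exists>w\<in>V. {v, w} \<in> E} = U - (A \<union> B)" by (auto simp: U_def)
      moreover have "card (U - (A \<union> B)) = card U - (card A + card B)"
      proof -
        have "A \<union> B \<subseteq> U" using AB pU by (auto simp: A0_def B0_def)
        then show ?thesis using finU subV(3) finAB AB
          by (subst card_Diff_subset) (auto simp: card_Un_disjoint finite_subset)
      qed
      moreover have "real (card U - (card A + card B)) \<le> L / 2000"
      proof -
        have "real (card U) - (real (card A) + real (card B)) \<le> L / 2000"
          using cU cA A0A B0B st(2) TL Lpos by argo
        then show ?thesis using Lpos by (simp add: of_nat_diff_if)
      qed
      ultimately show ?thesis by simp
    qed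
    show "2 ^ card B * 3 ^ (card V - card A - card B) \<le> ?f * exp (L / 2000)"
    proof -
      have 1: "(\<alpha> - L / 20000) * lp \<le> card A * lp" using lowA' p by (intro mult_right_mono) auto
      have 2: "(m / \<alpha> - L / 20000) * lr \<le> card B * lr" using lowB' p by (intro mult_right_mono) auto
      have "cost m \<alpha> + 4 - L / 2000 \<le> card A * lp + card B * lr"
        using 1 2 sc fin4 Lpos unfolding cs left_diff_distrib by argo
      then show ?thesis using ebound[of "card A * lp + card B * lr"] powers_exp[OF cAB] g(2) by (simp add: algebra_simps)
    qed
    show "2 ^ card A * 3 ^ (card V - card A - card B) \<le> ?f * exp (L / 2000)"
    proof -
      have 1: "(\<alpha> - L / 20000) * lr \<le> card A * lr" using lowA' p by (intro mult_right_mono) auto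
      have 2: "(m / \<alpha> - L / 20000) * lp \<le> card B * lp" using lowB' p by (intro mult_right_mono) auto
      \<comment> \<open>For the exchanged roles: giving single colours to the larger side only
        raises the cost, so this bound follows from the same estimate.\<close>
      have "\<alpha> \<le> m / \<alpha>" using al(2,4) by linarith
      then have "0 \<le> (m / \<alpha> - \<alpha>) * (lp - lr)" using p by (intro mult_nonneg_nonneg) auto
      then have "\<alpha> * lp + (m / \<alpha>) * lr \<le> \<alpha> * lr + (m / \<alpha>) * lp" by (simp add: algebra_simps)
      then have "cost m \<alpha> + 4 - L / 2000 \<le> card B * lp + card A * lr"
        using 1 2 sc fin4 Lpos unfolding cs left_diff_distrib by argo
      moreover have "card B + card A \<le> n" using cAB by simp
      moreover have "n - card A - card B = n - card B - card A" by simp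
      ultimately show ?thesis
        using ebound[of "card B * lp + card A * lr"] powers_exp[of "card B" "card A" n] g(2) by (simp add: algebra_simps)
    qed
    show "10 ^ 8 \<le> L" using L43 by simp
  qed
  then show ?thesis by blast
qed

section \<open>Asymptotics\<close>

lemma maximizer_structure:
  "\<exists>M. \<forall>(m :: nat) n (V :: 'a set) E. M \<le> m \<longrightarrow> 4 * m \<le> n\<^sup>2 \<longrightarrow> maximizes_colorings 3 n m V E \<longrightarrow>
     (\<exists>a b. semi_complete_plus_isolated a b V E \<or> complete_bipartite_plus_pendant a b V E)"
proof -
  define x :: real where "x = 1 / exp (1 / 10 ^ 22)"
  have x: "0 < x" "x < 1" by (simp_all add: x_def)
  then obtain D where D: "x ^ D < 1 - x" using real_arch_pow_inv[of "1 - x" x] by auto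
  define M where "M = (10 ^ 43 * (D + 1))\<^sup>2"
  have "\<exists>a b. semi_complete_plus_isolated a b V E \<or> complete_bipartite_plus_pendant a b V E"
    if m: "M \<le> m" "4 * m \<le> n\<^sup>2" and mx: "maximizes_colorings 3 n m V E" for m n and V :: "'a set" and E
  proof -
    have "(10 ^ 43 * (real D + 1))\<^sup>2 = real M" by (simp add: M_def)
    also have "\<dots> \<le> real m" using m by simp
    finally have L: "10 ^ 43 * (real D + 1) \<le> sqrt m" by (rule real_le_rsqrt)
    have D': "1 / exp (1 / 10 ^ 22) + (1 / exp (1 / 10 ^ 22)) ^ D \<le> (1::real)"
      using D unfolding x_def by linarith
    obtain A B where "core_graph V E A B (sqrt m)"
      using maximizer_core[OF mx m(2) D' refl L] by blast
    then obtain A' X S I where "decomposed_graph V E A' X S I (sqrt m)"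
      using core_graph.decomposition by blast
    then have "extremal_graph V E A' X S I (sqrt m) m n"
      by (intro extremal_graph.intro extremal_graph_axioms.intro mx m(2))
    then show ?thesis by (rule extremal_graph.extremal_structure)
  qed
  then show ?thesis by blast
qed

text \<open>A weak description common to both shapes and sufficient for the asymptotics: almost all
  of a K_{a,b} is present, and the edge count is close to a b.\<close>

lemma shape_bipartite:
  assumes fin: "finite V" "finite E"
    and sh: "semi_complete_plus_isolated a b V E \<or> complete_bipartite_plus_pendant a b V E"
  obtains A B D where "1 \<le> a" "a \<le> b" "A \<subseteq> V" "B \<subseteq> V" "A \<inter> B = {}" "card A = a" "card B = b"
    "D \<subseteq> bip A B" "card D < a" "bip A B - D \<subseteq> E" "card E \<le> a * b + 1" "a * b \<le> card E + a"
  using sh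
proof
  assume "semi_complete_plus_isolated a b V E"
  then obtain W E0 D where W: "W \<subseteq> V" "1 \<le> a" "a \<le> b" "complete_bipartite a b W E0" "D \<subseteq> E0" "card D < a" "E = E0 - D"
    unfolding semi_complete_plus_isolated_def semi_complete_def by blast
  obtain A B where AB: "finite A" "finite B" "A \<inter> B = {}" "W = A \<union> B" "card A = a" "card B = b" "E0 = bip A B"
    using W(4) unfolding complete_bipartite_def bip_def by blast
  have c: "card E0 = a * b" using card_bip[OF AB(3)] AB by simp
  have "finite E0" using AB by simp
  then have "card E = a * b - card D" using W c by (simp add: card_Diff_subset finite_subset)
  then show ?thesis using that[of A B D] W AB by auto
next
  assume "complete_bipartite_plus_pendant a b V E"
  then obtain W E0 u v where W: "1 \<le> a" "a \<le> b" "complete_bipartite a b W E0" "V = insert v W" "E = insert {u, v} E0"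
    unfolding complete_bipartite_plus_pendant_def by blast
  obtain A B where AB: "finite A" "finite B" "A \<inter> B = {}" "W = A \<union> B" "card A = a" "card B = b" "E0 = bip A B"
    using W(3) unfolding complete_bipartite_def bip_def by blast
  have c: "card E0 = a * b" using card_bip[OF AB(3)] AB by simp
  have "card E \<le> a * b + 1" unfolding W(5) using card_insert_le_m1[of "a * b + 1" E0 "{u, v}"] c by simp
  moreover have "a * b \<le> card E" unfolding c[symmetric] by (rule card_mono) (use fin W(5) in auto)
  ultimately show ?thesis using that[of A B "{}"] W AB by auto
qed

text \<open>The deleted edges number fewer than a \<le> b, so their rectangles add at most 6 * 2^b
  to the 6 * 2^b from the two constant sides; the shape thus fixes the count up to a
  constant.\<close>

lemma shape_upper:
  assumes mx: "maximizes_colorings 3 n m V E"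
    and sh: "semi_complete_plus_isolated a b V E \<or> complete_bipartite_plus_pendant a b V E"
  shows "1 \<le> a" "a \<le> b" "a + b \<le> n" "m \<le> a * b + 1" "a * b \<le> m + a"
    "real (num_colorings 3 V E) \<le> 12 * (2 ^ b * 3 ^ (n - a - b))"
proof -
  have g: "simple_graph V E" "card V = n" "card E = m" "finite V"
    using mx by (auto simp: maximizes_colorings_def graph_with_def simple_graph_def)
  have "finite E" using g unfolding simple_graph_def by (metis finite_imp_finite_nsets finite_subset)
  then obtain A B D where s: "1 \<le> a" "a \<le> b" "A \<subseteq> V" "B \<subseteq> V" "A \<inter> B = {}" "card A = a" "card B = b"
    "D \<subseteq> bip A B" "card D < a" "bip A B - D \<subseteq> E" "card E \<le> a * b + 1" "a * b \<le> card E + a"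
    using shape_bipartite[OF g(4) _ sh] by metis
  show "1 \<le> a" "a \<le> b" "m \<le> a * b + 1" "a * b \<le> m + a" using s g by simp_all
  have "card (A \<union> B) = a + b" using s g by (simp add: card_Un_disjoint finite_subset)
  moreover have "card (A \<union> B) \<le> card V" using s g by (intro card_mono) auto
  ultimately show "a + b \<le> n" using g by simp
  let ?r = "n - a - b"
  have "card (cols3 V E) \<le> card (cols3 V (bip A B - D))"
  proof (rule card_mono)
    show "finite (cols3 V (bip A B - D))" using g(4) by simp
    show "cols3 V E \<subseteq> cols3 V (bip A B - D)" using s(10) by (auto simp: list_colorings_def)
  qed
  also have "\<dots> \<le> (3 * 2 ^ b + 3 * 2 ^ a) * 3 ^ ?r + 6 * (2 ^ card D - 1) * 3 ^ ?r"
  proof -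
    have "card D < card A" "card D < card B" using s by simp_all
    from card_bip_minus_le(1)[OF g(4) s(3-5,8) this refl] show ?thesis unfolding s g by linarith
  qed
  also have "\<dots> \<le> (3 * 2 ^ b + 3 * 2 ^ b) * 3 ^ ?r + 6 * 2 ^ b * 3 ^ ?r"
  proof -
    have "(2::nat) ^ a \<le> 2 ^ b" "(2::nat) ^ card D \<le> 2 ^ b" using s by (intro power_increasing; simp)+
    moreover from this(2) have "(2::nat) ^ card D - 1 \<le> 2 ^ b" by linarith
    ultimately show ?thesis by (intro add_mono mult_right_mono mult_left_mono) auto
  qed
  also have "\<dots> = 12 * (2 ^ b * 3 ^ ?r)" by simp
  finally have "card (cols3 V E) \<le> 12 * (2 ^ b * 3 ^ ?r)" .
  then have "real (card (cols3 V E)) \<le> real (12 * (2 ^ b * 3 ^ ?r))" by (rule of_nat_mono)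
  then show "real (num_colorings 3 V E) \<le> 12 * (2 ^ b * 3 ^ (n - a - b))"
    unfolding num_colorings_cols3[OF g(1)] by simp
qed

text \<open>The rounded competitor and \<open>shape_upper\<close> enclose the count, so the cost of
  \<open>a\<close> is within a constant of the minimum. Quadratic growth turns this into an error of
  order sqrt L = m^(1/4), which is \<open>s\<close>.\<close>

lemma shape_asymptotics:
  fixes V :: "'a set"
  assumes mx: "maximizes_colorings 3 n m V E" and m: "16 \<le> m" "4 * m \<le> n\<^sup>2" and c: "center m n \<alpha>"
    and sh: "semi_complete_plus_isolated a b V E \<or> complete_bipartite_plus_pendant a b V E"
  defines "s \<equiv> sqrt (sqrt (real m))" and "f \<equiv> real (num_colorings 3 V E)"
  shows "0 < f" "\<bar>a - \<alpha>\<bar> \<le> 5 * s" "\<bar>b - m / \<alpha>\<bar> \<le> 50 * s"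
    "\<bar>ln f - (n * lp - cost m \<alpha>)\<bar> \<le> 9" "\<bar>ln f - (n * lp - a * lp - b * lr)\<bar> \<le> 9"
proof -
  note sh' = shape_upper[OF mx sh]
  have m': "real m > 0" "4 * real m \<le> (real n)\<^sup>2" "real n > 0"
  proof -
    show "real m > 0" using m by simp
    show *: "4 * real m \<le> (real n)\<^sup>2" using m(2) by (metis of_nat_le_iff of_nat_mult of_nat_numeral of_nat_power)
    show "real n > 0" using * \<open>real m > 0\<close> by (cases n) auto
  qed
  define L where "L = sqrt (real m)"
  have p: "1 \<le> lp" "lp \<le> 3 / 2" "1 / 3 \<le> lr" "lr \<le> 1 / 2" using log_bounds by linarith+
  have L1: "1 \<le> L" using m by (simp add: L_def)
  have LL: "L * L = m" by (simp add: L_def)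
  have s1: "1 \<le> s" "s * s = L" using L1 by (simp_all add: s_def L_def)
  have low: "exp (n * lp - cost m \<alpha> - 4) \<le> f" unfolding f_def by (rule maximizer_lower[OF mx m c])
  show f0: "0 < f" using low by (rule less_le_trans[OF exp_gt_zero])
  have lnlow: "n * lp - cost m \<alpha> - 4 \<le> ln f" using low f0 by (simp add: ln_ge_iff)
  have "ln f \<le> ln (12 * exp (n * lp - a * lp - b * lr))"
    using sh'(6) f0 unfolding f_def powers_exp[OF sh'(3)] by simp
  also have "\<dots> = ln 12 + (n * lp - a * lp - b * lr)" by (simp add: ln_mult)
  also have "ln (12::real) \<le> ln (3 ^ 3)" by (rule ln_mono) simp_all
  also have "ln ((3::real) ^ 3) = 3 * lp" by (subst ln_realpow) simp_all
  finally have lnup: "ln f \<le> 9 / 2 + (n * lp - a * lp - b * lr)" using p by simp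
  have a1: "1 \<le> real a" using sh' by simp
  have "real m \<le> real (a * b + 1)" "real (a * b) \<le> real (m + a)" using sh' by (simp_all only: of_nat_mono)
  then have ab: "real m \<le> real a * b + 1" "real a * b \<le> real m + a" by simp_all
  have ma: "m / a \<le> b + 1"
  proof -
    have "real m \<le> (b + 1) * a" using ab a1 by (simp add: algebra_simps)
    then show ?thesis using a1 by (simp add: field_simps)
  qed
  have cst: "cost m a \<le> a * lp + b * lr + 1 / 2"
  proof -
    have "lr * (m / a) \<le> lr * (b + 1)" using ma p by (intro mult_left_mono) auto
    then show ?thesis using p unfolding cost_def by (simp add: algebra_simps)
  qed
  have an: "real m - 1 \<le> a * (real n - a)"
  proof -
    have "real a * b \<le> a * (real n - a)" using sh'(3) by (intro mult_left_mono) auto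
    then show ?thesis using ab by linarith
  qed
  have st: "cost m \<alpha> - lp * sqrt 1 \<le> cost m a" "(a - \<alpha>)\<^sup>2 \<le> 1 \<or> lp * (a - \<alpha>)\<^sup>2 \<le> a * (cost m a - cost m \<alpha>)"
    using cost_stability[OF c m', of "real a" 1] a1 an by simp_all
  have aL: "a \<le> 2 * L"
  proof (rule ccontr)
    assume "\<not> a \<le> 2 * L"
    then have "L + 1 < a" using L1 by linarith
    then have "(L + 1) * L < real a * (real a - 1)" using L1 by (intro mult_strict_mono) auto
    moreover have "real a * a \<le> real a * b" using sh' by (intro mult_left_mono) auto
    ultimately show False using ab LL L1 by (simp add: algebra_simps)
  qed
  have "(a - \<alpha>)\<^sup>2 \<le> 25 * L"
    using st(2)
  proof
    assume "(a - \<alpha>)\<^sup>2 \<le> 1" then show ?thesis using L1 by linarith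
  next
    assume *: "lp * (a - \<alpha>)\<^sup>2 \<le> a * (cost m a - cost m \<alpha>)"
    have "1 * (a - \<alpha>)\<^sup>2 \<le> lp * (a - \<alpha>)\<^sup>2" using p by (intro mult_right_mono) auto
    also note *
    also have "a * (cost m a - cost m \<alpha>) \<le> a * (9 :: real)" using cst lnlow lnup by (intro mult_left_mono) auto
    finally show ?thesis using aL L1 by linarith
  qed
  also have "25 * L = (5 * s)\<^sup>2" using s1 by (simp add: power2_eq_square)
  finally show A: "\<bar>a - \<alpha>\<bar> \<le> 5 * s" using s1 abs_le_square_iff[of "a - \<alpha>" "5 * s"] by simp
  have eq: "cost m \<alpha> = \<alpha> * lp + (m / \<alpha>) * lr" by (simp add: cost_def)
  have up: "cost m \<alpha> \<le> a * lp + b * lr + 2" using st(1) cst p by simp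
  show "\<bar>ln f - (n * lp - cost m \<alpha>)\<bar> \<le> 9" "\<bar>ln f - (n * lp - a * lp - b * lr)\<bar> \<le> 9"
    using lnlow lnup up by linarith+
  \<comment> \<open>\<open>ln f\<close> fixes \<open>a * lp + b * lr\<close> up to a constant, so
    the error of \<open>b\<close> is a multiple of that of \<open>a\<close>.\<close>
  have "\<bar>b - m / \<alpha>\<bar> * (1 / 3) \<le> \<bar>b - m / \<alpha>\<bar> * lr" using p by (intro mult_left_mono) auto
  also have "\<dots> = \<bar>(b - m / \<alpha>) * lr\<bar>" using p by (simp add: abs_mult)
  also have "\<dots> \<le> \<bar>(a - \<alpha>) * lp\<bar> + 17 / 2"
    using lnlow lnup up unfolding eq left_diff_distrib by linarith
  also have "\<bar>(a - \<alpha>) * lp\<bar> = \<bar>a - \<alpha>\<bar> * lp" using p by (simp add: abs_mult)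
  also have "\<bar>a - \<alpha>\<bar> * lp + 17 / 2 \<le> 5 * s * (3 / 2) + 17 / 2"
    using A p by (intro add_right_mono mult_mono) auto
  finally have "\<bar>b - m / \<alpha>\<bar> * (1 / 3) \<le> 15 / 2 * s + 17 / 2" by simp
  then have "\<bar>b - m / \<alpha>\<bar> \<le> 45 / 2 * s + 51 / 2" by argo
  then show "\<bar>b - m / \<alpha>\<bar> \<le> 50 * s" using s1(1) by argo
qed

section \<open>The sparse and the dense regime\<close>

lemma relative_error:
  assumes "\<bar>x - y\<bar> \<le> K * s" "K \<le> 100" "s * s = L" "0 < s" "L / 2 \<le> y"
  shows "\<exists>e. \<bar>e\<bar> \<le> 200 / s \<and> x = (1 + e) * (y :: real)"
proof (intro exI conjI)
  have "0 < L" using assms by (metis mult_pos_pos)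
  then have y: "0 < y" using assms by linarith
  show "x = (1 + (x - y) / y) * y" using y by (simp add: field_simps)
  have "\<bar>x - y\<bar> * s \<le> 100 * s * s" using assms by (intro mult_right_mono order_trans[OF assms(1)]) auto
  also have "\<dots> \<le> 200 * y" using assms by (simp add: mult.assoc)
  finally show "\<bar>(x - y) / y\<bar> \<le> 200 / s" using y assms by (simp add: field_simps)
qed

lemma sparse_asymptotics:
  assumes mx: "maximizes_colorings 3 n m V E" and m: "16 \<le> m" "4 * m \<le> n\<^sup>2" "real m \<le> kappa3 * (real n)\<^sup>2"
    and sh: "semi_complete_plus_isolated a b V E \<or> complete_bipartite_plus_pendant a b V E"
  defines "\<delta> \<equiv> 200 / sqrt (sqrt (real m))"
  shows "\<exists>e1 e2 e3. \<bar>e1\<bar> \<le> \<delta> \<and> \<bar>e2\<bar> \<le> \<delta> \<and> \<bar>e3\<bar> \<le> \<delta> \<and>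
      real a = (1 + e1) * sqrt (real m * (ln (3/2) / ln 3)) \<and>
      real b = (1 + e2) * sqrt (real m * (ln 3 / ln (3/2))) \<and>
      real (num_colorings 3 V E) = 3 ^ n * exp (- (2 * sqrt (ln (3/2) * ln 3) + e3) * sqrt (real m))"
proof -
  let ?f = "real (num_colorings 3 V E)"
  define u where "u = sparse_opt m"
  have c: "center m n u" using m by (simp add: center_def u_def)
  note as = shape_asymptotics[OF mx m(1,2) c sh]
  define s where "s = sqrt (sqrt (real m))"
  define L where "L = sqrt (real m)"
  have p: "lp > 0" "lr > 0" using log_bounds by linarith+
  have mpos: "real m > 0" using m by simp
  have L1: "1 \<le> L" using m by (simp add: L_def)
  have s1: "1 \<le> s" "s * s = L" using L1 by (simp_all add: s_def L_def)
  note ub = sparse_opt_bounds[OF mpos, folded u_def L_def]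
  have v: "m / u = sqrt (m * (lp / lr))"
  proof -
    have "u * sqrt (m * (lp / lr)) = sqrt ((m * (lr / lp)) * (m * (lp / lr)))"
      unfolding u_def sparse_opt_def by (rule real_sqrt_mult[symmetric])
    also have "(m * (lr / lp)) * (m * (lp / lr)) = (real m)\<^sup>2" using p by (simp add: power2_eq_square)
    finally show ?thesis using ub(1) by (simp add: field_simps)
  qed
  have "L * u \<le> L * L" using ub L1 by (intro mult_left_mono) auto
  then have vL: "L \<le> m / u" using ub(1) by (simp add: L_def field_simps)
  obtain e1 where e1: "\<bar>e1\<bar> \<le> 200 / s" "real a = (1 + e1) * u"
    using relative_error[OF as(2)[folded s_def] _ s1(2)] s1 ub by auto
  obtain e2 where e2: "\<bar>e2\<bar> \<le> 200 / s" "real b = (1 + e2) * (m / u)"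
  proof -
    have "L / 2 \<le> m / u" "(50::real) \<le> 100" "0 < s" using vL L1 s1 by linarith+
    from relative_error[OF as(3)[folded s_def] this(2) s1(2) this(3,1)] that show ?thesis by metis
  qed
  have cu: "cost m u = 2 * sqrt (lr * lp) * L"
  proof -
    have "u * lp = sqrt (m * (lr / lp)) * sqrt (lp * lp)" using p by (simp add: u_def sparse_opt_def)
    also have "\<dots> = sqrt (m * (lr * lp))" unfolding real_sqrt_mult[symmetric] using p by simp
    finally have 1: "u * lp = sqrt (lr * lp) * L" by (simp add: real_sqrt_mult L_def)
    have "(m / u) * lr = sqrt (m * (lp / lr)) * sqrt (lr * lr)" unfolding v using p by simp
    also have "\<dots> = sqrt (m * (lr * lp))" unfolding real_sqrt_mult[symmetric] using p by (simp add: mult.commute)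
    finally have 2: "(m / u) * lr = sqrt (lr * lp) * L" by (simp add: real_sqrt_mult L_def)
    show ?thesis using 1 2 by (simp add: cost_def mult.commute)
  qed
  define e3 where "e3 = (n * lp - cost m u - ln ?f) / L"
  have "\<bar>e3\<bar> \<le> 9 / L" using as(4) L1 by (simp add: e3_def divide_right_mono)
  also have "\<dots> \<le> 200 / s"
  proof -
    have "s * 1 \<le> s * s" using s1 by (intro mult_left_mono) auto
    then have "9 * s \<le> 200 * L" using s1 by linarith
    then show ?thesis using s1 L1 by (simp add: field_simps)
  qed
  finally have e3: "\<bar>e3\<bar> \<le> 200 / s" .
  have "e3 * L = n * lp - cost m u - ln ?f" using L1 by (simp add: e3_def)
  then have "ln ?f = n * lp + (- (2 * sqrt (lr * lp) + e3) * L)" unfolding cu by (simp add: algebra_simps)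
  then have "?f = exp (n * lp + (- (2 * sqrt (lr * lp) + e3) * L))" using as(1) by (metis exp_ln)
  also have "\<dots> = 3 ^ n * exp (- (2 * sqrt (lr * lp) + e3) * L)" unfolding exp_add by (simp add: exp_of_nat_mult)
  finally have f: "?f = 3 ^ n * exp (- (2 * sqrt (lr * lp) + e3) * sqrt (real m))" unfolding L_def .
  show ?thesis
  proof (intro exI conjI)
    show "\<bar>e1\<bar> \<le> \<delta>" "\<bar>e2\<bar> \<le> \<delta>" "\<bar>e3\<bar> \<le> \<delta>"
      using e1(1) e2(1) e3 unfolding \<delta>_def s_def .
    show "real a = (1 + e1) * sqrt (real m * (lr / lp))" using e1(2) unfolding u_def sparse_opt_def .
    show "real b = (1 + e2) * sqrt (real m * (lp / lr))" using e2(2) unfolding v .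
    show "?f = 3 ^ n * exp (- (2 * sqrt (lr * lp) + e3) * sqrt (real m))" by (rule f)
  qed
qed

text \<open>The constraint is tight, \<alpha> + m / \<alpha> = n, so only O(m^(1/4)) vertices lie
  outside K_{a,b}; their powers of 3 and the bounded factor disappear in 2^(o(n)).\<close>

lemma dense_asymptotics:
  assumes mx: "maximizes_colorings 3 n m V E" and m: "16 \<le> m" "4 * m \<le> n\<^sup>2" "kappa3 * (real n)\<^sup>2 \<le> real m"
    and sh: "semi_complete_plus_isolated a b V E \<or> complete_bipartite_plus_pendant a b V E"
  defines "\<delta> \<equiv> 200 / sqrt (sqrt (real m))"
  shows "\<exists>e1 e2 e3. \<bar>e1\<bar> \<le> \<delta> \<and> \<bar>e2\<bar> \<le> \<delta> \<and> \<bar>e3\<bar> \<le> \<delta> \<and>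
      real a = (1 + e1) * ((real n - sqrt ((real n)\<^sup>2 - 4 * real m)) / 2) \<and>
      real b = (1 + e2) * ((real n + sqrt ((real n)\<^sup>2 - 4 * real m)) / 2) \<and>
      real (num_colorings 3 V E) = 2 powr (real b + e3 * real n)"
proof -
  let ?f = "real (num_colorings 3 V E)"
  define \<alpha> where "\<alpha> = (real n - sqrt ((real n)\<^sup>2 - 4 * real m)) / 2"
  have c: "center m n \<alpha>" using m by (simp add: center_def \<alpha>_def)
  note as = shape_asymptotics[OF mx m(1,2) c sh]
  note sh' = shape_upper[OF mx sh]
  have m': "real m > 0" "4 * real m \<le> (real n)\<^sup>2" "real n > 0"
  proof -
    show "real m > 0" using m by simp
    show *: "4 * real m \<le> (real n)\<^sup>2" using m(2) by (metis of_nat_le_iff of_nat_mult of_nat_numeral of_nat_power)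
    show "real n > 0" using * \<open>real m > 0\<close> by (cases n) auto
  qed
  define s where "s = sqrt (sqrt (real m))"
  define L where "L = sqrt (real m)"
  have p: "1 \<le> lp" "lp \<le> 3 / 2" "1 / 2 \<le> ln (2::real)" "lp = lr + ln 2" using log_bounds by linarith+
  have L1: "1 \<le> L" using m by (simp add: L_def)
  have s1: "1 \<le> s" "s * s = L" using L1 by (simp_all add: s_def L_def)
  note al = cost_center_le[OF c m', folded L_def]
  have prod: "\<alpha> * (real n - \<alpha>) = m"
  proof -
    have q: "sqrt ((real n)\<^sup>2 - 4 * real m) * sqrt ((real n)\<^sup>2 - 4 * real m) = (real n)\<^sup>2 - 4 * real m"
      using m' by simp
    show ?thesis using q unfolding \<alpha>_def by (simp add: field_simps power2_eq_square)
  qed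
  have \<alpha>: "\<alpha> > 0" using al L1 by linarith
  have v: "m / \<alpha> = real n - \<alpha>" using prod \<alpha> by (simp add: field_simps)
  have v': "m / \<alpha> = (real n + sqrt ((real n)\<^sup>2 - 4 * real m)) / 2" unfolding v by (simp add: \<alpha>_def field_simps)
  have nL: "L \<le> n" using al(4) \<alpha> v by linarith
  obtain e1 where e1: "\<bar>e1\<bar> \<le> 200 / s" "real a = (1 + e1) * \<alpha>"
    using relative_error[OF as(2)[folded s_def] _ s1(2)] s1 al by auto
  obtain e2 where e2: "\<bar>e2\<bar> \<le> 200 / s" "real b = (1 + e2) * (m / \<alpha>)"
  proof -
    have "L / 2 \<le> m / \<alpha>" "(50::real) \<le> 100" "0 < s" using al L1 s1 by linarith+
    from relative_error[OF as(3)[folded s_def] this(2) s1(2) this(3,1)] that show ?thesis by metis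
  qed
  define e3 where "e3 = (ln ?f / ln 2 - b) / n"
  have rest: "0 \<le> real n - a - b" "real n - a - b \<le> 55 * s"
    using as(2,3)[folded s_def] v sh'(3) by linarith+
  have "\<bar>ln ?f - b * ln 2\<bar> \<le> (real n - a - b) * lp + 9"
  proof -
    have "n * lp - a * lp - b * lr = (real n - a - b) * lp + b * ln 2" unfolding p(4) by (simp add: algebra_simps)
    moreover have "0 \<le> (real n - a - b) * lp" using rest p by simp
    ultimately show ?thesis using as(5) by linarith
  qed
  also have "\<dots> \<le> 55 * s * (3 / 2) + 9" using rest p by (intro add_mono mult_mono) auto
  also have "\<dots> \<le> 100 * s" using s1 by simp
  finally have d: "\<bar>ln ?f - b * ln 2\<bar> \<le> 100 * s" .
  have e3eq: "e3 * n * ln 2 = ln ?f - b * ln 2" using m'(3) p by (simp add: e3_def field_simps)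
  have "\<bar>e3\<bar> * n * (1 / 2) \<le> \<bar>e3\<bar> * n * ln 2" using p by (intro mult_left_mono) auto
  also have "\<dots> = \<bar>e3 * n * ln 2\<bar>" using p by (simp add: abs_mult)
  also have "\<dots> \<le> 100 * s" unfolding e3eq by (rule d)
  finally have "\<bar>e3\<bar> * n \<le> 200 * s" by simp
  moreover have "\<bar>e3\<bar> * L \<le> \<bar>e3\<bar> * n" using nL by (intro mult_left_mono) auto
  ultimately have "(\<bar>e3\<bar> * s) * s \<le> 200 * s" using s1 by (simp add: mult.assoc)
  then have "\<bar>e3\<bar> * s \<le> 200" using s1 by (simp only: mult_le_cancel_right_pos)
  then have e3: "\<bar>e3\<bar> \<le> 200 / s" using s1 by (simp add: field_simps)
  have "ln ?f = (b + e3 * n) * ln 2" using e3eq by (simp add: algebra_simps)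
  then have "?f = exp ((b + e3 * n) * ln 2)" using as(1) by (metis exp_ln)
  then have f: "?f = 2 powr (real b + e3 * real n)" by (simp add: powr_def)
  show ?thesis
  proof (intro exI conjI)
    show "\<bar>e1\<bar> \<le> \<delta>" "\<bar>e2\<bar> \<le> \<delta>" "\<bar>e3\<bar> \<le> \<delta>"
      using e1(1) e2(1) e3 unfolding \<delta>_def s_def .
    show "real a = (1 + e1) * ((real n - sqrt ((real n)\<^sup>2 - 4 * real m)) / 2)" using e1(2) unfolding \<alpha>_def .
    show "real b = (1 + e2) * ((real n + sqrt ((real n)\<^sup>2 - 4 * real m)) / 2)" using e2(2) unfolding v' .
    show "?f = 2 powr (real b + e3 * real n)" by (rule f)
  qed
qed

theorem theorem1p3:
  shows "\<exists>(M :: nat) (\<delta> :: nat \<Rightarrow> nat \<Rightarrow> real).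
    ((\<lambda>(m, n). \<delta> m n) \<longlongrightarrow> 0) (at_top \<times>\<^sub>F at_top) \<and>
    (\<forall>(m :: nat) (n :: nat) (V :: 'a set) (E :: 'a set set).
       m \<ge> M \<longrightarrow> real m \<le> (real n)\<^sup>2 / 4 \<longrightarrow> maximizes_colorings 3 n m V E \<longrightarrow>
       (\<exists>a b. semi_complete_plus_isolated a b V E \<or> complete_bipartite_plus_pendant a b V E) \<and>
       (\<forall>a b. semi_complete_plus_isolated a b V E \<or> complete_bipartite_plus_pendant a b V E \<longrightarrow>
          (real m \<le> kappa3 * (real n)\<^sup>2 \<longrightarrow>
             (\<exists>e1 e2 e3. \<bar>e1\<bar> \<le> \<delta> m n \<and> \<bar>e2\<bar> \<le> \<delta> m n \<and> \<bar>e3\<bar> \<le> \<delta> m n \<and>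
                real a = (1 + e1) * sqrt (real m * (ln (3/2) / ln 3)) \<and>
                real b = (1 + e2) * sqrt (real m * (ln 3 / ln (3/2))) \<and>
                real (num_colorings 3 V E) =
                  3 ^ n * exp (- (2 * sqrt (ln (3/2) * ln 3) + e3) * sqrt (real m)))) \<and>
          (kappa3 * (real n)\<^sup>2 \<le> real m \<longrightarrow>
             (\<exists>e1 e2 e3. \<bar>e1\<bar> \<le> \<delta> m n \<and> \<bar>e2\<bar> \<le> \<delta> m n \<and> \<bar>e3\<bar> \<le> \<delta> m n \<and>
                real a = (1 + e1) * ((real n - sqrt ((real n)\<^sup>2 - 4 * real m)) / 2) \<and>
                real b = (1 + e2) * ((real n + sqrt ((real n)\<^sup>2 - 4 * real m)) / 2) \<and>
                real (num_colorings 3 V E) = 2 powr (real b + e3 * real n)))))"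
proof -
  obtain M where M: "\<And>m n (V :: 'a set) E. M \<le> m \<Longrightarrow> 4 * m \<le> n\<^sup>2 \<Longrightarrow> maximizes_colorings 3 n m V E \<Longrightarrow>
     \<exists>a b. semi_complete_plus_isolated a b V E \<or> complete_bipartite_plus_pendant a b V E"
    using maximizer_structure by blast
  \<comment> \<open>One error function serves all three quantities in both regimes; it depends on
    \<open>m\<close> alone, so convergence along the product filter follows from the first
    coordinate.\<close>
  define \<delta> :: "nat \<Rightarrow> nat \<Rightarrow> real" where "\<delta> m n = 200 / sqrt (sqrt (real m))" for m n
  have "filterlim (\<lambda>m. sqrt (sqrt (real m))) at_top sequentially"
    by (intro filterlim_compose[OF sqrt_at_top] filterlim_real_sequentially)
  then have "((\<lambda>m :: nat. 200 / sqrt (sqrt (real m))) \<longlongrightarrow> 0) at_top"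
    by (intro tendsto_divide_0[OF tendsto_const] filterlim_at_top_imp_at_infinity)
  moreover have "filterlim fst (at_top :: nat filter) (at_top \<times>\<^sub>F (at_top :: nat filter))"
    unfolding filterlim_def by (rule filtermap_fst_prod_filter)
  ultimately
  have "((\<lambda>p. 200 / sqrt (sqrt (real (fst p)))) \<longlongrightarrow> 0) ((at_top :: nat filter) \<times>\<^sub>F (at_top :: nat filter))"
    by (rule filterlim_compose)
  then have lim: "((\<lambda>(m, n). \<delta> m n) \<longlongrightarrow> 0) (at_top \<times>\<^sub>F at_top)"
    by (simp add: \<delta>_def case_prod_unfold)
  have m4: "4 * m \<le> n\<^sup>2" if "real m \<le> (real n)\<^sup>2 / 4" for m n :: nat
  proof -
    have "real (4 * m) \<le> real (n\<^sup>2)" using that by simp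
    then show ?thesis by (simp only: of_nat_le_iff)
  qed
  show ?thesis
  proof (rule exI[of _ "max 16 M"], rule exI[of _ \<delta>], intro conjI allI impI)
    fix m n and V :: "'a set" and E
    assume a: "max 16 M \<le> m" "real m \<le> (real n)\<^sup>2 / 4" "maximizes_colorings 3 n m V E"
    then have m: "16 \<le> m" "M \<le> m" "4 * m \<le> n\<^sup>2" using m4 by auto
    show "\<exists>a b. semi_complete_plus_isolated a b V E \<or> complete_bipartite_plus_pendant a b V E"
      by (rule M[OF m(2,3) a(3)])
    fix a b
    assume sh: "semi_complete_plus_isolated a b V E \<or> complete_bipartite_plus_pendant a b V E"
    show "\<exists>e1 e2 e3. \<bar>e1\<bar> \<le> \<delta> m n \<and> \<bar>e2\<bar> \<le> \<delta> m n \<and> \<bar>e3\<bar> \<le> \<delta> m n \<and>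
        real a = (1 + e1) * sqrt (real m * (ln (3/2) / ln 3)) \<and>
        real b = (1 + e2) * sqrt (real m * (ln 3 / ln (3/2))) \<and>
        real (num_colorings 3 V E) = 3 ^ n * exp (- (2 * sqrt (ln (3/2) * ln 3) + e3) * sqrt (real m))"
      if "real m \<le> kappa3 * (real n)\<^sup>2"
      unfolding \<delta>_def by (rule sparse_asymptotics[OF a(3) m(1,3) that sh])
    show "\<exists>e1 e2 e3. \<bar>e1\<bar> \<le> \<delta> m n \<and> \<bar>e2\<bar> \<le> \<delta> m n \<and> \<bar>e3\<bar> \<le> \<delta> m n \<and>
        real a = (1 + e1) * ((real n - sqrt ((real n)\<^sup>2 - 4 * real m)) / 2) \<and>
        real b = (1 + e2) * ((real n + sqrt ((real n)\<^sup>2 - 4 * real m)) / 2) \<and>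
        real (num_colorings 3 V E) = 2 powr (real b + e3 * real n)"
      if "kappa3 * (real n)\<^sup>2 \<le> real m"
      unfolding \<delta>_def by (rule dense_asymptotics[OF a(3) m(1,3) that sh])
  qed (rule lim)
qed

end
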